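(* Let $X_1,X_2,\ldots,X_n$ be independent real-valued continuous random variables. Let $S\subset T$ be two nested non-empty random subsets of $[n]=\{1,2,\ldots,n\}$ such that $(S,T)$ is independent of $X=(X_1,X_2,\ldots,X_n)$. Let $R$ be the maximal correlation coefficient between $(S,X_S)$ and $(T,X_T)$, where $X_{S}=(X_i)_{i\in S}$ and $X_{T}=(X_j)_{j\in T}$; it is given by \[R=\max\big(R(S,T),\max(r_j:j\in[n])\big),\] where $R(S,T)$ is the maximal correlation coefficient between $S$ and $T$, and $r_j$ is the best constant $r$ for the inequality \[\sum_{s,t:\,j\in s\cap t}P(S=s,T=t)\alpha_s\beta_t\leq r\sqrt{\sum_{s:\,j\in s}P(S=s)\alpha_s^2}\sqrt{\sum_{t:\,j\in t}P(T=t)\beta_t^2}\quad\text{for all real }\alpha_s,\beta_t.\] Denote by $I(Z)=\int_{-\infty}^{\infty}\frac{(f'(z))^2}{f(z)}\,\mathrm{d}z$ the Fisher information of the continuous random variable $Z$ with the density $f(z)$. Then \[\sum_{t\subset[n]}P(T=t)\,I\Big(\sum_{j\in t}X_j\Big)\mu_t^2\leq R^2\sum_{s\subset[n]}P(S=s)\,I\Big(\sum_{i\in s}X_i\Big)\lambda_s^2,\] where $\mu_t=\sum_{s\subset[n]}P(S=s|T=t)\lambda_s$ for $t\subset[n]$ and $(\lambda_s)_{s\subset[n]}$ is an arbitrary real vector.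
   Context: For two random elements $U,V$ on a common probability space, the maximal correlation coefficient is $R(U,V)=\sup \rho(\varphi(U),\psi(V))$, where $\rho$ denotes the Pearson correlation coefficient and the supremum is over all real-valued measurable functions $\varphi,\psi$ such that $\varphi(U)$ and $\psi(V)$ are square-integrable and non-degenerate; $R(U,V)=0$ if $U$ or $V$ is degenerate. The random element $(S,X_S)$ records the random set $S$ together with the values $X_i$, $i\in S$; equivalently, it is the vector whose $i$-th entry is $X_i$ if $i\in S$ and a special point $\partial\notin\mathbb{R}$ otherwise; likewise for $(T,X_T)$. A continuous random variable is one with a density. *)

theory Defs
  imports "HOL-Probability.Probability"
begin

definition degenerate :: "'a measure \<Rightarrow> ('a \<Rightarrow> 'u) \<Rightarrow> bool" where
  "degenerate M U \<longleftrightarrow> (\<exists>c. AE \<omega> in M. U \<omega> = c)"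

definition pearson :: "'a measure \<Rightarrow> ('a \<Rightarrow> real) \<Rightarrow> ('a \<Rightarrow> real) \<Rightarrow> real" where
  "pearson M A B =
     (\<integral>\<omega>. (A \<omega> - (\<integral>\<omega>. A \<omega> \<partial>M)) * (B \<omega> - (\<integral>\<omega>. B \<omega> \<partial>M)) \<partial>M) /
     (sqrt (\<integral>\<omega>. (A \<omega> - (\<integral>\<omega>. A \<omega> \<partial>M))\<^sup>2 \<partial>M) *
      sqrt (\<integral>\<omega>. (B \<omega> - (\<integral>\<omega>. B \<omega> \<partial>M))\<^sup>2 \<partial>M))"

definition admissible :: "'a measure \<Rightarrow> 'u measure \<Rightarrow> ('a \<Rightarrow> 'u) \<Rightarrow> ('u \<Rightarrow> real) \<Rightarrow> bool" where
  "admissible M MU U \<phi> \<longleftrightarrow>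
     \<phi> \<in> borel_measurable MU \<and>
     integrable M (\<lambda>\<omega>. (\<phi> (U \<omega>))\<^sup>2) \<and>
     \<not> degenerate M (\<lambda>\<omega>. \<phi> (U \<omega>))"

text \<open>The measures \<open>MU\<close> and \<open>MV\<close> only carry the measurable spaces in which \<open>U\<close> and \<open>V\<close> take
  their values.\<close>

definition maximal_correlation ::
  "'a measure \<Rightarrow> 'u measure \<Rightarrow> ('a \<Rightarrow> 'u) \<Rightarrow> 'v measure \<Rightarrow> ('a \<Rightarrow> 'v) \<Rightarrow> real" where
  "maximal_correlation M MU U MV V =
     (if degenerate M U \<or> degenerate M V then 0
      else Sup {pearson M (\<lambda>\<omega>. \<phi> (U \<omega>)) (\<lambda>\<omega>. \<psi> (V \<omega>)) | \<phi> \<psi>.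
                  admissible M MU U \<phi> \<and> admissible M MV V \<psi>})"

text \<open>Independence of two random elements of possibly different types, where
  \<^const>\<open>prob_space.indep_var\<close> requires both to have the same type.\<close>

definition indep_elements ::
  "'a measure \<Rightarrow> 'u measure \<Rightarrow> ('a \<Rightarrow> 'u) \<Rightarrow> 'v measure \<Rightarrow> ('a \<Rightarrow> 'v) \<Rightarrow> bool" where
  "indep_elements M MU U MV V \<longleftrightarrow>
     U \<in> measurable M MU \<and> V \<in> measurable M MV \<and>
     prob_space.indep_set M {U -` A \<inter> space M | A. A \<in> sets MU} {V -` B \<inter> space M | B. B \<in> sets MV}"

text \<open>The extra point is \<^term>\<open>None\<close>, so \<^typ>\<open>real option\<close> is the real line with one isolated
  point adjoined.\<close>

definition option_borel :: "real option measure" where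
  "option_borel = sigma UNIV (insert {None} {Some ` B | B. B \<in> sets borel})"

definition masked :: "nat \<Rightarrow> ('a \<Rightarrow> nat set) \<Rightarrow> (nat \<Rightarrow> 'a \<Rightarrow> real) \<Rightarrow> 'a \<Rightarrow> nat \<Rightarrow> real option" where
  "masked n S X \<omega> = (\<lambda>i\<in>{1..n}. if i \<in> S \<omega> then Some (X i \<omega>) else None)"

abbreviation masked_space :: "nat \<Rightarrow> (nat \<Rightarrow> real option) measure" where
  "masked_space n \<equiv> Pi\<^sub>M {1..n} (\<lambda>_. option_borel)"

text \<open>If \<open>j\<close> almost surely does not belong to \<open>S\<close>, then both sides of the inequality vanish and
  every real \<open>r\<close> satisfies it; the restriction to \<open>r \<ge> 0\<close> makes the best constant 0 in that case
  and has no effect in any other.\<close>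

definition best_constant ::
  "'a measure \<Rightarrow> nat \<Rightarrow> ('a \<Rightarrow> nat set) \<Rightarrow> ('a \<Rightarrow> nat set) \<Rightarrow> nat \<Rightarrow> real" where
  "best_constant M n S T j =
     Inf {r. 0 \<le> r \<and> (\<forall>(\<alpha> :: nat set \<Rightarrow> real) (\<beta> :: nat set \<Rightarrow> real).
       (\<Sum>(s, t) \<in> {(s, t). s \<subseteq> {1..n} \<and> t \<subseteq> {1..n} \<and> j \<in> s \<inter> t}.
           \<P>(\<omega> in M. S \<omega> = s \<and> T \<omega> = t) * \<alpha> s * \<beta> t)
       \<le> r * sqrt (\<Sum>s \<in> {s. s \<subseteq> {1..n} \<and> j \<in> s}. \<P>(\<omega> in M. S \<omega> = s) * (\<alpha> s)\<^sup>2)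
           * sqrt (\<Sum>t \<in> {t. t \<subseteq> {1..n} \<and> j \<in> t}. \<P>(\<omega> in M. T \<omega> = t) * (\<beta> t)\<^sup>2))}"

definition continuous_rv :: "'a measure \<Rightarrow> ('a \<Rightarrow> real) \<Rightarrow> bool" where
  "continuous_rv M Z \<longleftrightarrow> (\<exists>f. distributed M lborel Z f)"

text \<open>Local absolute continuity: the derivative exists almost everywhere, is Lebesgue integrable on
  bounded intervals, and the function is its indefinite integral.\<close>

definition locally_AC :: "(real \<Rightarrow> real) \<Rightarrow> bool" where
  "locally_AC f \<longleftrightarrow>
     (AE z in lborel. f differentiable (at z)) \<and>
     (\<forall>a b. a \<le> b \<longrightarrow> deriv f absolutely_integrable_on {a..b} \<and>
                      integral {a..b} (deriv f) = f b - f a)"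

text \<open>A density is only determined almost everywhere, but at most one version of it is locally
  absolutely continuous, so the infimum ranges over at most one function. If there is no such
  version, it is the infimum of the empty set, i.e. the usual convention that the Fisher
  information is infinite (as for the uniform distribution, for which the bare integral with the
  almost everywhere defined derivative would be 0). Where \<open>f z = 0\<close>, the integrand is 0 because
  division by 0 gives 0; any derivative of the nonnegative function \<open>f\<close> at such a point is 0.\<close>

definition fisher_information :: "'a measure \<Rightarrow> ('a \<Rightarrow> real) \<Rightarrow> ennreal" where
  "fisher_information M Z =
     (INF f \<in> {f :: real \<Rightarrow> real. (\<forall>z. 0 \<le> f z) \<and> distributed M lborel Z (\<lambda>z. ennreal (f z)) \<and> locally_AC f}.
        \<integral>\<^sup>+ z. ennreal ((deriv f z)\<^sup>2 / f z) \<partial>lborel)"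

end

theory Submission
  imports Defs
begin

text \<open>
  Write a square-integrable function of \<open>(S, X_S)\<close> as \<open>f_S(X)\<close>, where \<open>f_s\<close> depends only on the
  coordinates in \<open>s\<close>, and likewise \<open>g_T(X)\<close>. Integrating out one coordinate \<open>j\<close> after the other
  splits \<open>f_s\<close> into its mean and orthogonal martingale differences, and the difference for \<open>j\<close>
  vanishes unless \<open>j \<in> s\<close>. Hence the covariance of \<open>f_S(X)\<close> and \<open>g_T(X)\<close> is the covariance of the
  means, which is controlled by \<open>R(S, T)\<close>, plus, for each \<open>j\<close>, a sum over the \<open>s, t\<close> containing \<open>j\<close>,
  which is controlled by \<open>r_j\<close>. Functions of \<open>S\<close> alone and functions \<open>\<alpha>_S h(X_j)\<close> show that
  neither bound can be improved.

  For the second claim take \<open>f_s\<close> to be \<open>\<lambda>_s\<close> times the score of \<open>\<Sum>i\<in>s. X_i\<close>, and \<open>g_t\<close> to be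
  \<open>\<mu>_t\<close> times the score of \<open>\<Sum>i\<in>t. X_i\<close>. For \<open>s \<subseteq> t\<close> the latter score is a conditional
  expectation of the former, so \<open>E f_S g_T = E g_T\<^sup>2\<close> is the left-hand side of the
  inequality. Smoothing by an independent summand keeps a density locally absolutely continuous;
  that the smoothed density is differentiable almost everywhere is the Lebesgue differentiation
  theorem.
\<close>

subsection \<open>Square-integrable functions on product spaces\<close>

text \<open>Independence enters in one way: on the event \<open>S = s, T = t\<close> the vector of
  the \<open>X i\<close> still has the product law \<open>N\<close>, so every expectation becomes a
  finite sum over \<open>s, t\<close> with weights \<open>p s t\<close>. Covariances and variances
  of the orthogonal pieces add up, and by the Cauchy-Schwarz inequality pieces bounded with a common
  constant combine without loss; this is why a maximum, and not a sum, of constants appears.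

  Scores have mean zero, so for them the part of the means vanishes. With \<open>P\<close> and
  \<open>Q\<close> the weighted sums of Fisher informations over \<open>s\<close> and
  \<open>t\<close>, the bound reads \<open>Q \<le> R * sqrt P * sqrt Q\<close>, and cancelling
  \<open>sqrt Q\<close> yields the square of \<open>R\<close>.

  Two obstacles shape the rest. Integrability is known only at sets of positive probability, so
  functions are replaced by 0 at the others. And Fisher information may be infinite: if this happens
  at a contributing \<open>s\<close>, then \<open>R > 0\<close> makes the right-hand side infinite;
  if not, the sum over each contributing \<open>t\<close> inherits a score from a subset
  \<open>s\<close>.\<close>

definition square_integrable :: "'a measure \<Rightarrow> ('a \<Rightarrow> real) \<Rightarrow> bool" where
  "square_integrable M f \<longleftrightarrow> f \<in> borel_measurable M \<and> integrable M (\<lambda>x. (f x)\<^sup>2)"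

lemma square_integrable_measurable [measurable_dest]:
  "square_integrable M f \<Longrightarrow> f \<in> borel_measurable M"
  by (simp add: square_integrable_def)

lemma square_integrable_square: "square_integrable M f \<Longrightarrow> integrable M (\<lambda>x. (f x)\<^sup>2)"
  by (simp add: square_integrable_def)

lemma square_integrable_mult:
  assumes "square_integrable M f" "square_integrable M g"
  shows "integrable M (\<lambda>x. f x * g x)"
proof (rule Bochner_Integration.integrable_bound)
  show "integrable M (\<lambda>x. (f x)\<^sup>2 + (g x)\<^sup>2)"
    using assms by (auto simp: square_integrable_def)
  show "(\<lambda>x. f x * g x) \<in> borel_measurable M"
    using assms by (auto simp: square_integrable_def)
  have "\<bar>a * b\<bar> \<le> a\<^sup>2 + b\<^sup>2" for a b :: real
    using sum_squares_bound[of "\<bar>a\<bar>" "\<bar>b\<bar>"] abs_ge_zero[of "a * b"]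
    unfolding abs_mult power2_abs by linarith
  then show "AE x in M. norm (f x * g x) \<le> norm ((f x)\<^sup>2 + (g x)\<^sup>2)"
    by auto
qed

lemma square_integrable_add:
  assumes "square_integrable M f" "square_integrable M g"
  shows "square_integrable M (\<lambda>x. f x + g x)"
  using square_integrable_mult[OF assms] assms
  by (auto simp: square_integrable_def power2_sum mult.assoc)

lemma square_integrable_cmult:
  assumes "square_integrable M f"
  shows "square_integrable M (\<lambda>x. c * f x)"
  using assms by (auto simp: square_integrable_def power_mult_distrib)

lemma square_integrable_diff:
  assumes "square_integrable M f" "square_integrable M g"
  shows "square_integrable M (\<lambda>x. f x - g x)"
  using square_integrable_add[OF assms(1) square_integrable_cmult[OF assms(2), of "-1"]] by simp

lemma square_integrable_zero: "square_integrable M (\<lambda>x. 0)"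
  by (simp add: square_integrable_def)

lemma (in finite_measure) square_integrable_const: "square_integrable M (\<lambda>x. c)"
  by (simp add: square_integrable_def)

lemma (in finite_measure) square_integrable_bounded:
  assumes "f \<in> borel_measurable M" "\<And>x. \<bar>f x\<bar> \<le> B"
  shows "square_integrable M f"
  unfolding square_integrable_def
proof
  show "integrable M (\<lambda>x. (f x)\<^sup>2)"
    using assms abs_le_square_iff[of "f _" B] order_trans[OF abs_ge_zero assms(2)]
    by (intro integrable_const_bound[where B = "B\<^sup>2"]) auto
qed fact

lemma (in finite_measure) square_integrable_integrable:
  assumes "square_integrable M f"
  shows "integrable M f"
  using square_integrable_mult[OF assms square_integrable_const[of 1]] by simp

text \<open>The integral of \<open>(f - t * g)^2\<close> is a quadratic in \<open>t\<close> without
  negative values; \<open>t = b / c\<close> is its minimum point, and for \<open>c = 0\<close> it is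
  linear and \<open>t = (a + 1) / (2 * b)\<close> would give the value -1.\<close>

lemma integral_Cauchy_Schwarz_square:
  assumes f: "square_integrable M f" and g: "square_integrable M g"
  shows "(\<integral>x. f x * g x \<partial>M)\<^sup>2 \<le> (\<integral>x. (f x)\<^sup>2 \<partial>M) * (\<integral>x. (g x)\<^sup>2 \<partial>M)"
proof -
  define a b c where "a = (\<integral>x. (f x)\<^sup>2 \<partial>M)" "b = (\<integral>x. f x * g x \<partial>M)" "c = (\<integral>x. (g x)\<^sup>2 \<partial>M)"
  note intg = square_integrable_mult[OF f g] square_integrable_square[OF f] square_integrable_square[OF g]
  have quad: "0 \<le> a - 2 * t * b + t\<^sup>2 * c" for t
  proof -
    have "0 \<le> (\<integral>x. (f x - t * g x)\<^sup>2 \<partial>M)" by simp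
    also have "\<dots> = (\<integral>x. (f x)\<^sup>2 - 2 * t * (f x * g x) + t\<^sup>2 * (g x)\<^sup>2 \<partial>M)"
      by (simp add: power2_eq_square algebra_simps)
    also have "\<dots> = a - 2 * t * b + t\<^sup>2 * c"
      unfolding a_b_c_def using intg by simp
    finally show ?thesis .
  qed
  have "a \<ge> 0" "c \<ge> 0" by (auto simp: a_b_c_def)
  have "b\<^sup>2 \<le> a * c"
  proof (cases "c = 0")
    case True
    have "b = 0"
    proof (rule ccontr)
      assume "b \<noteq> 0"
      with quad[of "(a + 1) / (2 * b)"] True show False by simp
    qed
    then show ?thesis using True by simp
  next
    case False
    then show ?thesis using quad[of "b / c"] \<open>c \<ge> 0\<close>
      by (simp add: field_simps power2_eq_square)
  qed
  then show ?thesis by (simp add: a_b_c_def)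
qed

lemma integral_Cauchy_Schwarz:
  assumes "square_integrable M f" "square_integrable M g"
  shows "(\<integral>x. f x * g x \<partial>M) \<le> sqrt (\<integral>x. (f x)\<^sup>2 \<partial>M) * sqrt (\<integral>x. (g x)\<^sup>2 \<partial>M)"
  using real_le_rsqrt[OF integral_Cauchy_Schwarz_square[OF assms]] by (simp add: real_sqrt_mult)

lemma (in prob_space) integral_square_le:
  assumes f: "square_integrable M f"
  shows "(\<integral>x. f x \<partial>M)\<^sup>2 \<le> (\<integral>x. (f x)\<^sup>2 \<partial>M)"
proof -
  define m where "m = (\<integral>x. f x \<partial>M)"
  note int = square_integrable_integrable[OF f] square_integrable_square[OF f]
  have "0 \<le> (\<integral>x. (f x - m)\<^sup>2 \<partial>M)" by simp
  also have "\<dots> = (\<integral>x. (f x)\<^sup>2 - 2 * m * f x + m\<^sup>2 \<partial>M)"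
    by (simp add: power2_eq_square algebra_simps)
  also have "\<dots> = (\<integral>x. (f x)\<^sup>2 \<partial>M) - m\<^sup>2"
    using int by (simp add: prob_space m_def power2_eq_square)
  finally show ?thesis by (simp add: m_def)
qed

text \<open>The Cauchy-Schwarz inequality in the plane. It joins the bounds for two orthogonal parts
  of a pair of functions into a bound with the same constant for the whole.\<close>

lemma sqrt_mult_add_le:
  fixes a b c d :: real
  assumes "a \<ge> 0" "b \<ge> 0" "c \<ge> 0" "d \<ge> 0"
  shows "sqrt a * sqrt b + sqrt c * sqrt d \<le> sqrt (a + c) * sqrt (b + d)"
proof -
  have "sqrt a * sqrt b + sqrt c * sqrt d \<le> sqrt ((a + c) * (b + d))"
  proof (rule real_le_rsqrt)
    have "2 * (sqrt a * sqrt b * (sqrt c * sqrt d)) \<le> a * d + c * b"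
      using sum_squares_bound[of "sqrt a * sqrt d" "sqrt c * sqrt b"] assms
      by (simp add: power_mult_distrib mult_ac)
    then show "(sqrt a * sqrt b + sqrt c * sqrt d)\<^sup>2 \<le> (a + c) * (b + d)"
      using assms by (simp add: power2_sum power_mult_distrib algebra_simps)
  qed
  then show ?thesis by (simp add: real_sqrt_mult)
qed

section \<open>Conditional expectation over a single coordinate of a product space\<close>

text \<open>The conditional expectation given all coordinates but \<open>j\<close>, in a version
  defined at every point. It is unaffected by a change of coordinate \<open>j\<close> everywhere,
  not just almost everywhere, which lets the dependence on coordinates be tracked pointwise
  below.\<close>

definition avg :: "('i \<Rightarrow> 'b measure) \<Rightarrow> 'i \<Rightarrow> (('i \<Rightarrow> 'b) \<Rightarrow> real) \<Rightarrow> ('i \<Rightarrow> 'b) \<Rightarrow> real" where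
  "avg M j f x = (\<integral>y. f (x(j := y)) \<partial>M j)"

context finite_product_prob_space
begin

abbreviation PM :: "('a \<Rightarrow> 'b) measure" where "PM \<equiv> Pi\<^sub>M I M"

lemma measurable_coordinate_update:
  assumes "j \<in> I"
  shows "(\<lambda>(x, y). x(j := y)) \<in> measurable (PM \<Otimes>\<^sub>M M j) PM"
proof -
  have [simp]: "insert j I = I" using assms by auto
  have "(\<lambda>(x, y). x(j := y)) \<in> measurable (PM \<Otimes>\<^sub>M M j) (Pi\<^sub>M (insert j I) M)"
    by measurable
  then show ?thesis by simp
qed

text \<open>Replacing coordinate \<open>j\<close> by a fresh independent copy preserves the product
  law. Fubini's theorem for this coordinate can thus be applied on
  \<open>PM \<Otimes>\<^sub>M M j\<close>, without splitting the index set.\<close>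

lemma distr_coordinate_update:
  assumes j: "j \<in> I"
  shows "distr (PM \<Otimes>\<^sub>M M j) PM (\<lambda>(x, y). x(j := y)) = PM"
proof (rule PiM_eqI)
  interpret P: prob_space PM by (rule prob_space_PiM) (rule prob_space)
  fix A assume A: "\<And>i. i \<in> I \<Longrightarrow> A i \<in> sets (M i)"
  \<comment> \<open>The side \<open>A j\<close> of the box constrains only the fresh copy, so the
    old coordinate ranges over all of \<open>space (M j)\<close>.\<close>
  have "(\<lambda>(x, y). x(j := y)) -` (Pi\<^sub>E I A) \<inter> space (PM \<Otimes>\<^sub>M M j)
      = Pi\<^sub>E I (A(j := space (M j))) \<times> A j"
    using j A[THEN sets.sets_into_space]
    by (fastforce simp: space_pair_measure space_PiM PiE_iff extensional_def split: if_splits)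
  then have "emeasure (distr (PM \<Otimes>\<^sub>M M j) PM (\<lambda>(x, y). x(j := y))) (Pi\<^sub>E I A)
     = emeasure (PM \<Otimes>\<^sub>M M j) (Pi\<^sub>E I (A(j := space (M j))) \<times> A j)"
    using measurable_coordinate_update[OF j] A finite_index
    by (subst emeasure_distr) (auto intro!: sets_PiM_I_finite)
  also have "\<dots> = emeasure PM (Pi\<^sub>E I (A(j := space (M j)))) * emeasure (M j) (A j)"
    using A j finite_index by (intro M.emeasure_pair_measure_Times) (auto intro!: sets_PiM_I_finite)
  also have "\<dots> = (\<Prod>i\<in>I. emeasure (M i) ((A(j := space (M j))) i)) * emeasure (M j) (A j)"
    using A finite_index by (subst emeasure_PiM) auto
  also have "\<dots> = (\<Prod>i\<in>I. emeasure (M i) (A i))"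
    using j finite_index
    by (simp add: prod.remove[of I j] M.emeasure_space_1 mult.commute del: fun_upd_apply)
       (simp add: M.emeasure_space_1 cong: prod.cong_simp)
  finally show "emeasure (distr (PM \<Otimes>\<^sub>M M j) PM (\<lambda>(x, y). x(j := y))) (Pi\<^sub>E I A)
     = (\<Prod>i\<in>I. emeasure (M i) (A i))" .
qed (use finite_index in auto)

lemma
  fixes F :: "('a \<Rightarrow> 'b) \<Rightarrow> real"
  assumes j: "j \<in> I" and F: "integrable PM F"
  shows integrable_avg: "integrable PM (avg M j F)"
    and integral_avg: "(\<integral>x. avg M j F x \<partial>PM) = (\<integral>x. F x \<partial>PM)"
    and AE_integrable_section: "AE x in PM. integrable (M j) (\<lambda>y. F (x(j := y)))"
proof -
  interpret P: pair_sigma_finite PM "M j" ..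
  have m: "F \<in> borel_measurable PM" using F by auto
  have "integrable (distr (PM \<Otimes>\<^sub>M M j) PM (\<lambda>(x, y). x(j := y))) F"
    using F j by (simp add: distr_coordinate_update)
  then have int: "integrable (PM \<Otimes>\<^sub>M M j) (\<lambda>(x, y). F (x(j := y)))"
    using m by (subst (asm) integrable_distr_eq[OF measurable_coordinate_update[OF j]])
       (auto simp: case_prod_beta')
  show "integrable PM (avg M j F)"
    unfolding avg_def using P.integrable_fst[OF int] by simp
  show "AE x in PM. integrable (M j) (\<lambda>y. F (x(j := y)))"
    using P.AE_integrable_fst[OF int] by simp
  have "(\<integral>x. F x \<partial>PM)
      = (\<integral>x. F x \<partial>distr (PM \<Otimes>\<^sub>M M j) PM (\<lambda>(x, y). x(j := y)))"
    using j by (simp add: distr_coordinate_update)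
  also have "\<dots> = (\<integral>(x, y). F (x(j := y)) \<partial>(PM \<Otimes>\<^sub>M M j))"
    using m by (subst integral_distr[OF measurable_coordinate_update[OF j]])
       (auto simp: case_prod_beta')
  also have "\<dots> = (\<integral>x. avg M j F x \<partial>PM)"
    unfolding avg_def using P.integral_fst[OF int] by simp
  finally show "(\<integral>x. avg M j F x \<partial>PM) = (\<integral>x. F x \<partial>PM)" by simp
qed

lemma avg_fun_upd [simp]: "avg M j f (x(j := y)) = avg M j f x"
  by (simp add: avg_def)

lemma section_measurable:
  assumes "j \<in> I" "f \<in> borel_measurable PM" "x \<in> space PM"
  shows "(\<lambda>y. f (x(j := y))) \<in> borel_measurable (M j)"
proof -
  have "(\<lambda>y. f (case (x, y) of (x, y) \<Rightarrow> x(j := y))) \<in> borel_measurable (M j)"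
    by (rule measurable_compose[OF measurable_compose[OF measurable_Pair1'[OF assms(3)]
          measurable_coordinate_update[OF assms(1)]] assms(2)])
  then show ?thesis by simp
qed

lemma avg_square_le:
  assumes j: "j \<in> I" and f: "square_integrable PM f" and x: "x \<in> space PM"
    and int: "integrable (M j) (\<lambda>y. (f (x(j := y)))\<^sup>2)"
  shows "(avg M j f x)\<^sup>2 \<le> avg M j (\<lambda>x. (f x)\<^sup>2) x"
  unfolding avg_def
  by (rule M.integral_square_le)
     (use int section_measurable[OF j _ x] f in \<open>auto simp: square_integrable_def\<close>)

lemma square_integrable_avg:
  assumes j: "j \<in> I" and f: "square_integrable PM f"
  shows "square_integrable PM (avg M j f)"
proof -
  have sq: "integrable PM (\<lambda>x. (f x)\<^sup>2)" using f by (rule square_integrable_square)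
  have meas: "avg M j f \<in> borel_measurable PM"
    using integrable_avg[OF j square_integrable_integrable[OF f]] by auto
  have "integrable PM (\<lambda>x. (avg M j f x)\<^sup>2)"
  proof (rule Bochner_Integration.integrable_bound[OF integrable_avg[OF j sq]])
    show "AE x in PM. norm ((avg M j f x)\<^sup>2) \<le> norm (avg M j (\<lambda>x. (f x)\<^sup>2) x)"
      using AE_integrable_section[OF j sq] AE_space
    proof eventually_elim
      case (elim x)
      have "norm ((avg M j f x)\<^sup>2) \<le> avg M j (\<lambda>x. (f x)\<^sup>2) x"
        using avg_square_le[OF j f elim(2,1)] by simp
      then show ?case by simp
    qed
  qed (use meas in measurable)
  then show ?thesis using meas by (simp add: square_integrable_def)
qed

text \<open>\<open>avg M j f\<close> is constant in coordinate \<open>j\<close>, so averaging the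
  product over \<open>j\<close> acts on \<open>g\<close> alone. This is the orthogonality of
  \<open>g - avg M j g\<close> to functions that do not depend on coordinate
  \<open>j\<close>.\<close>

lemma integral_avg_mult:
  assumes j: "j \<in> I" and f: "square_integrable PM f" and g: "square_integrable PM g"
  shows "(\<integral>x. avg M j f x * g x \<partial>PM) = (\<integral>x. avg M j f x * avg M j g x \<partial>PM)"
proof -
  have "(\<integral>x. avg M j f x * g x \<partial>PM) = (\<integral>x. avg M j (\<lambda>x. avg M j f x * g x) x \<partial>PM)"
    using square_integrable_mult[OF square_integrable_avg[OF j f] g]
    by (simp add: integral_avg[OF j])
  then show ?thesis by (simp add: avg_def)
qed

lemma integral_diff_avg_mult:
  assumes j: "j \<in> I" and f: "square_integrable PM f" and g: "square_integrable PM g"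
  shows "(\<integral>x. (f x - avg M j f x) * (g x - avg M j g x) \<partial>PM)
    = (\<integral>x. f x * g x \<partial>PM) - (\<integral>x. avg M j f x * avg M j g x \<partial>PM)"
proof -
  note af = square_integrable_avg[OF j f] and ag = square_integrable_avg[OF j g]
  note ints = square_integrable_mult[OF f g] square_integrable_mult[OF af g]
    square_integrable_mult[OF ag f] square_integrable_mult[OF af ag]
  have "(\<integral>x. (f x - avg M j f x) * (g x - avg M j g x) \<partial>PM)
    = (\<integral>x. f x * g x - avg M j f x * g x - avg M j g x * f x + avg M j f x * avg M j g x \<partial>PM)"
    by (simp add: algebra_simps)
  also have "\<dots> = (\<integral>x. f x * g x \<partial>PM) - (\<integral>x. avg M j f x * g x \<partial>PM)
     - (\<integral>x. avg M j g x * f x \<partial>PM) + (\<integral>x. avg M j f x * avg M j g x \<partial>PM)"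
    using ints by simp
  also have "\<dots> = (\<integral>x. f x * g x \<partial>PM) - (\<integral>x. avg M j f x * avg M j g x \<partial>PM)"
    using integral_avg_mult[OF j f g] integral_avg_mult[OF j g f] by (simp add: mult.commute)
  finally show ?thesis .
qed

lemma avg_ignore:
  assumes "x \<in> space PM" "\<And>y. y \<in> space (M j) \<Longrightarrow> f (x(j := y)) = f x"
  shows "avg M j f x = f x"
proof -
  have "avg M j f x = (\<integral>y. f x \<partial>M j)"
    unfolding avg_def by (rule Bochner_Integration.integral_cong) (use assms in auto)
  then show ?thesis by (simp add: M.prob_space)
qed

text \<open>Averaging over \<open>j\<close> creates no dependence on other coordinates. This keeps
  the functions local while the coordinates are integrated out one after the other.\<close>

lemma avg_commute_ignore:
  assumes "j \<noteq> k"
    and "\<And>x y. x \<in> space PM \<Longrightarrow> y \<in> space (M k) \<Longrightarrow> f (x(k := y)) = f x"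
    and "j \<in> I" "x \<in> space PM" "z \<in> space (M k)"
  shows "avg M j f (x(k := z)) = avg M j f x"
proof -
  have "f ((x(k := z))(j := y)) = f (x(j := y))" if "y \<in> space (M j)" for y
  proof -
    have "x(j := y) \<in> space PM"
      using assms(3,4) that by (auto simp: space_PiM PiE_iff extensional_def)
    then show ?thesis using assms(1,2,5) by (simp add: fun_upd_twist)
  qed
  then show ?thesis unfolding avg_def by (intro Bochner_Integration.integral_cong) auto
qed

section \<open>From bilinear inequalities for each coordinate to a covariance inequality\<close>

text \<open>At each point the assumed inequality bounds the sum by \<open>r\<close> times the
  product of two norms, called \<open>u\<close> and \<open>v\<close> in the proof; the
  Cauchy-Schwarz inequality for \<open>u\<close> and \<open>v\<close> then carries the integrals
  under the roots.\<close>

lemma sum_integral_mult_le: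
  fixes p :: "'s \<Rightarrow> 't \<Rightarrow> real" and p1 :: "'s \<Rightarrow> real" and p2 :: "'t \<Rightarrow> real"
  assumes N: "prob_space N"
    and f: "\<And>s. s \<in> A \<Longrightarrow> square_integrable N (f s)"
    and g: "\<And>t. t \<in> B \<Longrightarrow> square_integrable N (g t)"
    and nn: "r \<ge> 0" "\<And>s. s \<in> A \<Longrightarrow> p1 s \<ge> 0" "\<And>t. t \<in> B \<Longrightarrow> p2 t \<ge> 0"
    and le: "\<And>x. x \<in> space N \<Longrightarrow> (\<Sum>s\<in>A. \<Sum>t\<in>B. p s t * f s x * g t x)
       \<le> r * sqrt (\<Sum>s\<in>A. p1 s * (f s x)\<^sup>2) * sqrt (\<Sum>t\<in>B. p2 t * (g t x)\<^sup>2)"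
  shows "(\<Sum>s\<in>A. \<Sum>t\<in>B. p s t * (\<integral>x. f s x * g t x \<partial>N))
       \<le> r * sqrt (\<Sum>s\<in>A. p1 s * (\<integral>x. (f s x)\<^sup>2 \<partial>N)) * sqrt (\<Sum>t\<in>B. p2 t * (\<integral>x. (g t x)\<^sup>2 \<partial>N))"
proof -
  define u where "u = (\<lambda>x. sqrt (\<Sum>s\<in>A. p1 s * (f s x)\<^sup>2))"
  define v where "v = (\<lambda>x. sqrt (\<Sum>t\<in>B. p2 t * (g t x)\<^sup>2))"
  have u2: "(u x)\<^sup>2 = (\<Sum>s\<in>A. p1 s * (f s x)\<^sup>2)" for x
    unfolding u_def using nn by (intro real_sqrt_pow2 sum_nonneg) auto
  have v2: "(v x)\<^sup>2 = (\<Sum>t\<in>B. p2 t * (g t x)\<^sup>2)" for x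
    unfolding v_def using nn by (intro real_sqrt_pow2 sum_nonneg) auto
  have [measurable]: "f s \<in> borel_measurable N" if "s \<in> A" for s
    using f[OF that] by (simp add: square_integrable_def)
  have "u \<in> borel_measurable N"
    unfolding u_def by measurable
  then have u: "square_integrable N u"
    unfolding square_integrable_def u2 using f by (auto simp: square_integrable_def)
  have [measurable]: "g t \<in> borel_measurable N" if "t \<in> B" for t
    using g[OF that] by (simp add: square_integrable_def)
  have "v \<in> borel_measurable N"
    unfolding v_def by measurable
  then have v: "square_integrable N v"
    unfolding square_integrable_def v2 using g by (auto simp: square_integrable_def)
  have int: "integrable N (\<lambda>x. p s t * f s x * g t x)" if "s \<in> A" "t \<in> B" for s t
    using square_integrable_mult[OF f[OF that(1)] g[OF that(2)]] by (simp add: mult.assoc)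
  have "(\<Sum>s\<in>A. \<Sum>t\<in>B. p s t * (\<integral>x. f s x * g t x \<partial>N))
      = (\<Sum>s\<in>A. \<Sum>t\<in>B. (\<integral>x. p s t * f s x * g t x \<partial>N))"
    by (simp add: mult.assoc)
  also have "\<dots> = (\<integral>x. (\<Sum>s\<in>A. \<Sum>t\<in>B. p s t * f s x * g t x) \<partial>N)"
    using int by (subst Bochner_Integration.integral_sum) (auto intro!: sum.cong simp: Bochner_Integration.integral_sum)
  also have "\<dots> \<le> (\<integral>x. r * (u x * v x) \<partial>N)"
    using int square_integrable_mult[OF u v] le
    by (intro integral_mono) (auto simp: u_def v_def mult.assoc)
  also have "\<dots> = r * (\<integral>x. u x * v x \<partial>N)" by simp
  also have "\<dots> \<le> r * (sqrt (\<integral>x. (u x)\<^sup>2 \<partial>N) * sqrt (\<integral>x. (v x)\<^sup>2 \<partial>N))"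
    using integral_Cauchy_Schwarz[OF u v] nn by (intro mult_left_mono) auto
  also have "(\<integral>x. (u x)\<^sup>2 \<partial>N) = (\<Sum>s\<in>A. p1 s * (\<integral>x. (f s x)\<^sup>2 \<partial>N))"
    unfolding u2 using f by (subst Bochner_Integration.integral_sum) (auto simp: square_integrable_def)
  also have "(\<integral>x. (v x)\<^sup>2 \<partial>N) = (\<Sum>t\<in>B. p2 t * (\<integral>x. (g t x)\<^sup>2 \<partial>N))"
    unfolding v2 using g by (subst Bochner_Integration.integral_sum) (auto simp: square_integrable_def)
  finally show ?thesis by (simp add: mult.assoc)
qed

theorem sum_covariance_le:
  fixes p :: "'a set \<Rightarrow> 'a set \<Rightarrow> real" and p1 p2 :: "'a set \<Rightarrow> real"
  assumes fin: "finite A" "finite B"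
    and f: "\<And>s. s \<in> A \<Longrightarrow> square_integrable PM (f s)"
    and g: "\<And>t. t \<in> B \<Longrightarrow> square_integrable PM (g t)"
    and f_ignore: "\<And>s j x y. s \<in> A \<Longrightarrow> j \<in> I - s \<Longrightarrow> x \<in> space PM \<Longrightarrow> y \<in> space (M j)
        \<Longrightarrow> f s (x(j := y)) = f s x"
    and g_ignore: "\<And>t j x y. t \<in> B \<Longrightarrow> j \<in> I - t \<Longrightarrow> x \<in> space PM \<Longrightarrow> y \<in> space (M j)
        \<Longrightarrow> g t (x(j := y)) = g t x"
    and nn: "r \<ge> 0" "\<And>s. s \<in> A \<Longrightarrow> p1 s \<ge> 0" "\<And>t. t \<in> B \<Longrightarrow> p2 t \<ge> 0"
    and le: "\<And>j \<alpha> \<beta>. j \<in> I \<Longrightarrow> (\<And>s. j \<notin> s \<Longrightarrow> \<alpha> s = 0) \<Longrightarrow> (\<And>t. j \<notin> t \<Longrightarrow> \<beta> t = 0) \<Longrightarrow>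
       (\<Sum>s\<in>A. \<Sum>t\<in>B. p s t * \<alpha> s * \<beta> t)
       \<le> r * sqrt (\<Sum>s\<in>A. p1 s * (\<alpha> s)\<^sup>2) * sqrt (\<Sum>t\<in>B. p2 t * (\<beta> t)\<^sup>2)"
  shows "(\<Sum>s\<in>A. \<Sum>t\<in>B. p s t * ((\<integral>x. f s x * g t x \<partial>PM)
            - (\<integral>x. f s x \<partial>PM) * (\<integral>x. g t x \<partial>PM)))
    \<le> r * sqrt (\<Sum>s\<in>A. p1 s * ((\<integral>x. (f s x)\<^sup>2 \<partial>PM) - (\<integral>x. f s x \<partial>PM)\<^sup>2))
        * sqrt (\<Sum>t\<in>B. p2 t * ((\<integral>x. (g t x)\<^sup>2 \<partial>PM) - (\<integral>x. g t x \<partial>PM)\<^sup>2))"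
proof -
  define c where "c f g = (\<integral>x. f x * g x \<partial>PM) - (\<integral>x. f x \<partial>PM) * (\<integral>x. g x \<partial>PM)"
    for f g :: "('a \<Rightarrow> 'b) \<Rightarrow> real"
  define ign where "ign j f \<longleftrightarrow> (\<forall>x\<in>space PM. \<forall>y\<in>space (M j). f (x(j := y)) = f x)"
    for j and f :: "('a \<Rightarrow> 'b) \<Rightarrow> real"
  have c_nn: "c f f \<ge> 0" if "square_integrable PM f" for f
    using integral_square_le[OF that] by (simp add: c_def power2_eq_square)
  \<comment> \<open>\<open>J\<close> holds the coordinates that are not yet integrated out:
    \<open>f s\<close> depends only on those in \<open>s \<inter> J\<close>. The claim is made for
    all \<open>f\<close> and \<open>g\<close>, because the induction hypothesis is applied to their
    averages.\<close>
  have main: "finite J \<Longrightarrow> J \<subseteq> I \<Longrightarrow>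
     (\<forall>s\<in>A. square_integrable PM (f s)) \<Longrightarrow> (\<forall>t\<in>B. square_integrable PM (g t)) \<Longrightarrow>
     (\<forall>s\<in>A. \<forall>j\<in>I - (s \<inter> J). ign j (f s)) \<Longrightarrow> (\<forall>t\<in>B. \<forall>j\<in>I - (t \<inter> J). ign j (g t)) \<Longrightarrow>
     (\<Sum>s\<in>A. \<Sum>t\<in>B. p s t * c (f s) (g t))
       \<le> r * sqrt (\<Sum>s\<in>A. p1 s * c (f s) (f s)) * sqrt (\<Sum>t\<in>B. p2 t * c (g t) (g t))" for J
  proof (induction J arbitrary: f g rule: finite_induct)
    case empty
    \<comment> \<open>A function that ignores every coordinate is constant on the space: the
      coordinates of \<open>x\<close> are exchanged for those of \<open>y\<close> one by one. All
      covariances then vanish.\<close>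
    have const: "f x = f y" if f: "\<forall>j\<in>I. ign j f" and x: "x \<in> space PM" and y: "y \<in> space PM"
      for f x y
    proof -
      have "finite K \<Longrightarrow> K \<subseteq> I \<Longrightarrow> f (\<lambda>i. if i \<in> K then y i else x i) = f x" for K
      proof (induction K rule: finite_induct)
        case (insert k K)
        define z where "z = (\<lambda>i. if i \<in> K then y i else x i)"
        have "z \<in> space PM" "y k \<in> space (M k)"
          using x y insert.prems by (auto simp: z_def space_PiM PiE_iff extensional_def)
        then have "f (z(k := y k)) = f z" using f insert.prems by (auto simp: ign_def)
        moreover have "z(k := y k) = (\<lambda>i. if i \<in> insert k K then y i else x i)"
          by (auto simp: z_def)
        moreover have "f z = f x"
          unfolding z_def using insert.prems by (intro insert.IH) auto
        ultimately show ?case by simp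
      qed simp
      from this[of I] finite_index have "f (\<lambda>i. if i \<in> I then y i else x i) = f x" by simp
      moreover have "(\<lambda>i. if i \<in> I then y i else x i) = y"
        using x y by (auto simp: space_PiM PiE_iff extensional_def)
      ultimately show ?thesis by simp
    qed
    have "c (f s) (g t) = 0" if "s \<in> A" "t \<in> B" for s t
    proof -
      obtain x0 where x0: "x0 \<in> space PM" using not_empty by blast
      define a b where "a = f s x0" "b = g t x0"
      have fa: "f s x = a" if "x \<in> space PM" for x
        unfolding a_b_def(1) by (rule const[OF _ that x0]) (use empty \<open>s \<in> A\<close> in blast)
      have gb: "g t x = b" if "x \<in> space PM" for x
        unfolding a_b_def(2) by (rule const[OF _ that x0]) (use empty \<open>t \<in> B\<close> in blast)
      have "c (f s) (g t) = (\<integral>x. a * b \<partial>PM) - (\<integral>x. a \<partial>PM) * (\<integral>x. b \<partial>PM)"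
        unfolding c_def using fa gb by (simp cong: Bochner_Integration.integral_cong)
      then show ?thesis by (simp add: P.prob_space)
    qed
    moreover have "0 \<le> r * sqrt (\<Sum>s\<in>A. p1 s * c (f s) (f s)) * sqrt (\<Sum>t\<in>B. p2 t * c (g t) (g t))"
      using nn empty by (auto intro!: mult_nonneg_nonneg sum_nonneg c_nn)
    ultimately show ?case by simp
  next
    case (insert j J f g)
    have j: "j \<in> I" using insert by simp
    have f: "\<And>s. s \<in> A \<Longrightarrow> square_integrable PM (f s)"
      and g: "\<And>t. t \<in> B \<Longrightarrow> square_integrable PM (g t)" using insert by auto
    note af = square_integrable_avg[OF j f] and ag = square_integrable_avg[OF j g]
    define d where "d f g = (\<integral>x. (f x - avg M j f x) * (g x - avg M j g x) \<partial>PM)" for f g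
    \<comment> \<open>The means are unchanged by averaging, so the covariance is the inner product
      of the martingale differences for \<open>j\<close> plus the covariance of the
      averages.\<close>
    have c_split: "c f g = d f g + c (avg M j f) (avg M j g)"
      if "square_integrable PM f" "square_integrable PM g" for f g
      using integral_diff_avg_mult[OF j that] integral_avg[OF j square_integrable_integrable[OF that(1)]]
        integral_avg[OF j square_integrable_integrable[OF that(2)]] by (simp add: c_def d_def)
    have ign_avg: "ign k (avg M j h)" if "ign k h \<or> k = j" for h k
      using that avg_commute_ignore[of j k h] j by (cases "k = j") (auto simp: ign_def)
    have IH: "(\<Sum>s\<in>A. \<Sum>t\<in>B. p s t * c (avg M j (f s)) (avg M j (g t)))
       \<le> r * sqrt (\<Sum>s\<in>A. p1 s * c (avg M j (f s)) (avg M j (f s)))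
           * sqrt (\<Sum>t\<in>B. p2 t * c (avg M j (g t)) (avg M j (g t)))"
      using insert.prems af ag by (intro insert.IH) (auto intro!: ign_avg)
    have zero: "h x - avg M j h x = 0" if "ign j h" "x \<in> space PM" for h x
      using avg_ignore[of x j h] that by (auto simp: ign_def)
    have step: "(\<Sum>s\<in>A. \<Sum>t\<in>B. p s t * d (f s) (g t))
       \<le> r * sqrt (\<Sum>s\<in>A. p1 s * d (f s) (f s)) * sqrt (\<Sum>t\<in>B. p2 t * d (g t) (g t))"
      unfolding d_def power2_eq_square[symmetric]
    proof (rule sum_integral_mult_le[OF prob_space_axioms _ _ nn])
      fix x assume x: "x \<in> space PM"
      \<comment> \<open>If \<open>j \<notin> s\<close>, then \<open>f s\<close> ignores
        \<open>j\<close> and its difference is 0 already; the differences at \<open>x\<close> thus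
        form vectors with the support that \<open>le\<close> asks for.\<close>
      define \<alpha> where "\<alpha> s = (if j \<in> s then f s x - avg M j (f s) x else 0)" for s
      define \<beta> where "\<beta> t = (if j \<in> t then g t x - avg M j (g t) x else 0)" for t
      have \<alpha>: "f s x - avg M j (f s) x = \<alpha> s" if "s \<in> A" for s
        using zero[OF _ x, of "f s"] insert.prems that j by (auto simp: \<alpha>_def)
      have \<beta>: "g t x - avg M j (g t) x = \<beta> t" if "t \<in> B" for t
        using zero[OF _ x, of "g t"] insert.prems that j by (auto simp: \<beta>_def)
      show "(\<Sum>s\<in>A. \<Sum>t\<in>B. p s t * (f s x - avg M j (f s) x) * (g t x - avg M j (g t) x))
        \<le> r * sqrt (\<Sum>s\<in>A. p1 s * (f s x - avg M j (f s) x)\<^sup>2)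
           * sqrt (\<Sum>t\<in>B. p2 t * (g t x - avg M j (g t) x)\<^sup>2)"
        using le[OF j, of \<alpha> \<beta>] by (simp add: \<alpha> \<beta>) (simp add: \<alpha>_def \<beta>_def)
    qed (auto intro!: square_integrable_diff f g af ag)
    have dnn: "d h h \<ge> 0" for h unfolding d_def by simp
    have "(\<Sum>s\<in>A. \<Sum>t\<in>B. p s t * c (f s) (g t))
      = (\<Sum>s\<in>A. \<Sum>t\<in>B. p s t * d (f s) (g t)) + (\<Sum>s\<in>A. \<Sum>t\<in>B. p s t * c (avg M j (f s)) (avg M j (g t)))"
      by (simp add: c_split f g sum.distrib distrib_left)
    also have "\<dots> \<le> r * (sqrt (\<Sum>s\<in>A. p1 s * d (f s) (f s)) * sqrt (\<Sum>t\<in>B. p2 t * d (g t) (g t))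
        + sqrt (\<Sum>s\<in>A. p1 s * c (avg M j (f s)) (avg M j (f s)))
           * sqrt (\<Sum>t\<in>B. p2 t * c (avg M j (g t)) (avg M j (g t))))"
      using add_mono[OF step IH] by (simp add: algebra_simps)
    also have "\<dots> \<le> r * (sqrt ((\<Sum>s\<in>A. p1 s * d (f s) (f s)) + (\<Sum>s\<in>A. p1 s * c (avg M j (f s)) (avg M j (f s))))
        * sqrt ((\<Sum>t\<in>B. p2 t * d (g t) (g t)) + (\<Sum>t\<in>B. p2 t * c (avg M j (g t)) (avg M j (g t)))))"
      using nn by (intro mult_left_mono sqrt_mult_add_le sum_nonneg mult_nonneg_nonneg dnn c_nn af ag) auto
    also have "\<dots> = r * sqrt (\<Sum>s\<in>A. p1 s * c (f s) (f s)) * sqrt (\<Sum>t\<in>B. p2 t * c (g t) (g t))"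
      by (simp add: c_split f g sum.distrib distrib_left mult.assoc)
    finally show ?case .
  qed
  have "\<forall>s\<in>A. \<forall>j\<in>I - (s \<inter> I). ign j (f s)"
    unfolding ign_def by (intro ballI f_ignore) auto
  moreover have "\<forall>t\<in>B. \<forall>j\<in>I - (t \<inter> I). ign j (g t)"
    unfolding ign_def by (intro ballI g_ignore) auto
  ultimately have "(\<Sum>s\<in>A. \<Sum>t\<in>B. p s t * c (f s) (g t))
       \<le> r * sqrt (\<Sum>s\<in>A. p1 s * c (f s) (f s)) * sqrt (\<Sum>t\<in>B. p2 t * c (g t) (g t))"
    using f g by (intro main[OF finite_index order_refl]) auto
  then show ?thesis
    unfolding c_def power2_eq_square .
qed

end

subsection \<open>The Lebesgue differentiation theorem\<close>

text \<open>Pointwise, the indicator of a union is at most the sum of the indicators. The sum is an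
  integral over \<open>count_space I\<close>, so that the index set may be a countable set of pairs
  of endpoints without any enumeration.\<close>

lemma emeasure_UN_le_nn_integral_count_space:
  assumes X: "\<And>i. i \<in> I \<Longrightarrow> X i \<in> sets M" and I: "countable I"
  shows "emeasure M (\<Union>i\<in>I. X i) \<le> (\<integral>\<^sup>+i. emeasure M (X i) \<partial>count_space I)"
proof -
  have "emeasure M (\<Union>i\<in>I. X i) = (\<integral>\<^sup>+x. indicator (\<Union>i\<in>I. X i) x \<partial>M)"
    using X I by (intro nn_integral_indicator[symmetric] sets.countable_UN'') auto
  also have "\<dots> \<le> (\<integral>\<^sup>+x. (\<integral>\<^sup>+i. indicator (X i) x \<partial>count_space I) \<partial>M)"
  proof (intro nn_integral_mono)
    fix x
    show "indicator (\<Union>i\<in>I. X i) x \<le> (\<integral>\<^sup>+i. indicator (X i) x \<partial>count_space I)"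
    proof (cases "x \<in> (\<Union>i\<in>I. X i)")
      case True
      then obtain i where i: "i \<in> I" "x \<in> X i" by blast
      have "1 = (\<integral>\<^sup>+k. indicator {i} k \<partial>count_space I)" using i by simp
      also have "\<dots> \<le> (\<integral>\<^sup>+k. indicator (X k) x \<partial>count_space I)"
        using i by (intro nn_integral_mono) (auto simp: indicator_def)
      finally show ?thesis using True by simp
    qed simp
  qed
  also have "\<dots> = (\<integral>\<^sup>+i. (\<integral>\<^sup>+x. indicator (X i) x \<partial>M) \<partial>count_space I)"
    using X I by (intro nn_integral_count_space_nn_integral) auto
  also have "\<dots> = (\<integral>\<^sup>+i. emeasure M (X i) \<partial>count_space I)"
    using X by (intro nn_integral_cong) auto
  finally show ?thesis .
qed

text \<open>The covering lemma for balls in terms of endpoints: five times the radius about the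
  midpoint means two more lengths on either side. The common bound \<open>B\<close> on the lengths
  is what permits a greedy choice of nearly longest segments.\<close>

lemma Vitali_cover_closed_segments:
  fixes A :: "real set"
  assumes A: "\<And>x. x \<in> A \<Longrightarrow> \<exists>a b. a < b \<and> b - a \<le> B \<and> x \<in> {a..b} \<and> P a b"
  obtains C where "countable C" "\<And>a b. (a, b) \<in> C \<Longrightarrow> a < b \<and> P a b"
    "disjoint_family_on (\<lambda>(a, b). {a..b}) C"
    "A \<subseteq> (\<Union>(a, b)\<in>C. {a - 2 * (b - a)..b + 2 * (b - a)})"
proof -
  define K where "K = {(a, b). a < b \<and> b - a \<le> B \<and> P a b}"
  define c r where "c = (\<lambda>(a, b). (a + b) / 2 :: real)" "r = (\<lambda>(a, b). (b - a) / 2 :: real)"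
  have cb: "cball (c (a, b)) (r (a, b)) = {a..b}" for a b
    by (auto simp: c_r_def cball_def dist_real_def field_simps abs_if)
  have cb5: "cball (c (a, b)) (5 * r (a, b)) = {a - 2 * (b - a)..b + 2 * (b - a)}" for a b
    by (auto simp: c_r_def cball_def dist_real_def field_simps abs_if)
  have "A \<subseteq> (\<Union>i\<in>K. cball (c i) (r i))"
  proof
    fix x assume "x \<in> A"
    with A obtain a b where "a < b" "b - a \<le> B" "x \<in> {a..b}" "P a b" by blast
    then have "(a, b) \<in> K" "x \<in> cball (c (a, b)) (r (a, b))" unfolding cb by (auto simp: K_def)
    then show "x \<in> (\<Union>i\<in>K. cball (c i) (r i))" by blast
  qed
  moreover have "0 < r i \<and> r i \<le> B / 2" if "i \<in> K" for i
    using that by (auto simp: K_def c_r_def)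
  ultimately obtain C where C: "countable C" "C \<subseteq> K"
     "pairwise (\<lambda>i j. disjnt (cball (c i) (r i)) (cball (c j) (r j))) C"
     "A \<subseteq> (\<Union>i\<in>C. cball (c i) (5 * r i))"
    by (rule Vitali_covering_lemma_cballs)
  show ?thesis
  proof (rule that[OF C(1)])
    show "a < b \<and> P a b" if "(a, b) \<in> C" for a b using that C(2) by (auto simp: K_def)
    have "(case i of (a, b) \<Rightarrow> {a..b}) = cball (c i) (r i)" for i
      by (cases i) (simp only: cb prod.case)
    then show "disjoint_family_on (\<lambda>(a, b). {a..b}) C"
      using C(3) by (simp add: disjoint_family_on_def pairwise_def disjnt_def)
    have "(case i of (a, b) \<Rightarrow> {a - 2 * (b - a)..b + 2 * (b - a)}) = cball (c i) (5 * r i)" for i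
      by (cases i) (simp only: cb5 prod.case)
    then show "A \<subseteq> (\<Union>(a, b)\<in>C. {a - 2 * (b - a)..b + 2 * (b - a)})"
      using C(4) by simp
  qed
qed

text \<open>Choose an open \<open>U \<supseteq> {k < q}\<close> on which \<open>(k - q)\<^sup>+\<close> has integral at most \<open>\<epsilon>\<close>. Disjoint
  segments in \<open>U\<close> over which the average of \<open>k\<close> exceeds \<open>q + \<delta>\<close> have total length at most
  \<open>\<epsilon> / \<delta>\<close>, and by Vitali's lemma their enlargements cover the set in question.\<close>

lemma negligible_large_averages:
  fixes k :: "real \<Rightarrow> real"
  assumes k [measurable]: "k \<in> borel_measurable borel"
    and int: "\<And>a b. a \<le> b \<Longrightarrow> set_integrable lborel {a..b} k"
    and "\<delta> > 0"
  shows "negligible {x \<in> {-m<..<m}. k x < q \<and>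
    (\<forall>e>0. \<exists>a b. a < b \<and> b - a < e \<and> x \<in> {a..b} \<and> (LBINT z:{a..b}. k z) > (q + \<delta>) * (b - a))}"
    (is "negligible ?A")
  unfolding negligible_outer_le
proof (intro allI impI)
  fix \<epsilon> :: real assume "\<epsilon> > 0"
  \<comment> \<open>The cut-off outside \<open>{-m<..<m}\<close> makes \<open>\<nu>\<close> a finite
    measure, to which outer regularity applies.\<close>
  define kp where "kp x = indicator {-m<..<m} x * max 0 (k x - q)" for x
  define \<nu> where "\<nu> = density lborel (\<lambda>x. ennreal (kp x))"
  have kpm [measurable]: "kp \<in> borel_measurable borel" unfolding kp_def by measurable
  have kp_nn: "kp x \<ge> 0" for x by (simp add: kp_def)
  have kp_int: "integrable lborel kp"
  proof (cases "m \<ge> 0")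
    case True
    have "set_integrable lborel {-m..m} (\<lambda>x. \<bar>k x\<bar> + \<bar>q\<bar>)"
    proof (rule set_integral_add)
      show "set_integrable lborel {-m..m} (\<lambda>x. \<bar>k x\<bar>)"
        using int[of "-m" m] True by (auto intro: set_integrable_abs)
      show "set_integrable lborel {-m..m} (\<lambda>x. \<bar>q\<bar>)"
        using True by (simp add: set_integrable_def)
    qed
    then show ?thesis
      unfolding set_integrable_def
      by (rule Bochner_Integration.integrable_bound) (auto simp: kp_def indicator_def)
  next
    case False
    then have "kp = (\<lambda>_. 0)" by (auto simp: kp_def indicator_def)
    then show ?thesis by simp
  qed
  have \<nu>_sets: "sets \<nu> = sets borel" by (simp add: \<nu>_def)
  have \<nu>_fin: "emeasure \<nu> (space \<nu>) \<noteq> \<infinity>"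
    using kp_int by (simp add: \<nu>_def emeasure_density integrable_iff_bounded kp_nn)
  define E where "E = {x \<in> {-m<..<m}. k x < q}"
  have E: "E \<in> sets borel" unfolding E_def by measurable
  have "emeasure \<nu> E = (\<integral>\<^sup>+x. ennreal (kp x) * indicator E x \<partial>lborel)"
    unfolding \<nu>_def using E by (simp add: emeasure_density)
  also have "\<dots> = (\<integral>\<^sup>+x. 0 \<partial>(lborel :: real measure))"
    by (intro nn_integral_cong) (auto simp: kp_def E_def indicator_def)
  finally have "emeasure \<nu> E = 0" by simp
  \<comment> \<open>The constant anticipates two losses: a factor \<open>1 / \<delta>\<close> from
    the excess over the segments and a factor 5 from their enlargement.\<close>
  then have "(INF U \<in> {U. E \<subseteq> U \<and> open U}. emeasure \<nu> U) < ennreal (\<delta> * \<epsilon> / 5)"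
    using outer_regular[OF \<nu>_sets \<nu>_fin E] \<open>\<delta> > 0\<close> \<open>\<epsilon> > 0\<close> by simp
  then obtain U' where U': "E \<subseteq> U'" "open U'" "emeasure \<nu> U' < ennreal (\<delta> * \<epsilon> / 5)"
    by (auto simp: INF_less_iff)
  define U where "U = U' \<inter> {-m<..<m}"
  have U: "E \<subseteq> U" "open U" using U' by (auto simp: U_def E_def)
  have [measurable]: "U \<in> sets borel" using U by auto
  have "emeasure \<nu> U \<le> emeasure \<nu> U'"
    using U' by (intro emeasure_mono) (auto simp: U_def \<nu>_def)
  with U' have U_le: "emeasure \<nu> U \<le> ennreal (\<delta> * \<epsilon> / 5)" by simp
  define P where "P a b \<longleftrightarrow> {a..b} \<subseteq> U \<and> (LBINT z:{a..b}. k z) > (q + \<delta>) * (b - a)" for a b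
  have cover: "\<exists>a b. a < b \<and> b - a \<le> 1 \<and> x \<in> {a..b} \<and> P a b" if "x \<in> ?A" for x
  proof -
    have "x \<in> U" using that U by (auto simp: E_def)
    then obtain e where e: "e > 0" "ball x e \<subseteq> U" using U by (auto simp: open_contains_ball)
    have "\<forall>e>0. \<exists>a b. a < b \<and> b - a < e \<and> x \<in> {a..b} \<and> (LBINT z:{a..b}. k z) > (q + \<delta>) * (b - a)"
      using that by blast
    moreover have "min e 1 > 0" using e by simp
    ultimately obtain a b where ab: "a < b" "b - a < min e 1" "x \<in> {a..b}"
      "(LBINT z:{a..b}. k z) > (q + \<delta>) * (b - a)" by blast
    have "{a..b} \<subseteq> ball x e" using ab by (auto simp: dist_real_def)
    with ab e show ?thesis by (intro exI[of _ a] exI[of _ b]) (auto simp: P_def)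
  qed
  obtain C where C: "countable C" "\<And>a b. (a, b) \<in> C \<Longrightarrow> a < b \<and> P a b"
    "disjoint_family_on (\<lambda>(a, b). {a..b}) C"
    "?A \<subseteq> (\<Union>(a, b)\<in>C. {a - 2 * (b - a)..b + 2 * (b - a)})"
    using Vitali_cover_closed_segments[of ?A 1 P, OF cover] by blast
  define T where "T = (\<Union>(a, b)\<in>C. {a - 2 * (b - a)..b + 2 * (b - a)})"
  have T: "T \<in> sets borel" unfolding T_def using C(1) by (intro sets.countable_UN'') auto
  \<comment> \<open>Inside \<open>U\<close> the difference \<open>k - q\<close> is at most
    \<open>kp\<close>, and the integral of \<open>k\<close> exceeds \<open>q * (b - a)\<close> by
    more than \<open>\<delta> * (b - a)\<close>. So the \<open>\<nu>\<close>-measure of a chosen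
    segment is at least \<open>\<delta>\<close> times its length.\<close>
  have seg: "ennreal (5 * (b - a)) \<le> ennreal (5 / \<delta>) * emeasure \<nu> {a..b}" if "(a, b) \<in> C" for a b
  proof -
    have ab: "a < b" "{a..b} \<subseteq> U" "(LBINT z:{a..b}. k z) > (q + \<delta>) * (b - a)"
      using C(2)[OF that] by (auto simp: P_def)
    have ik: "integrable lborel (\<lambda>z. indicator {a..b} z * k z)"
      using int[of a b] ab by (simp add: set_integrable_def)
    have iq: "integrable lborel (\<lambda>z. indicator {a..b} z * q)"
      using integrable_mult_left[OF integrable_real_indicator[of "{a..b}" lborel], of q] ab by simp
    have "\<delta> * (b - a) \<le> (LBINT z:{a..b}. k z) - q * (b - a)"
      using ab by (simp add: algebra_simps)
    also have "q * (b - a) = (\<integral>z. indicator {a..b} z * q \<partial>lborel)"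
      using ab by simp
    also have "(LBINT z:{a..b}. k z) - \<dots> = (\<integral>z. indicator {a..b} z * k z - indicator {a..b} z * q \<partial>lborel)"
      using ik iq by (simp add: set_lebesgue_integral_def)
    also have "\<dots> \<le> (\<integral>z. indicator {a..b} z * kp z \<partial>lborel)"
    proof (rule integral_mono)
      show "integrable lborel (\<lambda>z. indicator {a..b} z * kp z)"
        using integrable_real_mult_indicator[OF _ kp_int, of "{a..b}"] by (simp add: mult.commute)
      show "indicator {a..b} z * k z - indicator {a..b} z * q \<le> indicator {a..b} z * kp z" for z
        using ab(2) by (auto simp: indicator_def kp_def U_def)
    qed (use ik iq in auto)
    finally have "ennreal (\<delta> * (b - a)) \<le> ennreal (\<integral>z. indicator {a..b} z * kp z \<partial>lborel)"
      by (rule ennreal_leI)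
    also have "\<dots> = (\<integral>\<^sup>+z. ennreal (indicator {a..b} z * kp z) \<partial>lborel)"
      using integrable_real_mult_indicator[OF _ kp_int, of "{a..b}"]
      by (subst nn_integral_eq_integral) (auto simp: kp_nn mult.commute)
    also have "\<dots> = emeasure \<nu> {a..b}"
      unfolding \<nu>_def by (auto simp: emeasure_density indicator_def intro!: nn_integral_cong)
    finally have "ennreal (5 / \<delta>) * ennreal (\<delta> * (b - a)) \<le> ennreal (5 / \<delta>) * emeasure \<nu> {a..b}"
      by (rule mult_left_mono) simp
    then show ?thesis using \<open>\<delta> > 0\<close> ab by (simp flip: ennreal_mult)
  qed
  have "emeasure lborel T \<le> (\<integral>\<^sup>+(a, b). emeasure lborel {a - 2 * (b - a)..b + 2 * (b - a)} \<partial>count_space C)"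
    unfolding T_def using C(1)
    by (intro order_trans[OF emeasure_UN_le_nn_integral_count_space]) (auto simp: case_prod_beta')
  also have "\<dots> \<le> (\<integral>\<^sup>+(a, b). ennreal (5 / \<delta>) * emeasure \<nu> {a..b} \<partial>count_space C)"
    using seg C(2) by (intro nn_integral_mono) (force simp: algebra_simps)
  also have "\<dots> = ennreal (5 / \<delta>) * (\<integral>\<^sup>+i. emeasure \<nu> (case i of (a, b) \<Rightarrow> {a..b}) \<partial>count_space C)"
    by (simp add: nn_integral_cmult case_prod_beta')
  also have "(\<integral>\<^sup>+i. emeasure \<nu> (case i of (a, b) \<Rightarrow> {a..b}) \<partial>count_space C)
      = emeasure \<nu> (\<Union>i\<in>C. case i of (a, b) \<Rightarrow> {a..b})"
    using C(1,3) by (subst emeasure_UN_countable) (auto simp: \<nu>_def)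
  also have "\<dots> \<le> emeasure \<nu> U"
    using C(2) by (intro emeasure_mono) (auto simp: P_def \<nu>_def)
  also note U_le
  finally have "emeasure lborel T \<le> ennreal (5 / \<delta>) * ennreal (\<delta> * \<epsilon> / 5)"
    by (simp add: mult_left_mono)
  then have T_le: "emeasure lborel T \<le> ennreal \<epsilon>"
    using \<open>\<delta> > 0\<close> \<open>\<epsilon> > 0\<close> by (simp flip: ennreal_mult)
  then have "emeasure lebesgue T \<le> ennreal \<epsilon>" using T by simp
  moreover have "T \<in> lmeasurable"
    using T T_le by (intro fmeasurableI) (auto simp: less_top[symmetric] top_unique)
  ultimately show "\<exists>T. ?A \<subseteq> T \<and> T \<in> lmeasurable \<and> measure lebesgue T \<le> \<epsilon>"
    using C(4) \<open>\<epsilon> > 0\<close> by (intro exI[of _ T]) (auto simp: T_def measure_def enn2real_leI)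
qed

text \<open>If difference quotients of at least \<open>k x + e\<close> occurred arbitrarily close to
  \<open>x\<close>, then \<open>x\<close> would lie in one of countably many null sets
  \<open>A m q \<delta>\<close>, with \<open>q\<close> a rational between \<open>k x\<close> and
  \<open>k x + e / 2\<close> and \<open>\<delta>\<close> an inverse integer below
  \<open>e / 2\<close>. Segments with \<open>x\<close> as left or right endpoint cover the quotients
  from both sides.\<close>

lemma AE_upper_derivative_le:
  fixes k F :: "real \<Rightarrow> real"
  assumes k [measurable]: "k \<in> borel_measurable borel"
    and int: "\<And>a b. a \<le> b \<Longrightarrow> set_integrable lborel {a..b} k"
    and F: "\<And>a b. a \<le> b \<Longrightarrow> F b - F a = (LBINT x:{a..b}. k x)"
  shows "AE x in lborel. \<forall>e>0. eventually (\<lambda>y. (F y - F x) / (y - x) < k x + e) (at x)"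
proof -
  define A where "A m q \<delta> = {x \<in> {-m<..<m}. k x < q \<and>
    (\<forall>e>0. \<exists>a b. a < b \<and> b - a < e \<and> x \<in> {a..b} \<and> (LBINT z:{a..b}. k z) > (q + \<delta>) * (b - a))}"
    for m q \<delta>
  have "AE x in lborel. \<forall>m q. \<forall>j::nat. x \<notin> A (real m) (of_rat q) (inverse (of_nat (Suc j)))"
  proof (subst AE_completion_iff[symmetric], intro AE_all_countable[THEN iffD2] allI)
    fix m j :: nat and q :: rat
    have "negligible (A (real m) (of_rat q) (inverse (of_nat (Suc j))))"
      unfolding A_def by (rule negligible_large_averages[OF k int]) auto
    then show "AE x in lebesgue. x \<notin> A (real m) (of_rat q) (inverse (of_nat (Suc j)))"
      by (intro AE_not_in) (simp add: negligible_iff_null_sets)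
  qed
  then show ?thesis
  proof eventually_elim
    case (elim x)
    show ?case
    proof (intro allI impI)
      fix e :: real assume "e > 0"
      obtain m :: nat where m: "real m > \<bar>x\<bar>" using reals_Archimedean2 by blast
      obtain j where j: "inverse (of_nat (Suc j)) < e / 2"
        using reals_Archimedean[of "e / 2"] \<open>e > 0\<close> by auto
      obtain q where q: "k x < of_rat q" "of_rat q < k x + e / 2"
        using of_rat_dense[of "k x" "k x + e / 2"] \<open>e > 0\<close> by auto
      define \<delta> :: real where "\<delta> = inverse (of_nat (Suc j))"
      have "x \<in> {-real m<..<real m}" using m by auto
      moreover have "x \<notin> A (real m) (of_rat q) \<delta>" unfolding \<delta>_def using elim by blast
      ultimately obtain d where d: "d > 0" and "\<not> (\<exists>a b. a < b \<and> b - a < d \<and> x \<in> {a..b} \<and>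
          (LBINT z:{a..b}. k z) > (of_rat q + \<delta>) * (b - a))"
        using q(1) unfolding A_def by blast
      then have dd: "(LBINT z:{a..b}. k z) \<le> (of_rat q + \<delta>) * (b - a)"
        if "a < b" "b - a < d" "x \<in> {a..b}" for a b
        using that by (meson not_le)
      have "(F y - F x) / (y - x) < k x + e" if y: "y \<noteq> x" "dist y x < d" for y
      proof (cases "x < y")
        case True
        with dd[of x y] y F[of x y] have "F y - F x \<le> (of_rat q + \<delta>) * (y - x)"
          by (auto simp: dist_real_def)
        then have "(F y - F x) / (y - x) \<le> of_rat q + \<delta>" using True by (simp add: field_simps)
        also have "\<dots> < k x + e" using q j by (simp add: \<delta>_def)
        finally show ?thesis .
      next
        case False
        with y have "y < x" by simp
        with dd[of y x] y F[of y x] have "F x - F y \<le> (of_rat q + \<delta>) * (x - y)"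
          by (auto simp: dist_real_def)
        then have "(F x - F y) / (x - y) \<le> of_rat q + \<delta>" using \<open>y < x\<close> by (simp add: field_simps)
        also have "\<dots> < k x + e" using q j by (simp add: \<delta>_def)
        also have "(F x - F y) / (x - y) = (F y - F x) / (y - x)"
          by (metis minus_diff_eq minus_divide_divide)
        finally show ?thesis .
      qed
      then show "eventually (\<lambda>y. (F y - F x) / (y - x) < k x + e) (at x)"
        unfolding eventually_at using d by blast
    qed
  qed
qed

text \<open>The upper estimate for \<open>F\<close> and the one for \<open>- F\<close> enclose the
  difference quotients.\<close>

theorem AE_has_real_derivative_integral:
  fixes k F :: "real \<Rightarrow> real"
  assumes k [measurable]: "k \<in> borel_measurable borel"
    and int: "\<And>a b. a \<le> b \<Longrightarrow> set_integrable lborel {a..b} k"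
    and F: "\<And>a b. a \<le> b \<Longrightarrow> F b - F a = (LBINT x:{a..b}. k x)"
  shows "AE x in lborel. (F has_real_derivative k x) (at x)"
proof -
  have "AE x in lborel. \<forall>e>0. eventually (\<lambda>y. (- F y - - F x) / (y - x) < - k x + e) (at x)"
  proof (rule AE_upper_derivative_le[where F = "\<lambda>x. - F x" and k = "\<lambda>x. - k x"])
    show "set_integrable lborel {a..b} (\<lambda>x. - k x)" if "a \<le> b" for a b
      using int[OF that] by (simp add: set_integrable_def)
    show "- F b - - F a = (LBINT x:{a..b}. - k x)" if "a \<le> b" for a b
      using F[OF that] by (simp add: set_lebesgue_integral_def)
  qed measurable
  moreover have "AE x in lborel. \<forall>e>0. eventually (\<lambda>y. (F y - F x) / (y - x) < k x + e) (at x)"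
    by (rule AE_upper_derivative_le) (use int F in auto)
  ultimately show ?thesis
  proof eventually_elim
    case (elim x)
    show ?case
      unfolding has_field_derivative_iff tendsto_iff
    proof (intro allI impI)
      fix e :: real assume "e > 0"
      with elim have "eventually (\<lambda>y. (F y - F x) / (y - x) < k x + e) (at x)"
        "eventually (\<lambda>y. (- F y - - F x) / (y - x) < - k x + e) (at x)" by auto
      then show "eventually (\<lambda>y. dist ((F y - F x) / (y - x)) (k x) < e) (at x)"
      proof eventually_elim
        case (elim y)
        have "(- F y - - F x) / (y - x) = - ((F y - F x) / (y - x))"
          by (metis minus_diff_minus minus_divide_left)
        with elim show ?case by (simp add: dist_real_def abs_less_iff)
      qed
    qed
  qed
qed

subsection \<open>Scores and Fisher information\<close>

text \<open>Passes from almost everywhere statements to negligible sets, in terms of which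
  integrands of \<open>integral\<close> may be altered.\<close>

lemma AE_lborel_negligible:
  assumes "AE x in lborel. P x"
  obtains N where "negligible N" "\<And>x. x \<notin> N \<Longrightarrow> P x"
proof -
  from AE_completion[OF assms] obtain N where "N \<in> null_sets lebesgue" "{x \<in> space lebesgue. \<not> P x} \<subseteq> N"
    by (auto simp: eventually_ae_filter)
  then show ?thesis by (intro that[of N]) (auto simp: negligible_iff_null_sets)
qed

lemma continuous_AE_eq:
  fixes f g :: "real \<Rightarrow> real"
  assumes "continuous_on UNIV f" "continuous_on UNIV g" "AE x in lborel. f x = g x"
  shows "f = g"
proof (rule ccontr)
  assume "f \<noteq> g"
  then obtain x where x: "f x \<noteq> g x" by auto
  have "open {x. f x \<noteq> g x}" using assms by (intro open_Collect_neq) auto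
  then obtain e where e: "e > 0" "ball x e \<subseteq> {x. f x \<noteq> g x}" using x by (auto simp: open_contains_ball)
  obtain N where N: "negligible N" "\<And>x. x \<notin> N \<Longrightarrow> f x = g x"
    using AE_lborel_negligible[OF assms(3)] by blast
  have "ball x e \<subseteq> N" using e N by auto
  then have "negligible (ball x e)" using N negligible_subset by blast
  then show False using e open_not_negligible[of "ball x e"] by auto
qed

lemma locally_AC_continuous:
  assumes "locally_AC f"
  shows "continuous_on UNIV f"
proof (intro continuous_at_imp_continuous_on ballI)
  fix x :: real
  have int: "deriv f integrable_on {x - 1..x + 1}"
    using assms by (auto simp: locally_AC_def absolutely_integrable_on_def)
  have "continuous_on {x - 1..x + 1} (\<lambda>y. f (x - 1) + integral {x - 1..y} (deriv f))"
    by (intro continuous_intros indefinite_integral_continuous_1 int)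
  then have "continuous_on {x - 1..x + 1} f"
  proof (rule continuous_on_eq)
    show "f (x - 1) + integral {x - 1..y} (deriv f) = f y" if "y \<in> {x - 1..x + 1}" for y
      using assms that by (auto simp: locally_AC_def)
  qed
  then have "continuous_on {x - 1<..<x + 1} f" by (rule continuous_on_subset) auto
  then show "isCont f x" by (simp add: continuous_on_eq_continuous_at)
qed

text \<open>\<open>f\<close> is the locally absolutely continuous density of \<open>Z\<close>, \<open>k\<close> a Borel version of its
  derivative, so \<open>k / f\<close> is the score, and the Fisher information is finite.\<close>

definition has_score :: "'a measure \<Rightarrow> ('a \<Rightarrow> real) \<Rightarrow> (real \<Rightarrow> real) \<Rightarrow> (real \<Rightarrow> real) \<Rightarrow> bool" where
  "has_score M Z f k \<longleftrightarrow>
     distributed M lborel Z (\<lambda>z. ennreal (f z)) \<and> f \<in> borel_measurable borel \<and> (\<forall>z. 0 \<le> f z) \<and>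
     (\<forall>z. f z = 0 \<longrightarrow> k z = 0) \<and>
     integrable lborel k \<and> integrable lborel (\<lambda>z. (k z)\<^sup>2 / f z) \<and>
     (\<forall>a b. a \<le> b \<longrightarrow> f b - f a = (LBINT z:{a..b}. k z))"

abbreviation fisher_int :: "(real \<Rightarrow> real) \<Rightarrow> (real \<Rightarrow> real) \<Rightarrow> real" where
  "fisher_int f k \<equiv> \<integral>z. (k z)\<^sup>2 / f z \<partial>lborel"

lemma has_scoreD:
  assumes "has_score M Z f k"
  shows "distributed M lborel Z (\<lambda>z. ennreal (f z))" "f \<in> borel_measurable borel" "0 \<le> f z"
    "f z = 0 \<Longrightarrow> k z = 0" "integrable lborel k" "integrable lborel (\<lambda>z. (k z)\<^sup>2 / f z)"
    "a \<le> b \<Longrightarrow> f b - f a = (LBINT z:{a..b}. k z)"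
  using assms unfolding has_score_def by blast+

lemma has_score_AE_derivative:
  assumes "has_score M Z f k"
  shows "AE z in lborel. (f has_real_derivative k z) (at z)"
proof (rule AE_has_real_derivative_integral)
  have k: "integrable lborel k" using assms by (simp add: has_score_def)
  then show "k \<in> borel_measurable borel" by auto
  show "set_integrable lborel {a..b} k" for a b
    using integrable_real_mult_indicator[OF _ k, of "{a..b}"]
    by (simp add: set_integrable_def mult.commute)
  show "f b - f a = (LBINT z:{a..b}. k z)" if "a \<le> b" for a b
    using assms that unfolding has_score_def by blast
qed

lemma has_score_locally_AC:
  assumes "has_score M Z f k"
  shows "locally_AC f"
proof -
  have k: "integrable lborel k" using assms by (simp add: has_score_def)
  have kset: "set_integrable lborel {a..b} k" for a b
    using integrable_real_mult_indicator[OF _ k, of "{a..b}"]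
    by (simp add: set_integrable_def mult.commute)
  obtain N where N: "negligible N" "\<And>x. x \<notin> N \<Longrightarrow> (f has_real_derivative k x) (at x)"
    using AE_lborel_negligible[OF has_score_AE_derivative[OF assms]] by blast
  show ?thesis
    unfolding locally_AC_def
  proof (intro conjI allI impI)
    show "AE z in lborel. f differentiable at z"
      using has_score_AE_derivative[OF assms] real_differentiable_def by auto
    fix a b :: real assume "a \<le> b"
    have "k absolutely_integrable_on {a..b}"
      using kset[of a b] k unfolding set_integrable_def
      by (subst integrable_completion) auto
    then show "deriv f absolutely_integrable_on {a..b}"
      by (rule absolutely_integrable_spike[OF _ N(1)]) (auto intro!: DERIV_imp_deriv N(2))
    have "integral {a..b} (deriv f) = integral {a..b} k"
      by (rule integral_spike[OF N(1)]) (auto intro!: DERIV_imp_deriv[symmetric] N(2))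
    also have "\<dots> = (LBINT z:{a..b}. k z)"
      using set_borel_integral_eq_integral(2)[OF kset] by simp
    also have "\<dots> = f b - f a" using has_scoreD(7)[OF assms \<open>a \<le> b\<close>] by simp
    finally show "integral {a..b} (deriv f) = f b - f a" .
  qed
qed

text \<open>Two densities of one variable agree almost everywhere, and locally absolutely continuous
  ones are continuous, so they agree everywhere. The infimum in \<open>fisher_information\<close> is
  therefore over a single function.\<close>

lemma has_score_unique:
  assumes Z: "has_score M Z f k" and AC: "locally_AC f'" "\<And>z. 0 \<le> f' z"
    "distributed M lborel Z (\<lambda>z. ennreal (f' z))"
  shows "f' = f"
proof (rule continuous_AE_eq)
  show "continuous_on UNIV f'" "continuous_on UNIV f"
    using AC has_score_locally_AC[OF Z] by (auto intro: locally_AC_continuous)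
  have "density lborel (\<lambda>z. ennreal (f' z)) = density lborel (\<lambda>z. ennreal (f z))"
    using Z AC(3) by (simp add: has_score_def distributed_def)
  then have "AE z in lborel. ennreal (f' z) = ennreal (f z)"
    using Z AC(3) by (subst sigma_finite_measure.density_unique_iff[OF sigma_finite_lborel, symmetric])
       (auto simp: has_score_def distributed_def)
  then show "AE z in lborel. f' z = f z"
    using Z AC(2) by (simp add: has_score_def)
qed

lemma has_score_fisher_information:
  assumes Z: "has_score M Z f k"
  shows "fisher_information M Z = ennreal (fisher_int f k)"
proof -
  have "{f :: real \<Rightarrow> real. (\<forall>z. 0 \<le> f z) \<and> distributed M lborel Z (\<lambda>z. ennreal (f z)) \<and> locally_AC f} = {f}"
    using has_score_unique[OF Z] has_score_locally_AC[OF Z] has_scoreD(1,3)[OF Z] by blast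
  then have "fisher_information M Z = (\<integral>\<^sup>+ z. ennreal ((deriv f z)\<^sup>2 / f z) \<partial>lborel)"
    by (simp add: fisher_information_def)
  also have "\<dots> = (\<integral>\<^sup>+ z. ennreal ((k z)\<^sup>2 / f z) \<partial>lborel)"
    using has_score_AE_derivative[OF Z]
    by (intro nn_integral_cong_AE) (auto elim!: eventually_mono dest: DERIV_imp_deriv)
  also have "\<dots> = ennreal (fisher_int f k)"
    using has_scoreD(3,6)[OF Z] by (intro nn_integral_eq_integral) simp_all
  finally show ?thesis .
qed

text \<open>A finite infimum is not over the empty set. Integrability of the derivative on the whole
  line, beyond bounded intervals, follows from \<open>\<bar>k\<bar> \<le> k^2 / f + f\<close>, whose
  right-hand side integrates to the Fisher information plus the total mass.\<close>

lemma fisher_information_finite_has_score: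
  assumes M: "prob_space M" and fin: "fisher_information M Z < \<top>"
  obtains f k where "has_score M Z f k"
proof -
  interpret prob_space M by fact
  from fin obtain f where f: "\<And>z. 0 \<le> f z" "distributed M lborel Z (\<lambda>z. ennreal (f z))" "locally_AC f"
    and I: "(\<integral>\<^sup>+ z. ennreal ((deriv f z)\<^sup>2 / f z) \<partial>lborel) < \<top>"
    unfolding fisher_information_def INF_less_iff by auto
  have cont: "continuous_on UNIV f" by (rule locally_AC_continuous) fact
  then have [measurable]: "f \<in> borel_measurable borel" by (rule borel_measurable_continuous_onI)
  \<comment> \<open>A limit along a fixed sequence of increments is Borel measurable and equals
    \<open>deriv f\<close> where \<open>f\<close> is positive and differentiable. At zeros of
    \<open>f\<close> the value 0 is prescribed; it is the derivative there if one exists, as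
    \<open>f\<close> has a minimum.\<close>
  define k where "k z = (if f z = 0 then 0 else lim (\<lambda>n. (f (z + inverse (real (Suc n))) - f z) / inverse (real (Suc n))))" for z
  have [measurable]: "k \<in> borel_measurable borel" unfolding k_def by measurable
  have k: "k z = deriv f z" if "f differentiable at z" for z
  proof (cases "f z = 0")
    case True
    have D: "(f has_real_derivative deriv f z) (at z)"
      using that by (simp add: DERIV_deriv_iff_real_differentiable)
    have "deriv f z = 0"
      by (rule DERIV_local_min[OF D, of 1]) (use f True in auto)
    then show ?thesis using True by (simp add: k_def)
  next
    case False
    have D: "(f has_real_derivative deriv f z) (at z)"
      using that by (simp add: DERIV_deriv_iff_real_differentiable)
    have "((\<lambda>h. (f (z + h) - f z) / h) \<longlongrightarrow> deriv f z) (at 0)"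
      using D by (simp add: DERIV_def)
    then have "(\<lambda>n. (f (z + inverse (real (Suc n))) - f z) / inverse (real (Suc n))) \<longlonglongrightarrow> deriv f z"
      by (rule filterlim_compose)
         (simp add: filterlim_at LIMSEQ_inverse_real_of_nat del: of_nat_Suc)
    then show ?thesis using False by (simp add: k_def limI)
  qed
  have AE_diff: "AE z in lborel. f differentiable at z" using f by (simp add: locally_AC_def)
  have "(\<integral>\<^sup>+ z. ennreal ((k z)\<^sup>2 / f z) \<partial>lborel) = (\<integral>\<^sup>+ z. ennreal ((deriv f z)\<^sup>2 / f z) \<partial>lborel)"
    using AE_diff by (intro nn_integral_cong_AE) (auto elim!: eventually_mono simp: k)
  then have int: "integrable lborel (\<lambda>z. (k z)\<^sup>2 / f z)"
    using I f(1) by (auto simp: integrable_iff_bounded)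
  have int_f: "integrable lborel f"
  proof -
    have "(\<integral>\<^sup>+ z. ennreal (f z) \<partial>lborel) = emeasure (distr M lborel Z) UNIV"
      using f(2) by (simp add: distributed_def emeasure_density)
    also have "\<dots> = 1"
      using f(2) emeasure_space_1 by (subst emeasure_distr) (auto simp: distributed_def)
    finally show ?thesis using f(1) by (auto simp: integrable_iff_bounded)
  qed
  have k_le: "\<bar>k z\<bar> \<le> (k z)\<^sup>2 / f z + f z" for z
  proof (cases "f z = 0")
    case False
    then have "f z > 0" using f(1)[of z] by simp
    have "0 \<le> \<bar>k z\<bar> * f z" using f(1)[of z] by simp
    then have "\<bar>k z\<bar> * f z \<le> (k z)\<^sup>2 + (f z)\<^sup>2"
      using sum_squares_bound[of "\<bar>k z\<bar>" "f z"] unfolding power2_abs by linarith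
    then have "\<bar>k z\<bar> \<le> ((k z)\<^sup>2 + (f z)\<^sup>2) / f z"
      using \<open>f z > 0\<close> by (simp add: pos_le_divide_eq)
    also have "\<dots> = (k z)\<^sup>2 / f z + f z"
      using \<open>f z > 0\<close> by (simp add: add_divide_distrib power2_eq_square)
    finally show ?thesis .
  qed (simp add: k_def)
  have int_k: "integrable lborel k"
  proof (rule Bochner_Integration.integrable_bound[OF Bochner_Integration.integrable_add[OF int int_f]])
    show "AE z in lborel. norm (k z) \<le> norm ((k z)\<^sup>2 / f z + f z)"
      using order_trans[OF k_le abs_ge_self] by simp
  qed simp
  have "f b - f a = (LBINT z:{a..b}. k z)" if "a \<le> b" for a b
  proof -
    obtain N where N: "negligible N" "\<And>z. z \<notin> N \<Longrightarrow> f differentiable at z"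
      using AE_lborel_negligible[OF AE_diff] by blast
    have "set_integrable lborel {a..b} k"
      using integrable_real_mult_indicator[OF _ int_k, of "{a..b}"]
      by (simp add: set_integrable_def mult.commute)
    then have "(LBINT z:{a..b}. k z) = integral {a..b} k"
      by (rule set_borel_integral_eq_integral)
    also have "\<dots> = integral {a..b} (deriv f)"
      by (rule integral_spike[OF N(1)]) (simp add: N(2) k)
    finally show ?thesis using f(3) that by (auto simp: locally_AC_def)
  qed
  moreover have "f z = 0 \<longrightarrow> k z = 0" for z by (simp add: k_def)
  ultimately have "has_score M Z f k"
    unfolding has_score_def using f(1,2) int int_k by simp
  then show ?thesis by (rule that)
qed

section \<open>Convolution with a probability measure on the line\<close>

locale lborel_times_prob = prob_space \<nu> for \<nu> :: "real measure" +
  assumes sets_eq: "sets \<nu> = sets borel"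
begin

lemma sets_cong [measurable_cong]: "sets \<nu> = sets borel"
  by (rule sets_eq)

abbreviation LN :: "(real \<times> real) measure" where "LN \<equiv> lborel \<Otimes>\<^sub>M \<nu>"

sublocale P: pair_sigma_finite lborel \<nu> ..

text \<open>Translation invariance of Lebesgue measure in each section with \<open>w\<close> fixed.
  The map is the substitution that trades a summand \<open>z\<close> for the sum
  \<open>z + w\<close> and leaves the other summand alone.\<close>

lemma distr_shift: "distr LN LN (\<lambda>(z, w). (z + w, w)) = LN"
proof (rule measure_eqI)
  fix A assume "A \<in> sets (distr LN LN (\<lambda>(z, w). (z + w, w)))"
  then have A: "A \<in> sets LN" by simp
  define T :: "real \<times> real \<Rightarrow> real \<times> real" where "T = (\<lambda>(z, w). (z + w, w))"
  have T: "T \<in> measurable LN LN" unfolding T_def by measurable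
  have sp: "space LN = UNIV"
    using sets_eq_imp_space_eq[OF sets_eq] by (simp add: space_pair_measure)
  have "emeasure (distr LN LN T) A = emeasure LN (T -` A)"
    using emeasure_distr[OF T A] by (simp add: sp)
  also have "\<dots> = (\<integral>\<^sup>+w. emeasure lborel ((\<lambda>z. (z, w)) -` T -` A) \<partial>\<nu>)"
    using measurable_sets[OF T A] by (intro P.emeasure_pair_measure_alt2) (simp add: sp)
  also have "\<dots> = (\<integral>\<^sup>+w. emeasure lborel ((\<lambda>z. (z, w)) -` A) \<partial>\<nu>)"
  proof (intro nn_integral_cong)
    fix w :: real
    have m: "(\<lambda>z. (z, w)) -` A \<in> sets borel"
      using sets_Pair2[OF A, of w] by simp
    have "emeasure lborel ((\<lambda>z. (z, w)) -` A) = emeasure (distr lborel borel ((+) w)) ((\<lambda>z. (z, w)) -` A)"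
      by (simp add: lborel_distr_plus)
    also have "\<dots> = emeasure lborel ((+) w -` (\<lambda>z. (z, w)) -` A)"
      using m by (subst emeasure_distr) auto
    also have "(+) w -` (\<lambda>z. (z, w)) -` A = (\<lambda>z. (z, w)) -` T -` A"
      by (auto simp: T_def add.commute)
    finally show "emeasure lborel ((\<lambda>z. (z, w)) -` T -` A) = emeasure lborel ((\<lambda>z. (z, w)) -` A)"
      by simp
  qed
  also have "\<dots> = emeasure LN A"
    using A by (rule P.emeasure_pair_measure_alt2[symmetric])
  finally show "emeasure (distr LN LN (\<lambda>(z, w). (z + w, w))) A
      = emeasure LN A"
    by (simp add: T_def)
qed simp

lemma shift_measurable: "(\<lambda>(z, w). (z + w, w)) \<in> measurable LN LN"
  by measurable

lemma
  fixes F :: "real \<Rightarrow> real \<Rightarrow> real"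
  assumes F: "case_prod F \<in> borel_measurable LN"
  shows integrable_shift:
      "integrable LN (\<lambda>(z, w). F (z + w) w) \<longleftrightarrow> integrable LN (case_prod F)"
    and integral_shift:
      "(\<integral>(z, w). F (z + w) w \<partial>LN) = (\<integral>(y, w). F y w \<partial>LN)"
  using integrable_distr_eq[OF shift_measurable F] integral_distr[OF shift_measurable F]
  unfolding distr_shift by (simp_all add: case_prod_beta')

lemma nn_integral_shift:
  fixes F :: "real \<Rightarrow> real \<Rightarrow> ennreal"
  assumes F: "case_prod F \<in> borel_measurable LN"
  shows "(\<integral>\<^sup>+(z, w). F (z + w) w \<partial>LN) = (\<integral>\<^sup>+(y, w). F y w \<partial>LN)"
  using nn_integral_distr[OF shift_measurable, of "case_prod F"] F
  unfolding distr_shift by (simp add: case_prod_beta')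

lemma
  fixes g :: "real \<Rightarrow> real"
  assumes g: "integrable lborel g"
  shows integrable_convolution: "integrable LN (\<lambda>(y, w). g (y - w))"
    and integral_convolution: "(\<integral>y. (\<integral>w. g (y - w) \<partial>\<nu>) \<partial>lborel) = (\<integral>z. g z \<partial>lborel)"
proof -
  have gm [measurable]: "g \<in> borel_measurable borel" using g by auto
  have "integrable (distr LN lborel fst) g"
    using g by (simp add: distr_pair_fst)
  then have gz: "integrable LN (\<lambda>(z, w). g z)"
    by (subst (asm) integrable_distr_eq) (auto simp: case_prod_beta')
  have m: "(\<lambda>(y, w). g (y - w)) \<in> borel_measurable LN" by measurable
  have "integrable LN (\<lambda>(z, w). g (z + w - w))" using gz by simp
  then show *: "integrable LN (\<lambda>(y, w). g (y - w))"
    by (rule integrable_shift[OF m, THEN iffD1])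
  have "(\<integral>y. (\<integral>w. g (y - w) \<partial>\<nu>) \<partial>lborel) = (\<integral>(y, w). g (y - w) \<partial>LN)"
    using P.integral_fst'[OF *] by simp
  also have "\<dots> = (\<integral>(z, w). g (z + w - w) \<partial>LN)"
    by (rule integral_shift[OF m, symmetric])
  also have "\<dots> = (\<integral>(z, w). g z \<partial>LN)" by simp
  also have "\<dots> = (\<integral>z. g z \<partial>distr LN lborel fst)"
    by (subst integral_distr) (auto simp: case_prod_beta')
  finally show "(\<integral>y. (\<integral>w. g (y - w) \<partial>\<nu>) \<partial>lborel) = (\<integral>z. g z \<partial>lborel)"
    by (simp add: distr_pair_fst)
qed

end

lemma has_score_set_integrable:
  assumes "has_score M Z f k"
  shows "set_integrable lborel {a..b} k"
  using integrable_real_mult_indicator[OF _ has_scoreD(5)[OF assms], of "{a..b}"]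
  by (simp add: set_integrable_def mult.commute)

text \<open>Up to its value at 0, \<open>f\<close> is an integral of the integrable
  \<open>k\<close>. A bounded \<open>f\<close> can be integrated against any probability law, so its
  convolution exists at every point.\<close>

lemma has_score_bounded:
  assumes "has_score M Z f k"
  obtains B where "\<And>z. \<bar>f z\<bar> \<le> B"
proof
  note D = has_scoreD[OF assms]
  have le: "\<bar>LBINT z:{a..b}. k z\<bar> \<le> (\<integral>z. \<bar>k z\<bar> \<partial>lborel)" for a b
  proof -
    have "\<bar>LBINT z:{a..b}. k z\<bar> \<le> (\<integral>z. \<bar>indicator {a..b} z * k z\<bar> \<partial>lborel)"
      unfolding set_lebesgue_integral_def
      using integral_abs_bound[of lborel "\<lambda>z. indicator {a..b} z * k z"] by simp
    also have "\<dots> \<le> (\<integral>z. \<bar>k z\<bar> \<partial>lborel)"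
      using D(5) has_score_set_integrable[OF assms, of a b]
      by (intro integral_mono) (auto simp: set_integrable_def indicator_def)
    finally show ?thesis .
  qed
  fix z
  show "\<bar>f z\<bar> \<le> \<bar>f 0\<bar> + (\<integral>z. \<bar>k z\<bar> \<partial>lborel)"
  proof (cases "0 \<le> z")
    case True
    then have "\<bar>f z - f 0\<bar> \<le> (\<integral>z. \<bar>k z\<bar> \<partial>lborel)" using D(7) le by metis
    then show ?thesis by linarith
  next
    case False
    then have "\<bar>f 0 - f z\<bar> \<le> (\<integral>z. \<bar>k z\<bar> \<partial>lborel)" using D(7)[of z 0] le[of z 0] by simp
    then show ?thesis by linarith
  qed
qed

lemma has_score_integral_density:
  fixes g :: "real \<Rightarrow> real"
  assumes Z: "has_score M Z f k" and g: "g \<in> borel_measurable borel"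
  shows "integrable M (\<lambda>x. g (Z x)) \<longleftrightarrow> integrable lborel (\<lambda>z. f z * g z)"
    and "(\<integral>x. g (Z x) \<partial>M) = (\<integral>z. f z * g z \<partial>lborel)"
proof -
  note D = has_scoreD[OF Z]
  show "integrable M (\<lambda>x. g (Z x)) \<longleftrightarrow> integrable lborel (\<lambda>z. f z * g z)"
    using distributed_integrable[OF D(1), of g] D(3) g by simp
  show "(\<integral>x. g (Z x) \<partial>M) = (\<integral>z. f z * g z \<partial>lborel)"
    using distributed_integral[OF D(1), of g] D(3) g by simp
qed

text \<open>Integrating \<open>f y - f (y - 1)\<close>, which is the average of \<open>k\<close> over \<open>[y - 1, y]\<close>, yields both
  \<open>0\<close> and the integral of \<open>k\<close>.\<close>

lemma has_score_integral_derivative: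
  assumes M: "prob_space M" and Z: "has_score M Z f k"
  shows "(\<integral>z. k z \<partial>lborel) = 0"
proof -
  interpret M: prob_space M by fact
  note D = has_scoreD[OF Z]
  define \<nu> where "\<nu> = uniform_measure lborel {0..1::real}"
  interpret \<nu>: lborel_times_prob \<nu>
    by (intro lborel_times_prob.intro prob_space_uniform_measure lborel_times_prob_axioms.intro)
       (auto simp: \<nu>_def intro!: prob_space_uniform_measure)
  have [measurable]: "k \<in> borel_measurable borel" using D(5) by auto
  have f_int: "integrable lborel f"
    using has_score_integral_density(1)[OF Z, of "\<lambda>_. 1"] by simp
  have avg: "(\<integral>w. k (y - w) \<partial>\<nu>) = f y - f (y - 1)" for y
  proof -
    have "\<nu> = density lborel (\<lambda>w. ennreal (indicator {0..1} w))"
      unfolding \<nu>_def uniform_measure_def by (rule density_cong) (auto simp: indicator_def)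
    then have "(\<integral>w. k (y - w) \<partial>\<nu>) = (\<integral>w. indicator {0..1} w * k (y - w) \<partial>lborel)"
      by (simp add: integral_density)
    also have "\<dots> = (\<integral>z. indicator {y - 1..y} z * k z \<partial>lborel)"
      by (subst (2) lborel_integral_real_affine[of "-1" _ y])
         (auto intro!: Bochner_Integration.integral_cong simp: indicator_def)
    finally show ?thesis using D(7)[of "y - 1" y] by (simp add: set_lebesgue_integral_def)
  qed
  have shift: "(\<integral>y. f (y - 1) \<partial>lborel) = (\<integral>y. f y \<partial>lborel)" "integrable lborel (\<lambda>y. f (y - 1))"
    using lborel_integral_real_affine[of 1 f "-1"] lborel_integrable_real_affine[OF f_int, of 1 "-1"]
    by simp_all
  have "(\<integral>z. k z \<partial>lborel) = (\<integral>y. f y - f (y - 1) \<partial>lborel)"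
    using \<nu>.integral_convolution[OF D(5)] by (simp add: avg)
  also have "\<dots> = 0" using f_int shift by simp
  finally show ?thesis .
qed

section \<open>The score of a sum of two independent variables\<close>

context
  fixes M :: "'a measure" and Z W :: "'a \<Rightarrow> real" and f k :: "real \<Rightarrow> real"
  assumes M: "prob_space M" and indep: "prob_space.indep_var M borel Z borel W"
    and Z: "has_score M Z f k"
begin

interpretation M: prob_space M by (rule M)

private definition "\<nu> = distr M borel W"
text \<open>\<open>h\<close> is going to be the density of \<open>Z + W\<close> and \<open>l\<close>
  a version of its derivative, so that \<open>l / h\<close> is the score of the sum.\<close>

private definition "h y = (\<integral>w. f (y - w) \<partial>\<nu>)"
private definition "l y = (\<integral>w. k (y - w) \<partial>\<nu>)"

private lemma W_measurable [measurable]: "W \<in> borel_measurable M"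
  using indep by (rule M.indep_var_rv2)

private lemma Z_measurable [measurable]: "Z \<in> borel_measurable M"
  using indep by (rule M.indep_var_rv1)

interpretation \<nu>: lborel_times_prob \<nu>
  unfolding \<nu>_def
  by (intro lborel_times_prob.intro lborel_times_prob_axioms.intro M.prob_space_distr) auto

private lemmas D = has_scoreD[OF Z]

private lemma fk_measurable [measurable]: "f \<in> borel_measurable borel" "k \<in> borel_measurable borel"
  using D(2,5) by auto

private lemma lh_measurable [measurable]: "h \<in> borel_measurable borel" "l \<in> borel_measurable borel"
proof -
  have "h \<in> borel_measurable lborel" "l \<in> borel_measurable lborel"
    unfolding h_def l_def by measurable
  then show "h \<in> borel_measurable borel" "l \<in> borel_measurable borel" by simp_all
qed

private lemma f_integrable: "integrable \<nu> (\<lambda>w. f (y - w))"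
proof -
  obtain B where "\<And>z. \<bar>f z\<bar> \<le> B" using has_score_bounded[OF Z] by blast
  then show ?thesis by (intro \<nu>.integrable_const_bound[of _ B]) auto
qed

private lemma h_nonneg: "h y \<ge> 0"
  unfolding h_def using D(3) by simp

text \<open>As \<open>f\<close> is nonnegative, a zero of \<open>h\<close> forces
  \<open>f (y - w) = 0\<close> for almost all \<open>w\<close>, and \<open>k\<close> vanishes at the
  zeros of \<open>f\<close>.\<close>

private lemma l_eq_0: "h y = 0 \<Longrightarrow> l y = 0"
proof -
  assume "h y = 0"
  then have "AE w in \<nu>. f (y - w) = 0"
    unfolding h_def using f_integrable D(3) by (subst (asm) integral_nonneg_eq_0_iff_AE) auto
  then have "AE w in \<nu>. k (y - w) = 0" by eventually_elim (rule D(4))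
  then show "l y = 0" unfolding l_def by (rule integral_eq_zero_AE)
qed

private lemma joint:
  "distr M \<nu>.LN (\<lambda>x. (Z x, W x)) = density \<nu>.LN (\<lambda>(z, w). ennreal (f z))"
proof -
  have "distr M \<nu>.LN (\<lambda>x. (Z x, W x)) = distr M (borel \<Otimes>\<^sub>M borel) (\<lambda>x. (Z x, W x))"
    by (intro distr_cong sets_pair_measure_cong) (auto simp: \<nu>_def)
  also have "\<dots> = distr M borel Z \<Otimes>\<^sub>M distr M borel W"
    using indep by (simp add: M.indep_var_distribution_eq)
  also have "distr M borel Z = distr M lborel Z" by (intro distr_cong) auto
  also have "\<dots> = density lborel (\<lambda>z. ennreal (f z))" using D(1) by (simp add: distributed_def)
  also have "density lborel (\<lambda>z. ennreal (f z)) \<Otimes>\<^sub>M distr M borel W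
      = density lborel (\<lambda>z. ennreal (f z)) \<Otimes>\<^sub>M density \<nu> (\<lambda>_. 1)"
    by (simp add: \<nu>_def density_1)
  also have "\<dots> = density \<nu>.LN (\<lambda>(z, w). ennreal (f z) * 1)"
    by (rule pair_measure_density) (auto simp: density_1 \<nu>.sigma_finite_measure_axioms)
  finally show ?thesis by simp
qed

private lemma distributed_sum: "distributed M lborel (\<lambda>x. Z x + W x) (\<lambda>y. ennreal (h y))"
  unfolding distributed_def
proof (intro conjI)
  show "distr M lborel (\<lambda>x. Z x + W x) = density lborel (\<lambda>y. ennreal (h y))"
  proof (rule measure_eqI)
    fix A assume "A \<in> sets (distr M lborel (\<lambda>x. Z x + W x))"
    then have A [measurable]: "A \<in> sets borel" by simp
    have ZW: "(\<lambda>x. (Z x, W x)) \<in> measurable M \<nu>.LN" by measurable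
    have "emeasure (distr M lborel (\<lambda>x. Z x + W x)) A = (\<integral>\<^sup>+y. indicator A y \<partial>distr M lborel (\<lambda>x. Z x + W x))"
      by simp
    also have "\<dots> = (\<integral>\<^sup>+x. indicator A (Z x + W x) \<partial>M)"
      by (subst nn_integral_distr) auto
    also have "\<dots> = (\<integral>\<^sup>+(z, w). indicator A (z + w) \<partial>distr M \<nu>.LN (\<lambda>x. (Z x, W x)))"
      by (subst nn_integral_distr[OF ZW]) (auto simp: case_prod_beta')
    also have "\<dots> = (\<integral>\<^sup>+(z, w). ennreal (f z) * indicator A (z + w) \<partial>\<nu>.LN)"
      unfolding joint by (subst nn_integral_density) (auto simp: case_prod_beta')
    also have "\<dots> = (\<integral>\<^sup>+(y, w). ennreal (f (y - w)) * indicator A y \<partial>\<nu>.LN)"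
      using \<nu>.nn_integral_shift[of "\<lambda>y w. ennreal (f (y - w)) * indicator A y"] by simp
    also have "\<dots> = (\<integral>\<^sup>+y. (\<integral>\<^sup>+w. ennreal (f (y - w)) * indicator A y \<partial>\<nu>) \<partial>lborel)"
      by (subst \<nu>.nn_integral_fst[symmetric]) auto
    also have "\<dots> = (\<integral>\<^sup>+y. ennreal (h y) * indicator A y \<partial>lborel)"
      unfolding h_def using f_integrable D(3)
      by (intro nn_integral_cong) (auto simp: nn_integral_multc nn_integral_eq_integral)
    also have "\<dots> = emeasure (density lborel (\<lambda>y. ennreal (h y))) A"
      by (simp add: emeasure_density)
    finally show "emeasure (distr M lborel (\<lambda>x. Z x + W x)) A = emeasure (density lborel (\<lambda>y. ennreal (h y))) A" .
  qed simp
qed auto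

private lemma l_integrable: "integrable lborel l"
  unfolding l_def using \<nu>.P.integrable_fst'[OF \<nu>.integrable_convolution[OF D(5)]] by simp

text \<open>Each translate of \<open>f\<close> is the indefinite integral of the same translate of
  \<open>k\<close>; Fubini's theorem exchanges this integral with the average over
  \<open>w\<close>.\<close>

private lemma h_diff:
  assumes "a \<le> b"
  shows "h b - h a = (LBINT y:{a..b}. l y)"
proof -
  have int: "integrable \<nu>.LN (\<lambda>(y, w). indicator {a..b} y * k (y - w))"
    by (rule Bochner_Integration.integrable_bound[OF \<nu>.integrable_convolution[OF D(5)]])
       (auto simp: indicator_def)
  have "h b - h a = (\<integral>w. f (b - w) - f (a - w) \<partial>\<nu>)"
    unfolding h_def using f_integrable by simp
  also have "\<dots> = (\<integral>w. (\<integral>y. indicator {a..b} y * k (y - w) \<partial>lborel) \<partial>\<nu>)"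
  proof (intro Bochner_Integration.integral_cong refl)
    fix w
    have "f (b - w) - f (a - w) = (\<integral>z. indicator {a - w..b - w} z * k z \<partial>lborel)"
      using D(7)[of "a - w" "b - w"] assms by (simp add: set_lebesgue_integral_def)
    also have "\<dots> = (\<integral>y. indicator {a - w..b - w} (- w + 1 * y) * k (- w + 1 * y) \<partial>lborel)"
      by (subst lborel_integral_real_affine[of 1 _ "- w"]) auto
    also have "\<dots> = (\<integral>y. indicator {a..b} y * k (y - w) \<partial>lborel)"
      by (intro Bochner_Integration.integral_cong) (auto simp: indicator_def)
    finally show "f (b - w) - f (a - w) = (\<integral>y. indicator {a..b} y * k (y - w) \<partial>lborel)" .
  qed
  also have "\<dots> = (\<integral>y. (\<integral>w. indicator {a..b} y * k (y - w) \<partial>\<nu>) \<partial>lborel)"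
    by (rule \<nu>.P.Fubini_integral[OF int])
  also have "\<dots> = (LBINT y:{a..b}. l y)"
    by (simp add: set_lebesgue_integral_def l_def)
  finally show ?thesis .
qed

text \<open>Cauchy-Schwarz for \<open>k = k / sqrt f * sqrt f\<close> under the average over
  \<open>w\<close>. This is the pointwise form of the fact that adding an independent variable does
  not increase the Fisher information.\<close>

private lemma l_square_le:
  assumes "integrable \<nu> (\<lambda>w. (k (y - w))\<^sup>2 / f (y - w))"
  shows "(l y)\<^sup>2 / h y \<le> (\<integral>w. (k (y - w))\<^sup>2 / f (y - w) \<partial>\<nu>)"
proof (cases "h y = 0")
  case True
  then show ?thesis using D(3) by simp
next
  case False
  have kf: "k z / sqrt (f z) * sqrt (f z) = k z" for z
    using D(4)[of z] by auto
  have sq: "(k z / sqrt (f z))\<^sup>2 = (k z)\<^sup>2 / f z" for z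
    using D(3) by (simp add: power_divide)
  have "(l y)\<^sup>2 = (\<integral>w. (k (y - w) / sqrt (f (y - w))) * sqrt (f (y - w)) \<partial>\<nu>)\<^sup>2"
    unfolding l_def kf ..
  also have "\<dots> \<le> (\<integral>w. (k (y - w) / sqrt (f (y - w)))\<^sup>2 \<partial>\<nu>) * (\<integral>w. (sqrt (f (y - w)))\<^sup>2 \<partial>\<nu>)"
    using assms f_integrable[of y] D(3)
    by (intro integral_Cauchy_Schwarz_square) (auto simp: square_integrable_def sq)
  also have "\<dots> = (\<integral>w. (k (y - w))\<^sup>2 / f (y - w) \<partial>\<nu>) * h y"
    using D(3) by (simp add: sq h_def)
  finally show ?thesis using False h_nonneg[of y] by (simp add: pos_divide_le_eq)
qed

private lemma score_square_integrable: "integrable lborel (\<lambda>y. (l y)\<^sup>2 / h y)"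
proof (rule Bochner_Integration.integrable_bound)
  let ?q = "\<lambda>z. (k z)\<^sup>2 / f z"
  note int = \<nu>.integrable_convolution[OF D(6)]
  show "integrable lborel (\<lambda>y. \<integral>w. ?q (y - w) \<partial>\<nu>)"
    using \<nu>.P.integrable_fst'[OF int] by simp
  have "AE y in lborel. integrable \<nu> (\<lambda>w. ?q (y - w))"
    using \<nu>.P.AE_integrable_fst'[OF int] by simp
  then show "AE y in lborel. norm ((l y)\<^sup>2 / h y) \<le> norm (\<integral>w. ?q (y - w) \<partial>\<nu>)"
  proof eventually_elim
    case (elim y)
    show ?case using l_square_le[OF elim] h_nonneg[of y] by simp
  qed
qed measurable

private lemma has_score_sum: "has_score M (\<lambda>x. Z x + W x) h l"
  unfolding has_score_def
  using distributed_sum h_nonneg l_eq_0 l_integrable score_square_integrable h_diff lh_measurable(1)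
  by blast

text \<open>The density \<open>f\<close> cancels against the denominator of the score of
  \<open>Z\<close>. After the substitution \<open>y = z + w\<close> the integral over
  \<open>w\<close> turns \<open>k (y - w)\<close> into \<open>l y\<close>, and \<open>l\<close>
  times \<open>l / h\<close> is the integrand on the right.\<close>

private lemma score_projection:
  "(\<integral>x. k (Z x) / f (Z x) * (l (Z x + W x) / h (Z x + W x)) \<partial>M) = (fisher_int h l)"
proof -
  define \<rho> where "\<rho> y = l y / h y" for y
  have [measurable]: "\<rho> \<in> borel_measurable borel" unfolding \<rho>_def by measurable
  have ZW: "(\<lambda>x. (Z x, W x)) \<in> measurable M \<nu>.LN" by measurable
  have fk: "f z * (k z / f z * c) = k z * c" for z c using D(4)[of z] by auto
  \<comment> \<open>Fubini's theorem needs joint integrability. It comes from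
    \<open>\<bar>k * \<rho>\<bar> \<le> k^2 / f + f * \<rho>^2\<close> with \<open>k\<close> and
    \<open>f\<close> taken at \<open>y - w\<close>; the second term integrates to the Fisher
    information of the sum.\<close>
  have int: "integrable \<nu>.LN (\<lambda>(y, w). k (y - w) * \<rho> y)"
  proof (rule Bochner_Integration.integrable_bound)
    have "(\<integral>\<^sup>+(y, w). ennreal (f (y - w) * (\<rho> y)\<^sup>2) \<partial>\<nu>.LN)
        = (\<integral>\<^sup>+y. (\<integral>\<^sup>+w. ennreal (f (y - w)) * ennreal ((\<rho> y)\<^sup>2) \<partial>\<nu>) \<partial>lborel)"
      using D(3) by (subst \<nu>.nn_integral_fst[symmetric]) (auto simp: ennreal_mult)
    also have "\<dots> = (\<integral>\<^sup>+y. ennreal (h y) * ennreal ((\<rho> y)\<^sup>2) \<partial>lborel)"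
      unfolding h_def using f_integrable D(3)
      by (intro nn_integral_cong) (auto simp: nn_integral_multc nn_integral_eq_integral)
    also have "\<dots> = (\<integral>\<^sup>+y. ennreal ((l y)\<^sup>2 / h y) \<partial>lborel)"
      using h_nonneg by (intro nn_integral_cong) (auto simp: \<rho>_def power_divide power2_eq_square simp flip: ennreal_mult)
    also have "\<dots> < \<infinity>"
      using score_square_integrable h_nonneg by (simp add: integrable_iff_bounded)
    finally have "integrable \<nu>.LN (\<lambda>(y, w). f (y - w) * (\<rho> y)\<^sup>2)"
      using D(3) by (auto simp: integrable_iff_bounded case_prod_beta')
    then show "integrable \<nu>.LN
        (\<lambda>x. (case x of (y, w) \<Rightarrow> (k (y - w))\<^sup>2 / f (y - w)) + (case x of (y, w) \<Rightarrow> f (y - w) * (\<rho> y)\<^sup>2))"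
      by (intro Bochner_Integration.integrable_add \<nu>.integrable_convolution[OF D(6)])
    have "\<bar>k z * c\<bar> \<le> (k z)\<^sup>2 / f z + f z * c\<^sup>2" for z c
    proof (cases "f z = 0")
      case False
      then have pos: "f z > 0" using D(3)[of z] by simp
      have "2 * (\<bar>k z\<bar> / sqrt (f z)) * (sqrt (f z) * \<bar>c\<bar>) \<le> (\<bar>k z\<bar> / sqrt (f z))\<^sup>2 + (sqrt (f z) * \<bar>c\<bar>)\<^sup>2"
        by (rule sum_squares_bound)
      then have "2 * \<bar>k z * c\<bar> \<le> (k z)\<^sup>2 / f z + f z * c\<^sup>2"
        using pos by (simp add: power_divide power_mult_distrib abs_mult)
      then show ?thesis using abs_ge_zero[of "k z * c"] by linarith
    qed (simp add: D(4))
    note le = order_trans[OF this abs_ge_self]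
    show "AE x in \<nu>.LN. norm (case x of (y, w) \<Rightarrow> k (y - w) * \<rho> y)
      \<le> norm ((case x of (y, w) \<Rightarrow> (k (y - w))\<^sup>2 / f (y - w)) + (case x of (y, w) \<Rightarrow> f (y - w) * (\<rho> y)\<^sup>2))"
      by (rule AE_I2) (use le in \<open>simp add: case_prod_beta'\<close>)
  qed measurable
  have "(\<integral>x. k (Z x) / f (Z x) * \<rho> (Z x + W x) \<partial>M)
      = (\<integral>(z, w). k z / f z * \<rho> (z + w) \<partial>distr M \<nu>.LN (\<lambda>x. (Z x, W x)))"
    by (subst integral_distr[OF ZW]) (auto simp: case_prod_beta')
  also have "\<dots> = (\<integral>(z, w). f z * (k z / f z * \<rho> (z + w)) \<partial>\<nu>.LN)"
    unfolding joint case_prod_beta' using D(3) by (subst integral_density) auto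
  also have "\<dots> = (\<integral>(z, w). k z * \<rho> (z + w) \<partial>\<nu>.LN)" unfolding fk ..
  also have "\<dots> = (\<integral>(y, w). k (y - w) * \<rho> y \<partial>\<nu>.LN)"
    using \<nu>.integral_shift[of "\<lambda>y w. k (y - w) * \<rho> y"] by simp
  also have "\<dots> = (\<integral>y. (\<integral>w. k (y - w) * \<rho> y \<partial>\<nu>) \<partial>lborel)"
    using \<nu>.P.integral_fst'[OF int] by simp
  also have "\<dots> = (fisher_int h l)"
    by (simp add: l_def[symmetric] \<rho>_def power2_eq_square)
  finally show ?thesis by (simp add: \<rho>_def)
qed

lemma has_score_add:
  obtains h l where "has_score M (\<lambda>x. Z x + W x) h l"
    "(\<integral>x. k (Z x) / f (Z x) * (l (Z x + W x) / h (Z x + W x)) \<partial>M) = (fisher_int h l)"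
  using has_score_sum score_projection by (rule that)

end

section \<open>Moments and uniqueness of scores\<close>

definition score :: "(real \<Rightarrow> real) \<Rightarrow> (real \<Rightarrow> real) \<Rightarrow> real \<Rightarrow> real" where
  "score f k z = k z / f z"

lemma score_measurable:
  assumes "has_score M Z f k"
  shows "score f k \<in> borel_measurable borel"
proof -
  have [measurable]: "f \<in> borel_measurable borel" "k \<in> borel_measurable borel"
    using has_scoreD(2,5)[OF assms] by auto
  show ?thesis unfolding score_def by measurable
qed

lemma
  assumes Z: "has_score M Z f k"
  shows square_integrable_score: "square_integrable M (\<lambda>x. score f k (Z x))"
    and integral_score_square: "(\<integral>x. (score f k (Z x))\<^sup>2 \<partial>M) = (fisher_int f k)"
proof -
  note D = has_scoreD[OF Z]
  have m: "(\<lambda>z. (score f k z)\<^sup>2) \<in> borel_measurable borel"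
    using score_measurable[OF Z] by simp
  have eq: "f z * (score f k z)\<^sup>2 = (k z)\<^sup>2 / f z" for z
    using D(4)[of z] by (auto simp: score_def power2_eq_square)
  have Zm: "Z \<in> borel_measurable M" using D(1) by (simp add: distributed_def)
  show "square_integrable M (\<lambda>x. score f k (Z x))"
    unfolding square_integrable_def
    using has_score_integral_density(1)[OF Z m] D(6) measurable_compose[OF Zm score_measurable[OF Z]]
    by (simp add: eq)
  show "(\<integral>x. (score f k (Z x))\<^sup>2 \<partial>M) = (fisher_int f k)"
    using has_score_integral_density(2)[OF Z m] by (simp add: eq)
qed

lemma integral_score:
  assumes "prob_space M" and Z: "has_score M Z f k"
  shows "(\<integral>x. score f k (Z x) \<partial>M) = 0"
proof -
  have "f z * score f k z = k z" for z
    using has_scoreD(4)[OF Z, of z] by (auto simp: score_def)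
  then show ?thesis
    using has_score_integral_density(2)[OF Z score_measurable[OF Z]] has_score_integral_derivative[OF assms]
    by simp
qed

text \<open>The density is unique, and its derivative is unique up to a Lebesgue null set, which is
  null for the law of \<open>Z\<close> as well. The sum over a set \<open>t\<close> gets one chosen
  score but arises by convolution from several subsets \<open>s\<close>, each of which yields its
  own version.\<close>

lemma score_unique:
  assumes Z: "has_score M Z f k" and Z': "has_score M Z f' k'"
  shows "AE \<omega> in M. score f k (Z \<omega>) = score f' k' (Z \<omega>)"
proof -
  have f: "f' = f"
    using has_score_unique[OF Z has_score_locally_AC[OF Z']] has_scoreD(1,3)[OF Z'] by blast
  have "AE z in lborel. k z = k' z"
    using has_score_AE_derivative[OF Z] has_score_AE_derivative[OF Z']
    by eventually_elim (use f DERIV_unique in blast)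
  then have "AE z in density lborel (\<lambda>z. ennreal (f z)). score f k z = score f' k' z"
    using has_scoreD(2)[OF Z] by (subst AE_density) (auto simp: score_def f elim!: eventually_mono)
  moreover have "distr M lborel Z = density lborel (\<lambda>z. ennreal (f z))"
    using has_scoreD(1)[OF Z] by (simp add: distributed_def)
  ultimately have "AE z in distr M lborel Z. score f k z = score f' k' z" by (simp only:)
  moreover have "Z \<in> measurable M lborel"
    using has_scoreD(1)[OF Z] by (simp add: distributed_def)
  ultimately show ?thesis by (rule AE_distrD[rotated])
qed

text \<open>The score of a sum is the conditional expectation, given the sum, of the score of a summand;
  only the product with the score of the sum itself is needed.\<close>

lemma score_add_projection:
  assumes M: "prob_space M" and indep: "prob_space.indep_var M borel Z borel W"
    and Z: "has_score M Z f k" and Y: "has_score M (\<lambda>x. Z x + W x) h l"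
  shows "(\<integral>x. score f k (Z x) * score h l (Z x + W x) \<partial>M) = (fisher_int h l)"
proof -
  obtain h' l' where Y': "has_score M (\<lambda>x. Z x + W x) h' l'"
    and proj: "(\<integral>x. k (Z x) / f (Z x) * (l' (Z x + W x) / h' (Z x + W x)) \<partial>M) = (\<integral>y. (l' y)\<^sup>2 / h' y \<partial>lborel)"
    by (rule has_score_add[OF M indep Z])
  note AE = score_unique[OF Y Y']
  note m = measurable_compose[OF _ score_measurable]
  have Zm: "Z \<in> borel_measurable M" using has_scoreD(1)[OF Z] by (simp add: distributed_def)
  have Ym: "(\<lambda>x. Z x + W x) \<in> borel_measurable M" using has_scoreD(1)[OF Y] by (simp add: distributed_def)
  note [measurable] = m[OF Zm Z] m[OF Ym Y] m[OF Ym Y']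
  have "(\<integral>x. score f k (Z x) * score h l (Z x + W x) \<partial>M)
      = (\<integral>x. score f k (Z x) * score h' l' (Z x + W x) \<partial>M)"
    using AE by (intro integral_cong_AE) (auto elim: eventually_mono)
  also have "\<dots> = (\<integral>y. (l' y)\<^sup>2 / h' y \<partial>lborel)"
    using proj by (simp add: score_def)
  also have "\<dots> = (\<integral>x. (score h' l' (Z x + W x))\<^sup>2 \<partial>M)"
    by (rule integral_score_square[OF Y', symmetric])
  also have "\<dots> = (\<integral>x. (score h l (Z x + W x))\<^sup>2 \<partial>M)"
    using AE by (intro integral_cong_AE) (auto elim: eventually_mono)
  finally show ?thesis by (simp add: integral_score_square[OF Y])
qed

subsection \<open>Maximal correlation\<close>

text \<open>Inequalities between covariances and variances remain meaningful for degenerate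
  variables, for which the quotient in \<open>pearson\<close> has denominator 0.\<close>

definition covar :: "'a measure \<Rightarrow> ('a \<Rightarrow> real) \<Rightarrow> ('a \<Rightarrow> real) \<Rightarrow> real" where
  "covar M A B = (\<integral>x. (A x - (\<integral>x. A x \<partial>M)) * (B x - (\<integral>x. B x \<partial>M)) \<partial>M)"

abbreviation var :: "'a measure \<Rightarrow> ('a \<Rightarrow> real) \<Rightarrow> real" where
  "var M A \<equiv> covar M A A"

lemma pearson_covar: "pearson M A B = covar M A B / (sqrt (var M A) * sqrt (var M B))"
  by (simp add: pearson_def covar_def power2_eq_square)

lemma covar_self_nonneg: "var M A \<ge> 0"
  by (simp add: covar_def)

lemma (in prob_space) covar_eq:
  assumes A: "square_integrable M A" and B: "square_integrable M B"
  shows "covar M A B = expectation (\<lambda>x. A x * B x) - expectation A * expectation B"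
proof -
  note int = square_integrable_integrable[OF A] square_integrable_integrable[OF B]
    square_integrable_mult[OF A B]
  have "covar M A B = expectation (\<lambda>x. A x * B x - expectation A * B x - expectation B * A x
      + expectation A * expectation B)"
    unfolding covar_def by (simp add: algebra_simps)
  also have "\<dots> = expectation (\<lambda>x. A x * B x) - expectation A * expectation B"
    using int by (simp add: prob_space)
  finally show ?thesis .
qed

lemma (in prob_space) covar_le:
  assumes "square_integrable M A" "square_integrable M B"
  shows "covar M A B \<le> sqrt (var M A) * sqrt (var M B)"
  using integral_Cauchy_Schwarz[OF square_integrable_diff[OF assms(1) square_integrable_const]
      square_integrable_diff[OF assms(2) square_integrable_const]]
  unfolding covar_def power2_eq_square .

lemma covar_cong_AE:
  assumes "AE \<omega> in M. A \<omega> = A' \<omega>" "AE \<omega> in M. B \<omega> = B' \<omega>"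
    and [measurable]: "A \<in> borel_measurable M" "A' \<in> borel_measurable M"
      "B \<in> borel_measurable M" "B' \<in> borel_measurable M"
  shows "covar M A B = covar M A' B'"
proof -
  have "(\<integral>x. A x \<partial>M) = (\<integral>x. A' x \<partial>M)" "(\<integral>x. B x \<partial>M) = (\<integral>x. B' x \<partial>M)"
    using assms(1,2) by (auto intro!: integral_cong_AE)
  moreover have "(\<integral>x. (A x - a) * (B x - b) \<partial>M) = (\<integral>x. (A' x - a) * (B' x - b) \<partial>M)" for a b
  proof (rule integral_cong_AE)
    show "AE \<omega> in M. (A \<omega> - a) * (B \<omega> - b) = (A' \<omega> - a) * (B' \<omega> - b)"
      using assms(1,2) by eventually_elim simp
  qed measurable
  ultimately show ?thesis by (simp add: covar_def)
qed

lemma (in prob_space) degenerate_covar: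
  assumes "degenerate M A" and [measurable]: "A \<in> borel_measurable M" "B \<in> borel_measurable M"
  shows "covar M A B = 0" "covar M B A = 0"
proof -
  from assms obtain c where "AE \<omega> in M. A \<omega> = c" by (auto simp: degenerate_def)
  then have "covar M A B = covar M (\<lambda>_. c) B"
    by (intro covar_cong_AE) auto
  then show *: "covar M A B = 0" by (simp add: covar_def prob_space)
  show "covar M B A = 0" using * by (simp add: covar_def mult.commute)
qed

lemma (in prob_space) covar_self_pos:
  assumes A: "square_integrable M A" and "\<not> degenerate M A"
  shows "var M A > 0"
proof (rule ccontr)
  assume "\<not> var M A > 0"
  then have "var M A = 0" using covar_self_nonneg[of M A] by linarith
  then have "(\<integral>x. (A x - expectation A)\<^sup>2 \<partial>M) = 0"
    by (simp add: covar_def power2_eq_square)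
  moreover have "integrable M (\<lambda>x. (A x - expectation A)\<^sup>2)"
    using square_integrable_diff[OF A square_integrable_const] by (rule square_integrable_square)
  ultimately have "AE \<omega> in M. (A \<omega> - expectation A)\<^sup>2 = 0"
    by (subst (asm) integral_nonneg_eq_0_iff_AE) auto
  then have "AE \<omega> in M. A \<omega> = expectation A" by simp
  with assms show False unfolding degenerate_def by blast
qed

lemma degenerate_comp:
  assumes "degenerate M U"
  shows "degenerate M (\<lambda>x. \<phi> (U x))"
proof -
  from assms obtain c where "AE \<omega> in M. U \<omega> = c" by (auto simp: degenerate_def)
  then have "AE \<omega> in M. \<phi> (U \<omega>) = \<phi> c" by eventually_elim simp
  then show ?thesis unfolding degenerate_def by blast
qed

lemma admissible_square_integrable:
  assumes "admissible M MU U \<phi>" "U \<in> measurable M MU"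
  shows "square_integrable M (\<lambda>x. \<phi> (U x))"
  using assms measurable_compose[OF assms(2)] by (auto simp: admissible_def square_integrable_def)

lemma (in prob_space) admissibleI:
  assumes "\<phi> \<in> borel_measurable MU" "square_integrable M (\<lambda>x. \<phi> (U x))" "0 < var M (\<lambda>x. \<phi> (U x))"
  shows "admissible M MU U \<phi>"
  using assms degenerate_covar(1)[OF _ square_integrable_measurable square_integrable_measurable, OF _ assms(2,2)]
  by (auto simp: admissible_def square_integrable_def)

context prob_space
begin

text \<open>For degenerate functions both sides are 0. Otherwise the correlation belongs to the set
  under \<open>Sup\<close>, which the Cauchy-Schwarz inequality bounds by 1, so that the real
  supremum is indeed an upper bound.\<close>

lemma covar_le_maximal_correlation:
  assumes U: "U \<in> measurable M MU" and V: "V \<in> measurable M MV"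
    and \<phi>: "\<phi> \<in> borel_measurable MU" "square_integrable M (\<lambda>x. \<phi> (U x))"
    and \<psi>: "\<psi> \<in> borel_measurable MV" "square_integrable M (\<lambda>x. \<psi> (V x))"
  shows "covar M (\<lambda>x. \<phi> (U x)) (\<lambda>x. \<psi> (V x)) \<le> maximal_correlation M MU U MV V
    * sqrt (var M (\<lambda>x. \<phi> (U x))) * sqrt (var M (\<lambda>x. \<psi> (V x)))"
    (is "covar M ?A ?B \<le> ?R * _ * _")
proof (cases "degenerate M ?A \<or> degenerate M ?B")
  case True
  have m: "?A \<in> borel_measurable M" "?B \<in> borel_measurable M"
    using \<phi>(2) \<psi>(2) by (auto simp: square_integrable_def)
  from True show ?thesis using m by (auto simp: degenerate_covar)
next
  case False
  then have adm: "admissible M MU U \<phi>" "admissible M MV V \<psi>"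
    using \<phi> \<psi> by (auto simp: admissible_def square_integrable_def)
  have nd: "\<not> degenerate M U" "\<not> degenerate M V" using False degenerate_comp by blast+
  define P where "P = {pearson M (\<lambda>x. \<phi> (U x)) (\<lambda>x. \<psi> (V x)) | \<phi> \<psi>.
    admissible M MU U \<phi> \<and> admissible M MV V \<psi>}"
  have "pearson M ?A ?B \<le> Sup P"
  proof (rule cSup_upper)
    show "pearson M ?A ?B \<in> P" using adm by (auto simp: P_def)
    show "bdd_above P"
    proof (rule bdd_aboveI[of _ 1])
      fix x assume "x \<in> P"
      then obtain \<phi> \<psi> where x: "x = pearson M (\<lambda>x. \<phi> (U x)) (\<lambda>x. \<psi> (V x))"
        "admissible M MU U \<phi>" "admissible M MV V \<psi>" by (auto simp: P_def)
      note sq = admissible_square_integrable[OF x(2) U] admissible_square_integrable[OF x(3) V]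
      have "var M (\<lambda>x. \<phi> (U x)) > 0" "var M (\<lambda>x. \<psi> (V x)) > 0"
        using x sq by (auto intro!: covar_self_pos simp: admissible_def)
      then show "x \<le> 1" using covar_le[OF sq] by (simp add: x pearson_covar)
    qed
  qed
  then have "covar M ?A ?B / (sqrt (var M ?A) * sqrt (var M ?B)) \<le> ?R"
    using nd by (simp add: maximal_correlation_def P_def pearson_covar)
  moreover have "sqrt (var M ?A) * sqrt (var M ?B) > 0"
    using False by (intro mult_pos_pos real_sqrt_gt_zero covar_self_pos \<phi> \<psi>) auto
  ultimately show ?thesis by (simp add: pos_divide_le_eq mult.assoc)
qed

text \<open>The existence of admissible functions is asked for because the supremum of an empty set
  of reals has no meaningful value.\<close>

lemma maximal_correlation_le:
  assumes U: "U \<in> measurable M MU" and V: "V \<in> measurable M MV" and r: "0 \<le> r"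
    and exU: "\<not> degenerate M U \<Longrightarrow> \<exists>\<phi>. admissible M MU U \<phi>"
    and exV: "\<not> degenerate M V \<Longrightarrow> \<exists>\<psi>. admissible M MV V \<psi>"
    and le: "\<And>\<phi> \<psi>. \<phi> \<in> borel_measurable MU \<Longrightarrow> square_integrable M (\<lambda>x. \<phi> (U x)) \<Longrightarrow>
       \<psi> \<in> borel_measurable MV \<Longrightarrow> square_integrable M (\<lambda>x. \<psi> (V x)) \<Longrightarrow>
       covar M (\<lambda>x. \<phi> (U x)) (\<lambda>x. \<psi> (V x)) \<le> r
       * sqrt (var M (\<lambda>x. \<phi> (U x))) * sqrt (var M (\<lambda>x. \<psi> (V x)))"
  shows "maximal_correlation M MU U MV V \<le> r"
proof (cases "degenerate M U \<or> degenerate M V")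
  case True
  then show ?thesis using r by (auto simp: maximal_correlation_def)
next
  case False
  have "Sup {pearson M (\<lambda>x. \<phi> (U x)) (\<lambda>x. \<psi> (V x)) | \<phi> \<psi>.
    admissible M MU U \<phi> \<and> admissible M MV V \<psi>} \<le> r"
  proof (rule cSup_least)
    show "{pearson M (\<lambda>x. \<phi> (U x)) (\<lambda>x. \<psi> (V x)) | \<phi> \<psi>.
      admissible M MU U \<phi> \<and> admissible M MV V \<psi>} \<noteq> {}"
      using exU exV False by auto
    fix x assume "x \<in> {pearson M (\<lambda>x. \<phi> (U x)) (\<lambda>x. \<psi> (V x)) | \<phi> \<psi>.
      admissible M MU U \<phi> \<and> admissible M MV V \<psi>}"
    then obtain \<phi> \<psi> where x: "x = pearson M (\<lambda>x. \<phi> (U x)) (\<lambda>x. \<psi> (V x))"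
      "admissible M MU U \<phi>" "admissible M MV V \<psi>" by auto
    note sq = admissible_square_integrable[OF x(2) U] admissible_square_integrable[OF x(3) V]
    have "var M (\<lambda>x. \<phi> (U x)) > 0" "var M (\<lambda>x. \<psi> (V x)) > 0"
      using x sq by (auto intro!: covar_self_pos simp: admissible_def)
    moreover have "covar M (\<lambda>x. \<phi> (U x)) (\<lambda>x. \<psi> (V x)) \<le> r
       * sqrt (var M (\<lambda>x. \<phi> (U x))) * sqrt (var M (\<lambda>x. \<psi> (V x)))"
      using x sq by (intro le) (auto simp: admissible_def)
    ultimately show "x \<le> r" by (simp add: x pearson_covar pos_divide_le_eq mult.assoc)
  qed
  with False show ?thesis by (simp add: maximal_correlation_def)
qed

text \<open>The indicator of a value \<open>a\<close> of positive probability works: were it almost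
  surely constant, then \<open>U\<close> would either equal \<open>a\<close> almost surely and be
  degenerate, or avoid \<open>a\<close> almost surely.\<close>

lemma finite_range_admissible:
  assumes U: "U \<in> measurable M (count_space A)" and A: "finite A" and nd: "\<not> degenerate M U"
  shows "\<exists>\<phi>. admissible M (count_space A) U \<phi>"
proof -
  have "\<exists>a\<in>A. \<not> (AE \<omega> in M. U \<omega> \<noteq> a)"
  proof (rule ccontr)
    assume "\<not> ?thesis"
    then have "AE \<omega> in M. \<forall>a\<in>A. U \<omega> \<noteq> a"
      using A by (intro AE_finite_allI) auto
    then have "AE \<omega> in M. False"
      using AE_space by eventually_elim (use measurable_space[OF U] in auto)
    then show False by simp
  qed
  then obtain a where a: "a \<in> A" "\<not> (AE \<omega> in M. U \<omega> \<noteq> a)" by blast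
  define \<phi> :: "_ \<Rightarrow> real" where "\<phi> = indicator {a}"
  have m: "(\<lambda>x. \<phi> (U x)) \<in> borel_measurable M"
    by (rule measurable_compose[OF U]) simp
  have "\<not> degenerate M (\<lambda>x. \<phi> (U x))"
  proof
    assume "degenerate M (\<lambda>x. \<phi> (U x))"
    then obtain c where c: "AE \<omega> in M. \<phi> (U \<omega>) = c" by (auto simp: degenerate_def)
    show False
    proof (cases "c = 1")
      case True
      with c have "AE \<omega> in M. U \<omega> = a"
        by (auto elim!: eventually_mono simp: \<phi>_def indicator_def split: if_splits)
      with nd show False by (auto simp: degenerate_def)
    next
      case False
      with c have "AE \<omega> in M. U \<omega> \<noteq> a"
        by (auto elim!: eventually_mono simp: \<phi>_def)
      with a show False by simp
    qed
  qed
  moreover have "square_integrable M (\<lambda>x. \<phi> (U x))"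
    using m by (rule square_integrable_bounded[of _ 1]) (simp add: \<phi>_def indicator_def)
  ultimately have "admissible M (count_space A) U \<phi>"
    by (simp add: admissible_def square_integrable_def)
  then show ?thesis by blast
qed

end

subsection \<open>Nested random sets\<close>

lemma Some_measurable: "Some \<in> measurable borel option_borel"
  unfolding option_borel_def
proof (rule measurable_measure_of)
  show "insert {None} {Some ` B | B. B \<in> sets borel} \<subseteq> Pow UNIV" by simp
  fix A :: "real option set" assume "A \<in> insert {None} {Some ` B | B. B \<in> sets borel}"
  then consider "A = {None}" | B where "A = Some ` B" "B \<in> sets borel" by blast
  then have "Some -` A \<in> sets borel"
  proof cases
    case 1
    then have "Some -` A = {}" by auto
    then show ?thesis by simp
  next
    case (2 B)
    then have "Some -` A = B" by auto
    then show ?thesis using 2 by simp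
  qed
  then show "Some -` A \<inter> space borel \<in> sets borel" by simp
qed simp

lemma sets_option_borel:
  "{None} \<in> sets option_borel" "B \<in> sets borel \<Longrightarrow> Some ` B \<in> sets option_borel"
  unfolding option_borel_def by auto

lemma space_option_borel [simp]: "space option_borel = UNIV"
  by (simp add: option_borel_def)

lemma case_option_measurable:
  fixes h :: "real \<Rightarrow> real"
  assumes h: "h \<in> borel_measurable borel"
  shows "case_option 0 h \<in> borel_measurable option_borel"
proof (rule measurableI)
  fix B :: "real set" assume B: "B \<in> sets borel"
  have "v \<in> case_option 0 h -` B \<longleftrightarrow> v \<in> (if 0 \<in> B then {None} else {}) \<union> Some ` (h -` B)" for v
    by (cases v) auto
  then have "case_option 0 h -` B = (if 0 \<in> B then {None} else {}) \<union> Some ` (h -` B)"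
    by blast
  moreover have "h -` B \<in> sets borel" using measurable_sets[OF h B] by simp
  ultimately show "case_option 0 h -` B \<inter> space option_borel \<in> sets option_borel"
    using sets.Un[OF sets_option_borel(1) sets_option_borel(2)] sets_option_borel(2) by auto
qed simp

lemma not_None_measurable: "(\<lambda>v. v \<noteq> None) \<in> measurable option_borel (count_space UNIV)"
proof -
  have "{v. v \<noteq> None} = UNIV - {None :: real option}" by auto
  then have "{v \<in> space option_borel. v \<noteq> None} \<in> sets option_borel"
    using sets_option_borel(1) sets.compl_sets[of "{None}" option_borel] by simp
  then show ?thesis by (simp add: pred_def)
qed

section \<open>Masked vectors and the law of the variables given the random sets\<close>

text \<open>The set and the vector are separate deterministic arguments, so that on the event
  \<open>S = s\<close> the masked vector is the image of the variables under the fixed measurable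
  map \<open>mask n s\<close>.\<close>

definition mask :: "nat \<Rightarrow> nat set \<Rightarrow> (nat \<Rightarrow> real) \<Rightarrow> nat \<Rightarrow> real option" where
  "mask n s x = (\<lambda>i\<in>{1..n}. if i \<in> s then Some (x i) else None)"

text \<open>The set is encoded in a masked vector by the places without \<open>None\<close>; hence
  every function of \<open>S\<close> is a function of \<open>S\<close> together with the visible
  values.\<close>

definition unmasked :: "nat \<Rightarrow> (nat \<Rightarrow> real option) \<Rightarrow> nat set" where
  "unmasked n v = {i \<in> {1..n}. v i \<noteq> None}"

lemma mask_measurable: "mask n s \<in> measurable (Pi\<^sub>M {1..n} (\<lambda>_. borel)) (masked_space n)"
  unfolding mask_def
proof (rule measurable_restrict)
  fix i assume i: "i \<in> {1..n}"
  show "(\<lambda>x. if i \<in> s then Some (x i) else None) \<in> measurable (Pi\<^sub>M {1..n} (\<lambda>_. borel)) option_borel"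
  proof (cases "i \<in> s")
    case True
    then show ?thesis
      using measurable_compose[OF measurable_component_singleton[OF i] Some_measurable] by simp
  qed simp
qed

lemma unmasked_measurable: "unmasked n \<in> measurable (masked_space n) (count_space (Pow {1..n}))"
proof (subst measurable_count_space_eq2)
  have "Measurable.pred (masked_space n) (\<lambda>v. \<forall>i\<in>{1..n}. (v i \<noteq> None) = (i \<in> a))" for a
  proof (rule pred_intros_finite)
    fix i assume i: "i \<in> {1..n}"
    have "Measurable.pred (masked_space n) (\<lambda>v. v i \<noteq> None)"
      by (rule measurable_compose[OF measurable_component_singleton[OF i] not_None_measurable])
    then show "Measurable.pred (masked_space n) (\<lambda>v. (v i \<noteq> None) = (i \<in> a))"
      by measurable
  qed simp
  moreover have "unmasked n -` {a} \<inter> space (masked_space n)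
      = {v \<in> space (masked_space n). \<forall>i\<in>{1..n}. (v i \<noteq> None) = (i \<in> a)}" if "a \<in> Pow {1..n}" for a
  proof -
    have "unmasked n v = a \<longleftrightarrow> (\<forall>i\<in>{1..n}. (v i \<noteq> None) = (i \<in> a))" for v
      using that unfolding unmasked_def by blast
    then show ?thesis by blast
  qed
  moreover have "unmasked n v \<in> Pow {1..n}" for v by (auto simp: unmasked_def)
  ultimately show "unmasked n \<in> space (masked_space n) \<rightarrow> Pow {1..n} \<and>
      (\<forall>a\<in>Pow {1..n}. unmasked n -` {a} \<inter> space (masked_space n) \<in> sets (masked_space n))"
    by (simp add: pred_def)
qed simp

locale nested_random_sets = prob_space M for M :: "'a measure" +
  fixes n :: nat and X :: "nat \<Rightarrow> 'a \<Rightarrow> real" and S T :: "'a \<Rightarrow> nat set"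
  assumes continuous: "\<And>i. i \<in> {1..n} \<Longrightarrow> continuous_rv M (X i)"
    and indep_X: "indep_vars (\<lambda>_. borel) X {1..n}"
    and nested: "\<And>\<omega>. \<omega> \<in> space M \<Longrightarrow> S \<omega> \<noteq> {} \<and> S \<omega> \<subseteq> T \<omega> \<and> T \<omega> \<subseteq> {1..n}"
    and indep_ST: "indep_elements M
           (count_space (Pow {1..n} \<times> Pow {1..n})) (\<lambda>\<omega>. (S \<omega>, T \<omega>))
           (Pi\<^sub>M {1..n} (\<lambda>_. borel)) (\<lambda>\<omega>. \<lambda>i\<in>{1..n}. X i \<omega>)"
begin

text \<open>Otherwise \<open>{1..n}\<close> would be rewritten to \<open>{Suc 0..n}\<close>.\<close>

declare One_nat_def [simp del]

abbreviation I :: "nat set" where "I \<equiv> {1..n}"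

abbreviation J :: "nat set set" where "J \<equiv> Pow I"

abbreviation PB :: "(nat \<Rightarrow> real) measure" where "PB \<equiv> Pi\<^sub>M I (\<lambda>_. borel)"

definition V :: "'a \<Rightarrow> nat \<Rightarrow> real" where "V \<omega> = (\<lambda>i\<in>I. X i \<omega>)"

definition p :: "nat set \<Rightarrow> nat set \<Rightarrow> real" where "p s t = \<P>(\<omega> in M. S \<omega> = s \<and> T \<omega> = t)"

definition pS :: "nat set \<Rightarrow> real" where "pS s = \<P>(\<omega> in M. S \<omega> = s)"

definition pT :: "nat set \<Rightarrow> real" where "pT t = \<P>(\<omega> in M. T \<omega> = t)"

text \<open>Outside \<open>I\<close> a point mass is put, since the product locale demands a
  probability measure at every index.\<close>

definition \<mu> :: "nat \<Rightarrow> real measure" where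
  "\<mu> i = (if i \<in> I then distr M borel (X i) else return borel 0)"

abbreviation N :: "(nat \<Rightarrow> real) measure" where "N \<equiv> Pi\<^sub>M I \<mu>"

lemma X_measurable: "i \<in> I \<Longrightarrow> X i \<in> borel_measurable M"
  using indep_X by (auto simp: indep_vars_def)

lemma prob_space_\<mu>: "prob_space (\<mu> i)"
  by (auto simp: \<mu>_def X_measurable intro!: prob_space_distr prob_space_return)

sublocale N: finite_product_prob_space \<mu> I
proof -
  interpret product_prob_space \<mu> I
    by (intro product_prob_space.intro product_sigma_finite.intro product_prob_space_axioms.intro
        prob_space_imp_sigma_finite prob_space_\<mu>)
  show "finite_product_prob_space \<mu> I"
    by unfold_locales simp
qed

lemma I_nonempty: "I \<noteq> {}"
  using nested not_empty by blast

lemma sets_N: "sets N = sets (Pi\<^sub>M I (\<lambda>_. borel :: real measure))"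
  by (intro sets_PiM_cong) (auto simp: \<mu>_def)

lemma V_measurable: "V \<in> measurable M PB"
  unfolding V_def by (intro measurable_restrict X_measurable)

lemma distr_V: "distr M PB V = N"
proof -
  have "distr M PB V = Pi\<^sub>M I (\<lambda>i. distr M borel (X i))"
    unfolding V_def using indep_X indep_vars_iff_distr_eq_PiM'[OF I_nonempty, of X "\<lambda>_. borel"] X_measurable
    by simp
  also have "\<dots> = N" by (intro PiM_cong) (auto simp: \<mu>_def)
  finally show ?thesis .
qed

lemma
  fixes F :: "(nat \<Rightarrow> real) \<Rightarrow> real"
  assumes F: "F \<in> borel_measurable PB"
  shows integrable_N: "integrable N F \<longleftrightarrow> integrable M (\<lambda>\<omega>. F (V \<omega>))"
    and integral_N: "(\<integral>x. F x \<partial>N) = (\<integral>\<omega>. F (V \<omega>) \<partial>M)"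
  using integrable_distr_eq[OF V_measurable F] integral_distr[OF V_measurable F]
  unfolding distr_V by auto

lemma measurable_N_eq: "measurable N K = measurable PB K"
  by (rule measurable_cong_sets[OF sets_N refl])

lemma ST_measurable: "(\<lambda>\<omega>. (S \<omega>, T \<omega>)) \<in> measurable M (count_space (J \<times> J))"
  using indep_ST by (simp add: indep_elements_def)

lemma S_measurable: "S \<in> measurable M (count_space J)"
  and T_measurable: "T \<in> measurable M (count_space J)"
proof -
  have "fst \<in> measurable (count_space (J \<times> J)) (count_space J)"
    "snd \<in> measurable (count_space (J \<times> J)) (count_space J)" by auto
  from measurable_compose[OF ST_measurable this(1)] measurable_compose[OF ST_measurable this(2)]
  show "S \<in> measurable M (count_space J)" "T \<in> measurable M (count_space J)" by simp_all
qed

definition E :: "nat set \<Rightarrow> nat set \<Rightarrow> 'a set" where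
  "E s t = {\<omega> \<in> space M. S \<omega> = s \<and> T \<omega> = t}"

lemma E_vimage: "E s t = (\<lambda>\<omega>. (S \<omega>, T \<omega>)) -` ({(s, t)} \<inter> J \<times> J) \<inter> space M"
  using nested by (fastforce simp: E_def)

lemma E_sets: "E s t \<in> sets M"
  unfolding E_vimage by (rule measurable_sets[OF ST_measurable]) simp

lemma p_eq: "p s t = prob (E s t)"
  by (simp add: p_def E_def)

lemma prob_E_Int:
  assumes A: "A \<in> sets PB"
  shows "prob (E s t \<inter> (V -` A \<inter> space M)) = p s t * prob (V -` A \<inter> space M)"
proof -
  have "indep_set {(\<lambda>\<omega>. (S \<omega>, T \<omega>)) -` A \<inter> space M | A. A \<in> sets (count_space (J \<times> J))}
     {V -` B \<inter> space M | B. B \<in> sets PB}"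
    using indep_ST by (simp add: indep_elements_def V_def[abs_def])
  then show ?thesis
    unfolding p_eq
    by (rule indep_setD) (use A in \<open>auto simp: E_vimage intro!: exI[of _ "{(s, t)} \<inter> J \<times> J"]\<close>)
qed

text \<open>By independence, restriction to an event on \<open>S\<close> and \<open>T\<close> only
  scales the law of \<open>V\<close>. As an equality of measures this transfers integrability and
  integrals alike.\<close>

lemma distr_density_E:
  fixes s t :: "nat set"
  defines "ME \<equiv> density M (\<lambda>\<omega>. ennreal (indicator (E s t) \<omega>))"
  shows "distr ME PB V = density N (\<lambda>_. ennreal (p s t))"
proof (rule measure_eqI)
  show "sets (distr ME PB V)
      = sets (density N (\<lambda>_. ennreal (p s t)))"
    by (simp add: sets_N)
  fix A assume "A \<in> sets (distr ME PB V)"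
  then have A: "A \<in> sets PB" by simp
  have VA: "V -` A \<inter> space M \<in> sets M" by (rule measurable_sets[OF V_measurable A])
  have "emeasure (distr ME PB V) A
      = emeasure ME (V -` A \<inter> space M)"
    using V_measurable A by (subst emeasure_distr) (auto simp: ME_def)
  also have "\<dots> = (\<integral>\<^sup>+\<omega>. ennreal (indicator (E s t) \<omega>) * indicator (V -` A \<inter> space M) \<omega> \<partial>M)"
    unfolding ME_def using VA E_sets by (intro emeasure_density) auto
  also have "\<dots> = (\<integral>\<^sup>+\<omega>. indicator (E s t \<inter> (V -` A \<inter> space M)) \<omega> \<partial>M)"
    by (intro nn_integral_cong) (simp add: indicator_def)
  also have "\<dots> = ennreal (prob (E s t \<inter> (V -` A \<inter> space M)))"
    using VA E_sets by (simp add: emeasure_eq_measure sets.Int)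
  also have "\<dots> = ennreal (p s t) * emeasure (distr M PB V) A"
    using VA A V_measurable
    by (simp add: prob_E_Int emeasure_distr emeasure_eq_measure ennreal_mult p_def)
  also have "\<dots> = emeasure (density N (\<lambda>_. ennreal (p s t))) A"
    using A by (subst emeasure_density_const) (simp_all add: distr_V sets_N)
  finally show "emeasure (distr ME PB V) A
      = emeasure (density N (\<lambda>_. ennreal (p s t))) A" .
qed

lemma p_nonneg: "p s t \<ge> 0" and pS_nonneg: "pS s \<ge> 0" and pT_nonneg: "pT t \<ge> 0"
  by (simp_all add: p_def pS_def pT_def)

lemma
  fixes F :: "(nat \<Rightarrow> real) \<Rightarrow> real"
  assumes F: "F \<in> borel_measurable PB"
  shows integrable_on_E: "integrable M (\<lambda>\<omega>. indicator (E s t) \<omega> * F (V \<omega>)) \<longleftrightarrow> p s t = 0 \<or> integrable N F"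
    and integral_on_E: "(\<integral>\<omega>. indicator (E s t) \<omega> * F (V \<omega>) \<partial>M) = p s t * (\<integral>x. F x \<partial>N)"
proof -
  have V: "V \<in> measurable (density M (\<lambda>\<omega>. ennreal (indicator (E s t) \<omega>))) PB"
    using V_measurable by simp
  have FV: "(\<lambda>\<omega>. F (V \<omega>)) \<in> borel_measurable M" by (rule measurable_compose[OF V_measurable F])
  have FN: "F \<in> borel_measurable N" using F by (simp add: measurable_N_eq)
  have ind: "(indicator (E s t) :: _ \<Rightarrow> real) \<in> borel_measurable M" using E_sets by simp
  show "integrable M (\<lambda>\<omega>. indicator (E s t) \<omega> * F (V \<omega>)) \<longleftrightarrow> p s t = 0 \<or> integrable N F"
    using integrable_distr_eq[OF V F] integrable_density[OF FV ind] integrable_density[OF FN, of "\<lambda>_. p s t"]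
      p_nonneg[of s t]
    by (simp add: distr_density_E)
  show "(\<integral>\<omega>. indicator (E s t) \<omega> * F (V \<omega>) \<partial>M) = p s t * (\<integral>x. F x \<partial>N)"
    using integral_distr[OF V F] integral_density[OF FV ind] integral_density[OF FN, of "\<lambda>_. p s t"]
      p_nonneg[of s t]
    by (simp add: distr_density_E)
qed

lemma
  fixes F :: "nat set \<Rightarrow> nat set \<Rightarrow> (nat \<Rightarrow> real) \<Rightarrow> real"
  assumes F: "\<And>s t. s \<in> J \<Longrightarrow> t \<in> J \<Longrightarrow> F s t \<in> borel_measurable PB"
    and int: "\<And>s t. s \<in> J \<Longrightarrow> t \<in> J \<Longrightarrow> p s t \<noteq> 0 \<Longrightarrow> integrable N (F s t)"
  shows integrable_randomized: "integrable M (\<lambda>\<omega>. F (S \<omega>) (T \<omega>) (V \<omega>))"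
    and expectation_randomized:
      "expectation (\<lambda>x. F (S x) (T x) (V x)) = (\<Sum>s\<in>J. \<Sum>t\<in>J. p s t * (\<integral>x. F s t x \<partial>N))"
proof -
  \<comment> \<open>The events \<open>E s t\<close> partition the space, so exactly one summand
    survives at each point.\<close>
  have eq: "F (S \<omega>) (T \<omega>) (V \<omega>) = (\<Sum>s\<in>J. \<Sum>t\<in>J. indicator (E s t) \<omega> * F s t (V \<omega>))"
    if "\<omega> \<in> space M" for \<omega>
  proof -
    have ST: "S \<omega> \<in> J" "T \<omega> \<in> J" using nested[OF that] by auto
    have ind: "indicator (E s t) \<omega> = (if s = S \<omega> then if t = T \<omega> then 1 else 0 else (0 :: real))" for s t
      using that by (auto simp: E_def indicator_def)
    have inner: "(\<Sum>t\<in>J. indicator (E s t) \<omega> * F s t (V \<omega>)) = (if s = S \<omega> then F s (T \<omega>) (V \<omega>) else 0)" for s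
      unfolding ind using ST(2) by (cases "s = S \<omega>") (simp_all add: if_distrib[of "\<lambda>x. x * _"] cong: if_cong)
    show ?thesis
      unfolding inner using ST(1) by simp
  qed
  have intE: "integrable M (\<lambda>\<omega>. indicator (E s t) \<omega> * F s t (V \<omega>))" if "s \<in> J" "t \<in> J" for s t
    using integrable_on_E[OF F[OF that]] int[OF that] by blast
  have "integrable M (\<lambda>\<omega>. \<Sum>s\<in>J. \<Sum>t\<in>J. indicator (E s t) \<omega> * F s t (V \<omega>))"
    using intE by (intro Bochner_Integration.integrable_sum) auto
  then show "integrable M (\<lambda>\<omega>. F (S \<omega>) (T \<omega>) (V \<omega>))"
    by (subst Bochner_Integration.integrable_cong[OF refl eq])
  have "expectation (\<lambda>x. F (S x) (T x) (V x))
      = expectation (\<lambda>x. \<Sum>s\<in>J. \<Sum>t\<in>J. indicator (E s t) x * F s t (V x))"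
    by (rule Bochner_Integration.integral_cong[OF refl eq])
  also have "\<dots> = (\<Sum>s\<in>J. expectation (\<lambda>x. \<Sum>t\<in>J. indicator (E s t) x * F s t (V x)))"
    by (intro Bochner_Integration.integral_sum Bochner_Integration.integrable_sum intE)
  also have "\<dots> = (\<Sum>s\<in>J. \<Sum>t\<in>J. expectation (\<lambda>x. indicator (E s t) x * F s t (V x)))"
    by (intro sum.cong refl Bochner_Integration.integral_sum intE)
  also have "\<dots> = (\<Sum>s\<in>J. \<Sum>t\<in>J. p s t * (\<integral>x. F s t x \<partial>N))"
    using F by (intro sum.cong refl integral_on_E) auto
  finally show "expectation (\<lambda>x. F (S x) (T x) (V x)) = (\<Sum>s\<in>J. \<Sum>t\<in>J. p s t * (\<integral>x. F s t x \<partial>N))" .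
qed

lemma S_event: "{\<omega> \<in> space M. S \<omega> = s} \<in> sets M" and T_event: "{\<omega> \<in> space M. T \<omega> = t} \<in> sets M"
proof -
  have "{\<omega> \<in> space M. S \<omega> = s} = S -` ({s} \<inter> J) \<inter> space M"
    "{\<omega> \<in> space M. T \<omega> = t} = T -` ({t} \<inter> J) \<inter> space M"
    using nested by fastforce+
  then show "{\<omega> \<in> space M. S \<omega> = s} \<in> sets M" "{\<omega> \<in> space M. T \<omega> = t} \<in> sets M"
    using measurable_sets[OF S_measurable, of "{s} \<inter> J"] measurable_sets[OF T_measurable, of "{t} \<inter> J"]
    by simp_all
qed

lemma pS_eq_sum:
  assumes "s \<in> J"
  shows "pS s = (\<Sum>t\<in>J. p s t)"
proof -
  have "pS s = expectation (indicator {\<omega> \<in> space M. S \<omega> = s})"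
    using S_event by (simp add: pS_def)
  also have "\<dots> = expectation (\<lambda>\<omega>. (\<lambda>s' t x. if s' = s then 1 else 0) (S \<omega>) (T \<omega>) (V \<omega>))"
    by (intro Bochner_Integration.integral_cong) (auto simp: indicator_def)
  also have "\<dots> = (\<Sum>s'\<in>J. \<Sum>t\<in>J. p s' t * (\<integral>x. (if s' = s then 1 else 0) \<partial>N))"
    by (rule expectation_randomized) auto
  also have "\<dots> = (\<Sum>s'\<in>J. if s' = s then (\<Sum>t\<in>J. p s' t) else 0)"
    by (intro sum.cong) (auto simp: N.P.prob_space)
  also have "\<dots> = (\<Sum>t\<in>J. p s t)" using assms by simp
  finally show ?thesis .
qed

lemma pT_eq_sum:
  assumes "t \<in> J"
  shows "pT t = (\<Sum>s\<in>J. p s t)"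
proof -
  have "pT t = expectation (indicator {\<omega> \<in> space M. T \<omega> = t})"
    using T_event by (simp add: pT_def)
  also have "\<dots> = expectation (\<lambda>\<omega>. (\<lambda>s t' x. if t' = t then 1 else 0) (S \<omega>) (T \<omega>) (V \<omega>))"
    by (intro Bochner_Integration.integral_cong) (auto simp: indicator_def)
  also have "\<dots> = (\<Sum>s\<in>J. \<Sum>t'\<in>J. p s t' * (\<integral>x. (if t' = t then 1 else 0) \<partial>N))"
    by (rule expectation_randomized) auto
  also have "\<dots> = (\<Sum>s\<in>J. \<Sum>t'\<in>J. if t' = t then p s t' else 0)"
    by (intro sum.cong refl) (auto simp: N.P.prob_space)
  also have "\<dots> = (\<Sum>s\<in>J. p s t)" using assms by simp
  finally show ?thesis .
qed

lemma p_le: "p s t \<le> pS s" "p s t \<le> pT t"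
  unfolding p_def pS_def pT_def using S_event T_event by (auto intro!: finite_measure_mono)

lemma p_eq_0: "pS s = 0 \<Longrightarrow> p s t = 0" "pT t = 0 \<Longrightarrow> p s t = 0"
  using p_le[of s t] p_nonneg[of s t] by auto

text \<open>An event of nonzero probability contains a point, and the nesting holds at that
  point.\<close>

lemma p_nonzeroD:
  assumes "p s t \<noteq> 0"
  shows "s \<noteq> {}" "s \<subseteq> t" "t \<subseteq> I"
proof -
  have "E s t \<noteq> {}" using assms by (auto simp: p_eq)
  then show "s \<noteq> {}" "s \<subseteq> t" "t \<subseteq> I" using nested by (auto simp: E_def)
qed

lemma
  fixes F :: "nat set \<Rightarrow> (nat \<Rightarrow> real) \<Rightarrow> real"
  assumes F: "\<And>s. s \<in> J \<Longrightarrow> F s \<in> borel_measurable PB"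
    and int: "\<And>s. s \<in> J \<Longrightarrow> integrable N (F s)"
  shows expectation_randomized_S: "expectation (\<lambda>x. F (S x) (V x)) = (\<Sum>s\<in>J. pS s * (\<integral>x. F s x \<partial>N))"
    and expectation_randomized_T: "expectation (\<lambda>x. F (T x) (V x)) = (\<Sum>t\<in>J. pT t * (\<integral>x. F t x \<partial>N))"
proof -
  have "expectation (\<lambda>x. F (S x) (V x)) = (\<Sum>s\<in>J. \<Sum>t\<in>J. p s t * (\<integral>x. F s x \<partial>N))"
    using expectation_randomized[of "\<lambda>s t. F s"] F int by simp
  then show "expectation (\<lambda>x. F (S x) (V x)) = (\<Sum>s\<in>J. pS s * (\<integral>x. F s x \<partial>N))"
    by (simp add: pS_eq_sum sum_distrib_right)
  have "expectation (\<lambda>x. F (T x) (V x)) = (\<Sum>s\<in>J. \<Sum>t\<in>J. p s t * (\<integral>x. F t x \<partial>N))"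
    using expectation_randomized[of "\<lambda>s t. F t"] F int by simp
  also have "\<dots> = (\<Sum>t\<in>J. \<Sum>s\<in>J. p s t * (\<integral>x. F t x \<partial>N))" by (rule sum.swap)
  finally show "expectation (\<lambda>x. F (T x) (V x)) = (\<Sum>t\<in>J. pT t * (\<integral>x. F t x \<partial>N))"
    by (simp add: pT_eq_sum sum_distrib_right)
qed

lemma masked_S: "\<omega> \<in> space M \<Longrightarrow> masked n S X \<omega> = mask n (S \<omega>) (V \<omega>)"
  and masked_T: "\<omega> \<in> space M \<Longrightarrow> masked n T X \<omega> = mask n (T \<omega>) (V \<omega>)"
  by (auto simp: masked_def mask_def V_def)

lemma masked_measurable:
  assumes U: "U \<in> measurable M (count_space J)"
  shows "masked n U X \<in> measurable M (masked_space n)"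
  unfolding masked_def
proof (rule measurable_restrict)
  fix i assume i: "i \<in> {1..n}"
  have "Measurable.pred M (\<lambda>\<omega>. i \<in> U \<omega>)"
    by (rule measurable_compose[OF U]) simp
  then show "(\<lambda>\<omega>. if i \<in> U \<omega> then Some (X i \<omega>) else None) \<in> measurable M option_borel"
    using measurable_compose[OF X_measurable[OF i] Some_measurable] by (intro measurable_If) auto
qed

lemma unmasked_mask: "s \<subseteq> I \<Longrightarrow> unmasked n (mask n s x) = s"
  by (auto simp: unmasked_def mask_def)

end

lemma continuous_rv_AE_neq:
  assumes "continuous_rv M Z"
  shows "AE \<omega> in M. Z \<omega> \<noteq> c"
proof -
  obtain f where f: "distributed M lborel Z f" using assms by (auto simp: continuous_rv_def)
  then have d: "distr M lborel Z = density lborel f" "f \<in> borel_measurable lborel" "Z \<in> measurable M lborel"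
    by (auto simp: distributed_def)
  have "AE z in lborel. z \<noteq> c" by (rule AE_lborel_singleton)
  then have "AE z in density lborel f. z \<noteq> c"
    by (subst AE_density[OF d(2)]) (auto elim: eventually_mono)
  then have "AE z in distr M lborel Z. z \<noteq> c" by (simp only: d(1))
  then show ?thesis by (rule AE_distrD[OF d(3)])
qed

lemma covar_cong:
  assumes "\<And>\<omega>. \<omega> \<in> space M \<Longrightarrow> A \<omega> = A' \<omega>" "\<And>\<omega>. \<omega> \<in> space M \<Longrightarrow> B \<omega> = B' \<omega>"
  shows "covar M A B = covar M A' B'"
proof -
  have "(\<integral>\<omega>. A \<omega> \<partial>M) = (\<integral>\<omega>. A' \<omega> \<partial>M)" "(\<integral>\<omega>. B \<omega> \<partial>M) = (\<integral>\<omega>. B' \<omega> \<partial>M)"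
    using assms by (auto intro!: Bochner_Integration.integral_cong)
  then show ?thesis
    unfolding covar_def using assms by (auto intro!: Bochner_Integration.integral_cong)
qed

lemma square_integrable_cong:
  assumes "\<And>\<omega>. \<omega> \<in> space M \<Longrightarrow> A \<omega> = A' \<omega>"
  shows "square_integrable M A \<longleftrightarrow> square_integrable M A'"
  unfolding square_integrable_def using assms
  by (simp cong: measurable_cong Bochner_Integration.integrable_cong)

text \<open>\<open>arctan\<close> is bounded and injective: \<open>arctan Z\<close> has all moments
  whatever the law of \<open>Z\<close>, and it is not almost surely constant because a continuous
  \<open>Z\<close> has no atoms. Centring and scaling give \<open>h\<close>.\<close>

lemma (in prob_space) standardizing_function:
  assumes Z: "continuous_rv M Z"
  obtains h :: "real \<Rightarrow> real" and B where "h \<in> borel_measurable borel" "\<And>x. \<bar>h x\<bar> \<le> B"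
    "expectation (\<lambda>x. h (Z x)) = 0" "expectation (\<lambda>x. (h (Z x))\<^sup>2) = 1"
proof -
  have Zm [measurable]: "Z \<in> borel_measurable M"
    using Z by (auto simp: continuous_rv_def distributed_def)
  define A where "A \<omega> = arctan (Z \<omega>)" for \<omega>
  define m where "m = expectation A"
  define v where "v = var M A"
  have bound: "\<bar>arctan x\<bar> \<le> pi / 2" for x
    using arctan_bounded[of x] by auto
  have Am: "A \<in> borel_measurable M" unfolding A_def by measurable
  have A: "square_integrable M A"
    using Am by (rule square_integrable_bounded[of _ "pi / 2"]) (unfold A_def, rule bound)
  have "\<not> degenerate M A"
  proof
    assume "degenerate M A"
    then obtain c where "AE \<omega> in M. A \<omega> = c" by (auto simp: degenerate_def)
    with continuous_rv_AE_neq[OF Z, of "tan c"] have "AE \<omega> in M. False"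
      by eventually_elim (auto simp: A_def tan_arctan)
    then show False by simp
  qed
  then have v: "v > 0" unfolding v_def by (rule covar_self_pos[OF A])
  define h where "h x = (arctan x - m) / sqrt v" for x
  show ?thesis
  proof
    show "h \<in> borel_measurable borel" unfolding h_def by measurable
    show "\<bar>h x\<bar> \<le> (pi / 2 + \<bar>m\<bar>) / sqrt v" for x
      using bound[of x] v by (auto simp: h_def abs_divide intro!: divide_right_mono)
    have "expectation (\<lambda>x. h (Z x)) = expectation (\<lambda>x. A x - m) / sqrt v"
      by (simp add: h_def A_def)
    also have "expectation (\<lambda>x. A x - m) = 0"
      using square_integrable_integrable[OF A] by (simp add: m_def prob_space)
    finally show "expectation (\<lambda>x. h (Z x)) = 0" by simp
    have "expectation (\<lambda>x. (h (Z x))\<^sup>2) = expectation (\<lambda>x. (A x - m)\<^sup>2) / v"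
      using v by (simp add: h_def A_def power_divide)
    also have "expectation (\<lambda>x. (A x - m)\<^sup>2) = v"
      by (simp add: v_def covar_def m_def power2_eq_square)
    finally show "expectation (\<lambda>x. (h (Z x))\<^sup>2) = 1" using v by simp
  qed
qed

context nested_random_sets
begin

abbreviation onS :: "(nat set \<Rightarrow> (nat \<Rightarrow> real) \<Rightarrow> real) \<Rightarrow> 'a \<Rightarrow> real" where
  "onS f \<equiv> \<lambda>\<omega>. f (S \<omega>) (V \<omega>)"

abbreviation onT :: "(nat set \<Rightarrow> (nat \<Rightarrow> real) \<Rightarrow> real) \<Rightarrow> 'a \<Rightarrow> real" where
  "onT f \<equiv> \<lambda>\<omega>. f (T \<omega>) (V \<omega>)"

lemma
  fixes f :: "nat set \<Rightarrow> (nat \<Rightarrow> real) \<Rightarrow> real"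
  assumes f: "\<And>s. s \<in> J \<Longrightarrow> square_integrable N (f s)"
  shows square_integrable_randomized_S: "square_integrable M (onS f)"
    and square_integrable_randomized_T: "square_integrable M (onT f)"
proof -
  have m: "f s \<in> borel_measurable PB" if "s \<in> J" for s
    using f[OF that] by (simp add: square_integrable_def measurable_N_eq)
  have m2: "(\<lambda>x. (f s x)\<^sup>2) \<in> borel_measurable PB" if "s \<in> J" for s
    using m[OF that] by (rule borel_measurable_power)
  have i: "integrable N (f s)" "integrable N (\<lambda>x. (f s x)\<^sup>2)" if "s \<in> J" for s
    by (rule N.P.square_integrable_integrable[OF f[OF that]], rule square_integrable_square[OF f[OF that]])
  have "integrable M (onS f)" "integrable M (\<lambda>\<omega>. (f (S \<omega>) (V \<omega>))\<^sup>2)"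
    by (rule integrable_randomized[of "\<lambda>s t. f s"], rule m, assumption, rule i, assumption)
       (rule integrable_randomized[of "\<lambda>s t x. (f s x)\<^sup>2"], rule m2, assumption, rule i, assumption)
  then show "square_integrable M (onS f)"
    by (simp add: square_integrable_def borel_measurable_integrable)
  have "integrable M (onT f)" "integrable M (\<lambda>\<omega>. (f (T \<omega>) (V \<omega>))\<^sup>2)"
    by (rule integrable_randomized[of "\<lambda>s t. f t"], rule m, assumption, rule i, assumption)
       (rule integrable_randomized[of "\<lambda>s t x. (f t x)\<^sup>2"], rule m2, assumption, rule i, assumption)
  then show "square_integrable M (onT f)"
    by (simp add: square_integrable_def borel_measurable_integrable)
qed

abbreviation inner_N :: "((nat \<Rightarrow> real) \<Rightarrow> real) \<Rightarrow> ((nat \<Rightarrow> real) \<Rightarrow> real) \<Rightarrow> real" where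
  "inner_N u v \<equiv> \<integral>x. u x * v x \<partial>N"

lemma
  fixes f g :: "nat set \<Rightarrow> (nat \<Rightarrow> real) \<Rightarrow> real"
  assumes f: "\<And>s. s \<in> J \<Longrightarrow> square_integrable N (f s)"
    and g: "\<And>t. t \<in> J \<Longrightarrow> square_integrable N (g t)"
  shows covar_randomized: "covar M (onS f) (onT g)
      = (\<Sum>s\<in>J. \<Sum>t\<in>J. p s t * inner_N (f s) (g t))
        - (\<Sum>s\<in>J. pS s * (\<integral>x. f s x \<partial>N)) * (\<Sum>t\<in>J. pT t * (\<integral>x. g t x \<partial>N))"
    and covar_randomized_S: "var M (onS f)
      = (\<Sum>s\<in>J. pS s * (\<integral>x. (f s x)\<^sup>2 \<partial>N)) - (\<Sum>s\<in>J. pS s * (\<integral>x. f s x \<partial>N))\<^sup>2"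
    and covar_randomized_T: "var M (onT g)
      = (\<Sum>t\<in>J. pT t * (\<integral>x. (g t x)\<^sup>2 \<partial>N)) - (\<Sum>t\<in>J. pT t * (\<integral>x. g t x \<partial>N))\<^sup>2"
proof -
  have m: "h s \<in> borel_measurable PB"
    if "\<And>s. s \<in> J \<Longrightarrow> square_integrable N (h s)" "s \<in> J" for h s
    using that(1)[OF that(2)] by (simp add: square_integrable_def measurable_N_eq)
  note mf = m[of f, OF f] and mg = m[of g, OF g]
  have i: "integrable N (f s)" "integrable N (\<lambda>x. (f s x)\<^sup>2)"
    "integrable N (g s)" "integrable N (\<lambda>x. (g s x)\<^sup>2)" if "s \<in> J" for s
    by (rule N.P.square_integrable_integrable[OF f[OF that]], rule square_integrable_square[OF f[OF that]],
        rule N.P.square_integrable_integrable[OF g[OF that]], rule square_integrable_square[OF g[OF that]])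
  have ES: "expectation (onS f) = (\<Sum>s\<in>J. pS s * (\<integral>x. f s x \<partial>N))"
    by (rule expectation_randomized_S) (use mf i in auto)
  have ET: "expectation (onT g) = (\<Sum>t\<in>J. pT t * (\<integral>x. g t x \<partial>N))"
    by (rule expectation_randomized_T) (use mg i in auto)
  have EST: "expectation (\<lambda>x. f (S x) (V x) * g (T x) (V x))
      = (\<Sum>s\<in>J. \<Sum>t\<in>J. p s t * inner_N (f s) (g t))"
    by (rule expectation_randomized[of "\<lambda>s t x. f s x * g t x"])
       (auto intro!: borel_measurable_times mf mg square_integrable_mult f g)
  have ESS: "expectation (\<lambda>x. (f (S x) (V x))\<^sup>2) = (\<Sum>s\<in>J. pS s * (\<integral>x. (f s x)\<^sup>2 \<partial>N))"
    by (rule expectation_randomized_S[of "\<lambda>s x. (f s x)\<^sup>2"]) (use mf i in \<open>auto intro!: borel_measurable_power\<close>)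
  have ETT: "expectation (\<lambda>x. (g (T x) (V x))\<^sup>2) = (\<Sum>t\<in>J. pT t * (\<integral>x. (g t x)\<^sup>2 \<partial>N))"
    by (rule expectation_randomized_T[of "\<lambda>s x. (g s x)\<^sup>2"]) (use mg i in \<open>auto intro!: borel_measurable_power\<close>)
  have sf: "square_integrable M (onS f)" by (rule square_integrable_randomized_S) (rule f)
  have sg: "square_integrable M (onT g)" by (rule square_integrable_randomized_T) (rule g)
  show "covar M (onS f) (onT g)
      = (\<Sum>s\<in>J. \<Sum>t\<in>J. p s t * inner_N (f s) (g t))
        - (\<Sum>s\<in>J. pS s * (\<integral>x. f s x \<partial>N)) * (\<Sum>t\<in>J. pT t * (\<integral>x. g t x \<partial>N))"
    unfolding covar_eq[OF sf sg] EST ES ET ..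
  show "var M (onS f)
      = (\<Sum>s\<in>J. pS s * (\<integral>x. (f s x)\<^sup>2 \<partial>N)) - (\<Sum>s\<in>J. pS s * (\<integral>x. f s x \<partial>N))\<^sup>2"
    unfolding covar_eq[OF sf sf] ES power2_eq_square[symmetric] ESS ..
  show "var M (onT g)
      = (\<Sum>t\<in>J. pT t * (\<integral>x. (g t x)\<^sup>2 \<partial>N)) - (\<Sum>t\<in>J. pT t * (\<integral>x. g t x \<partial>N))\<^sup>2"
    unfolding covar_eq[OF sg sg] ET power2_eq_square[symmetric] ETT ..
qed

section \<open>Best constants as bounds on bilinear forms over the sets containing an index\<close>

abbreviation bilin :: "(nat set \<Rightarrow> real) \<Rightarrow> (nat set \<Rightarrow> real) \<Rightarrow> real" where
  "bilin \<alpha> \<beta> \<equiv> \<Sum>s\<in>J. \<Sum>t\<in>J. p s t * \<alpha> s * \<beta> t"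

abbreviation normS :: "(nat set \<Rightarrow> real) \<Rightarrow> real" where
  "normS \<alpha> \<equiv> sqrt (\<Sum>s\<in>J. pS s * (\<alpha> s)\<^sup>2)"

abbreviation normT :: "(nat set \<Rightarrow> real) \<Rightarrow> real" where
  "normT \<beta> \<equiv> sqrt (\<Sum>t\<in>J. pT t * (\<beta> t)\<^sup>2)"

text \<open>The vectors are extended by 0, so that all sums run over the fixed index set
  \<open>J\<close>. This is the shape in which the martingale differences for coordinate
  \<open>j\<close> occur.\<close>

definition coordinate_bound :: "nat \<Rightarrow> real \<Rightarrow> bool" where
  "coordinate_bound j r \<longleftrightarrow> (\<forall>\<alpha> \<beta>. (\<forall>s. j \<notin> s \<longrightarrow> \<alpha> s = 0) \<longrightarrow> (\<forall>t. j \<notin> t \<longrightarrow> \<beta> t = 0) \<longrightarrow>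
     bilin \<alpha> \<beta>
     \<le> r * normS \<alpha> * normT \<beta>)"

lemma best_constant_eq: "best_constant M n S T j = Inf {r. 0 \<le> r \<and> coordinate_bound j r}"
proof -
  have one: "(\<Sum>(s, t) \<in> {(s, t). s \<subseteq> I \<and> t \<subseteq> I \<and> j \<in> s \<inter> t}. p s t * \<alpha> s * \<beta> t)
     = (\<Sum>s\<in>J. \<Sum>t\<in>J. p s t * (if j \<in> s then \<alpha> s else 0) * (if j \<in> t then \<beta> t else 0))"
    for \<alpha> \<beta> :: "nat set \<Rightarrow> real"
  proof -
    have "(\<Sum>s\<in>J. \<Sum>t\<in>J. p s t * (if j \<in> s then \<alpha> s else 0) * (if j \<in> t then \<beta> t else 0))
       = (\<Sum>(s, t) \<in> J \<times> J. p s t * (if j \<in> s then \<alpha> s else 0) * (if j \<in> t then \<beta> t else 0))"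
      by (simp add: sum.cartesian_product)
    also have "\<dots> = (\<Sum>(s, t) \<in> {(s, t). s \<subseteq> I \<and> t \<subseteq> I \<and> j \<in> s \<inter> t}. p s t * \<alpha> s * \<beta> t)"
      by (rule sum.mono_neutral_cong_right) (auto split: if_splits)
    finally show ?thesis by simp
  qed
  have two: "(\<Sum>s \<in> {s. s \<subseteq> I \<and> j \<in> s}. q s * (\<alpha> s)\<^sup>2)
     = (\<Sum>s\<in>J. q s * (if j \<in> s then \<alpha> s else 0)\<^sup>2)" for \<alpha> q :: "nat set \<Rightarrow> real"
    by (rule sum.mono_neutral_cong_left) (auto split: if_splits)
  have key: "(\<forall>\<alpha> \<beta>. (\<Sum>(s, t) \<in> {(s, t). s \<subseteq> I \<and> t \<subseteq> I \<and> j \<in> s \<inter> t}. p s t * \<alpha> s * \<beta> t)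
       \<le> r * sqrt (\<Sum>s \<in> {s. s \<subseteq> I \<and> j \<in> s}. pS s * (\<alpha> s)\<^sup>2)
           * sqrt (\<Sum>t \<in> {t. t \<subseteq> I \<and> j \<in> t}. pT t * (\<beta> t)\<^sup>2)) \<longleftrightarrow> coordinate_bound j r" (is "?L \<longleftrightarrow> ?R") for r
  proof
    assume L: ?L
    show ?R
      unfolding coordinate_bound_def
    proof (intro allI impI)
      fix \<alpha> \<beta> :: "nat set \<Rightarrow> real" assume "\<forall>s. j \<notin> s \<longrightarrow> \<alpha> s = 0" "\<forall>t. j \<notin> t \<longrightarrow> \<beta> t = 0"
      then have "(if j \<in> s then \<alpha> s else 0) = \<alpha> s" "(if j \<in> s then \<beta> s else 0) = \<beta> s" for s by auto
      with L[rule_format, of \<alpha> \<beta>, unfolded one two]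
      show "bilin \<alpha> \<beta>
        \<le> r * normS \<alpha> * normT \<beta>" by (simp only:)
    qed
  next
    assume R: ?R
    show ?L
    proof (intro allI)
      fix \<alpha> \<beta> :: "nat set \<Rightarrow> real"
      show "(\<Sum>(s, t) \<in> {(s, t). s \<subseteq> I \<and> t \<subseteq> I \<and> j \<in> s \<inter> t}. p s t * \<alpha> s * \<beta> t)
       \<le> r * sqrt (\<Sum>s \<in> {s. s \<subseteq> I \<and> j \<in> s}. pS s * (\<alpha> s)\<^sup>2)
           * sqrt (\<Sum>t \<in> {t. t \<subseteq> I \<and> j \<in> t}. pT t * (\<beta> t)\<^sup>2)"
        unfolding one two
        by (rule R[unfolded coordinate_bound_def, rule_format]) auto
    qed
  qed
  show ?thesis
    unfolding best_constant_def p_def[symmetric] pS_def[symmetric] pT_def[symmetric] by (simp only: key)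
qed

text \<open>The infimum is attained. For given vectors with product of norms \<open>c\<close> and
  form value \<open>L\<close>, every member of the set is at least \<open>L / c\<close> if
  \<open>c > 0\<close>, and its existence forces \<open>L \<le> 0\<close> if \<open>c = 0\<close>.
  The given \<open>r\<close> makes the set nonempty.\<close>

lemma coordinate_bound_best_constant:
  assumes r: "0 \<le> r" "coordinate_bound j r"
  shows "best_constant M n S T j \<le> r" "0 \<le> best_constant M n S T j"
    "coordinate_bound j (best_constant M n S T j)"
proof -
  define K where "K = {r. 0 \<le> r \<and> coordinate_bound j r}"
  have b: "best_constant M n S T j = Inf K" by (simp add: best_constant_eq K_def)
  have bdd: "bdd_below K" by (rule bdd_belowI[of _ 0]) (simp add: K_def)
  have ne: "K \<noteq> {}" using r by (auto simp: K_def)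
  show "best_constant M n S T j \<le> r" unfolding b using r bdd by (intro cInf_lower) (auto simp: K_def)
  show "0 \<le> best_constant M n S T j" unfolding b using ne by (intro cInf_greatest) (auto simp: K_def)
  show "coordinate_bound j (best_constant M n S T j)"
    unfolding coordinate_bound_def
  proof (intro allI impI)
    fix \<alpha> \<beta> :: "nat set \<Rightarrow> real" assume z: "\<forall>s. j \<notin> s \<longrightarrow> \<alpha> s = 0" "\<forall>t. j \<notin> t \<longrightarrow> \<beta> t = 0"
    define c where "c = normS \<alpha> * normT \<beta>"
    define L where "L = bilin \<alpha> \<beta>"
    have le: "L \<le> r * c" if "r \<in> K" for r
      using that z by (simp add: K_def coordinate_bound_def L_def c_def mult.assoc)
    have "c \<ge> 0"
      unfolding c_def using pS_nonneg pT_nonneg by (intro mult_nonneg_nonneg real_sqrt_ge_zero sum_nonneg) auto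
    have "L \<le> Inf K * c"
    proof (cases "c = 0")
      case True
      then show ?thesis using le ne by auto
    next
      case False
      then have "c > 0" using \<open>c \<ge> 0\<close> by simp
      then have "L / c \<le> Inf K" using le ne by (intro cInf_greatest) (auto simp: pos_divide_le_eq)
      then show ?thesis using \<open>c > 0\<close> by (simp add: pos_divide_le_eq)
    qed
    then show "L \<le> best_constant M n S T j * normS \<alpha> * normT \<beta>"
      by (simp add: b c_def mult.assoc)
  qed
qed

text \<open>For \<open>h\<close> standardizing \<open>X j\<close>, the functions \<open>\<alpha> S * h (X j)\<close> of \<open>(S, X_S)\<close> with \<open>\<alpha>\<close> supported
  on the sets containing \<open>j\<close> realize the inequality that defines the best constant for \<open>j\<close>.\<close>

definition coordinate_fun :: "nat \<Rightarrow> (real \<Rightarrow> real) \<Rightarrow> (nat set \<Rightarrow> real) \<Rightarrow> (nat \<Rightarrow> real option) \<Rightarrow> real" where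
  "coordinate_fun j h \<alpha> v = \<alpha> (unmasked n v) * case_option 0 h (v j)"

abbreviation coordS :: "nat \<Rightarrow> (real \<Rightarrow> real) \<Rightarrow> (nat set \<Rightarrow> real) \<Rightarrow> 'a \<Rightarrow> real" where
  "coordS j h \<alpha> \<equiv> \<lambda>\<omega>. coordinate_fun j h \<alpha> (masked n S X \<omega>)"

abbreviation coordT :: "nat \<Rightarrow> (real \<Rightarrow> real) \<Rightarrow> (nat set \<Rightarrow> real) \<Rightarrow> 'a \<Rightarrow> real" where
  "coordT j h \<alpha> \<equiv> \<lambda>\<omega>. coordinate_fun j h \<alpha> (masked n T X \<omega>)"

lemma coordinate_fun_measurable:
  assumes j: "j \<in> I" and h: "h \<in> borel_measurable borel"
  shows "coordinate_fun j h \<alpha> \<in> borel_measurable (masked_space n)"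
proof -
  have "(\<lambda>v. \<alpha> (unmasked n v)) \<in> borel_measurable (masked_space n)"
    by (rule measurable_compose[OF unmasked_measurable]) simp
  moreover have "(\<lambda>v. case_option 0 h (v j)) \<in> borel_measurable (masked_space n)"
    by (rule measurable_compose[OF measurable_component_singleton[OF j] case_option_measurable[OF h]])
  ultimately show ?thesis unfolding coordinate_fun_def by (rule borel_measurable_times)
qed

lemma coordinate_fun_mask:
  assumes "s \<in> J" "j \<in> I" "\<And>s. j \<notin> s \<Longrightarrow> \<alpha> s = 0"
  shows "coordinate_fun j h \<alpha> (mask n s x) = \<alpha> s * h (x j)"
proof -
  have "unmasked n (mask n s x) = s" using assms(1) by (intro unmasked_mask) simp
  moreover have "mask n s x j = (if j \<in> s then Some (x j) else None)"
    using assms(2) by (simp add: mask_def)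
  ultimately show ?thesis using assms(3)[of s] by (simp add: coordinate_fun_def)
qed

text \<open>Since \<open>h (X j)\<close> has mean 0 and second moment 1, the means drop out and only
  the forms in the coefficients remain.\<close>

lemma
  assumes j: "j \<in> I" and h: "h \<in> borel_measurable borel" "\<And>x. \<bar>h x\<bar> \<le> B"
    and e: "expectation (\<lambda>x. h (X j x)) = 0" "expectation (\<lambda>x. (h (X j x))\<^sup>2) = 1"
    and \<alpha>: "\<forall>s. j \<notin> s \<longrightarrow> \<alpha> s = 0" and \<beta>: "\<forall>t. j \<notin> t \<longrightarrow> \<beta> t = 0"
  shows square_integrable_coordinate_fun_S:
      "square_integrable M (coordS j h \<alpha>)"
    and square_integrable_coordinate_fun_T:
      "square_integrable M (coordT j h \<beta>)"
    and covar_coordinate_fun: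
      "covar M (coordS j h \<alpha>) (coordT j h \<beta>)
        = bilin \<alpha> \<beta>"
    and covar_coordinate_fun_S:
      "var M (coordS j h \<alpha>)
        = (\<Sum>s\<in>J. pS s * (\<alpha> s)\<^sup>2)"
    and covar_coordinate_fun_T:
      "var M (coordT j h \<beta>)
        = (\<Sum>t\<in>J. pT t * (\<beta> t)\<^sup>2)"
proof -
  have hj: "(\<lambda>x. h (x j)) \<in> borel_measurable PB"
    by (rule measurable_compose[OF measurable_component_singleton[OF j] h(1)])
  have Vj: "V \<omega> j = X j \<omega>" for \<omega> using j by (simp add: V_def)
  have E1: "(\<integral>x. h (x j) \<partial>N) = 0"
    using integral_N[OF hj] e by (simp add: Vj)
  have E2: "(\<integral>x. (h (x j))\<^sup>2 \<partial>N) = 1"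
    using integral_N[OF borel_measurable_power[OF hj]] e by (simp add: Vj)
  have sq: "square_integrable N (\<lambda>x. c * h (x j))" for c
    using hj h(2) by (intro square_integrable_cmult N.P.square_integrable_bounded[of _ B])
      (auto simp: measurable_N_eq)
  define f where "f = (\<lambda>s x. \<alpha> s * h (x j))"
  define g where "g = (\<lambda>t x. \<beta> t * h (x j))"
  have f: "square_integrable N (f s)" and g: "square_integrable N (g s)" for s
    using sq by (simp_all add: f_def g_def)
  have S_eq: "coordinate_fun j h \<alpha> (masked n S X \<omega>) = f (S \<omega>) (V \<omega>)" if "\<omega> \<in> space M" for \<omega>
    using nested[OF that] j \<alpha> unfolding masked_S[OF that] f_def by (intro coordinate_fun_mask) auto
  have T_eq: "coordinate_fun j h \<beta> (masked n T X \<omega>) = g (T \<omega>) (V \<omega>)" if "\<omega> \<in> space M" for \<omega>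
    using nested[OF that] j \<beta> unfolding masked_T[OF that] g_def by (intro coordinate_fun_mask) auto
  show "square_integrable M (coordS j h \<alpha>)"
    by (subst square_integrable_cong, rule S_eq, assumption)
       (rule square_integrable_randomized_S[of f, OF f])
  show "square_integrable M (coordT j h \<beta>)"
    by (subst square_integrable_cong, rule T_eq, assumption)
       (rule square_integrable_randomized_T[of g, OF g])
  have cov: "covar M (coordS j h \<alpha>) (coordT j h \<beta>) = covar M (onS f) (onT g)"
    "var M (coordS j h \<alpha>) = var M (onS f)"
    "var M (coordT j h \<beta>) = var M (onT g)"
    by (intro covar_cong S_eq T_eq; assumption)+
  have fg: "inner_N (f s) (g t) = \<alpha> s * \<beta> t" for s t
  proof -
    have "inner_N (f s) (g t) = (\<integral>x. \<alpha> s * \<beta> t * (h (x j))\<^sup>2 \<partial>N)"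
      by (simp add: f_def g_def power2_eq_square mult_ac)
    then show ?thesis by (simp add: E2)
  qed
  have ff: "(\<integral>x. (f s x)\<^sup>2 \<partial>N) = (\<alpha> s)\<^sup>2" and gg: "(\<integral>x. (g s x)\<^sup>2 \<partial>N) = (\<beta> s)\<^sup>2"
    and f0: "(\<integral>x. f s x \<partial>N) = 0" and g0: "(\<integral>x. g s x \<partial>N) = 0" for s
    by (simp_all add: f_def g_def power_mult_distrib E1 E2)
  show "covar M (coordS j h \<alpha>) (coordT j h \<beta>)
        = bilin \<alpha> \<beta>"
    unfolding cov(1) covar_randomized[of f g, OF f g] by (simp add: fg f0 g0 mult.assoc)
  show "var M (coordS j h \<alpha>)
        = (\<Sum>s\<in>J. pS s * (\<alpha> s)\<^sup>2)"
    unfolding cov(2) covar_randomized_S[of f g, OF f g] by (simp add: ff f0)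
  show "var M (coordT j h \<beta>)
        = (\<Sum>t\<in>J. pT t * (\<beta> t)\<^sup>2)"
    unfolding cov(3) covar_randomized_T[of f g, OF f g] by (simp add: gg g0)
qed

section \<open>The lower bound for the maximal correlation\<close>

abbreviation R_masked :: real where
  "R_masked \<equiv> maximal_correlation M (masked_space n) (masked n S X) (masked_space n) (masked n T X)"

abbreviation R_sets :: real where
  "R_sets \<equiv> maximal_correlation M (count_space J) S (count_space J) T"

lemmas masked_S_measurable = masked_measurable[OF S_measurable]
lemmas masked_T_measurable = masked_measurable[OF T_measurable]

lemma coordinate_bound_R_masked:
  assumes j: "j \<in> I"
  shows "coordinate_bound j R_masked"
  unfolding coordinate_bound_def
proof (intro allI impI)
  fix \<alpha> \<beta> :: "nat set \<Rightarrow> real" assume z: "\<forall>s. j \<notin> s \<longrightarrow> \<alpha> s = 0" "\<forall>t. j \<notin> t \<longrightarrow> \<beta> t = 0"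
  obtain h :: "real \<Rightarrow> real" and B where h: "h \<in> borel_measurable borel" "\<And>x. \<bar>h x\<bar> \<le> B"
    "expectation (\<lambda>x. h (X j x)) = 0" "expectation (\<lambda>x. (h (X j x))\<^sup>2) = 1"
    by (rule standardizing_function[OF continuous[OF j]]) blast
  note C = j h z
  show "bilin \<alpha> \<beta>
     \<le> R_masked * normS \<alpha> * normT \<beta>"
    using covar_le_maximal_correlation[where \<phi> = "coordinate_fun j h \<alpha>" and \<psi> = "coordinate_fun j h \<beta>",
        OF masked_S_measurable masked_T_measurable
        coordinate_fun_measurable[OF j h(1)] square_integrable_coordinate_fun_S[OF C]
        coordinate_fun_measurable[OF j h(1)] square_integrable_coordinate_fun_T[OF C]]
    unfolding covar_coordinate_fun[OF C] covar_coordinate_fun_S[OF C] covar_coordinate_fun_T[OF C] .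
qed

text \<open>Otherwise all \<open>p s t\<close> vanish, although they sum to 1.\<close>

lemma exists_likely_set: "\<exists>s\<in>J. s \<noteq> {} \<and> pS s > 0"
proof (rule ccontr)
  assume none: "\<not> ?thesis"
  have "p s t = 0" if "s \<in> J" for s t
  proof (rule ccontr)
    assume p: "p s t \<noteq> 0"
    then have "\<not> pS s > 0" using none p_nonzeroD(1)[OF p] that by blast
    then have "pS s = 0" using pS_nonneg[of s] by linarith
    then show False using p p_eq_0(1) by blast
  qed
  moreover have "expectation (\<lambda>x. 1) = (\<Sum>s\<in>J. \<Sum>t\<in>J. p s t * (\<integral>x. 1 \<partial>N))"
    by (rule expectation_randomized[of "\<lambda>s t x. 1"]) auto
  ultimately show False by (simp add: prob_space)
qed

definition through :: "nat \<Rightarrow> nat set \<Rightarrow> real" where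
  "through j s = (if j \<in> s then 1 else 0)"

text \<open>Because of \<open>S \<subseteq> T\<close>, an index in \<open>S\<close> is automatically
  in \<open>T\<close>, so both sums are the probability of \<open>j \<in> S\<close>.\<close>

lemma sum_pS_through_pos:
  assumes "s \<in> J" "pS s > 0" "j \<in> s"
  shows "(\<Sum>s\<in>J. pS s * (through j s)\<^sup>2) > 0"
    and "bilin (through j) (through j) > 0"
proof -
  show *: "(\<Sum>s\<in>J. pS s * (through j s)\<^sup>2) > 0"
    using assms pS_nonneg by (intro sum_pos2[of _ s]) (auto simp: through_def)
  have "bilin (through j) (through j)
      = (\<Sum>s\<in>J. \<Sum>t\<in>J. p s t * (through j s)\<^sup>2)"
    by (intro sum.cong refl) (use p_nonzeroD in \<open>fastforce simp: through_def\<close>)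
  also have "\<dots> = (\<Sum>s\<in>J. pS s * (through j s)\<^sup>2)"
    by (simp add: pS_eq_sum sum_distrib_right)
  finally show "bilin (through j) (through j) > 0" using * by simp
qed

text \<open>The vector \<open>through j\<close>, for an index \<open>j\<close> that \<open>S\<close>
  contains with positive probability, has a positive form value. Positivity provides a nonnegative
  candidate for the best constants and makes \<open>R^2\<close> times infinity infinite.\<close>

lemma R_masked_pos: "R_masked > 0"
proof -
  obtain s j where s: "s \<in> J" "pS s > 0" "j \<in> s" using exists_likely_set by blast
  then have j: "j \<in> I" by auto
  have "0 < bilin (through j) (through j)"
    by (rule sum_pS_through_pos[OF s])
  also have "\<dots> \<le> R_masked * normS (through j) * normT (through j)"
    using coordinate_bound_R_masked[OF j] by (simp add: coordinate_bound_def through_def)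
  also have "\<dots> = R_masked * (normS (through j) * normT (through j))"
    by (simp add: mult.assoc)
  finally have "0 < R_masked * (normS (through j) * normT (through j))"
    (is "0 < _ * ?c") .
  moreover have "?c \<ge> 0"
    using pS_nonneg pT_nonneg by (intro mult_nonneg_nonneg real_sqrt_ge_zero sum_nonneg) auto
  ultimately show ?thesis using mult_nonpos_nonneg[of R_masked ?c] by linarith
qed

text \<open>\<open>unmasked\<close> recovers both sets from the masked vectors, so each pair of test
  functions for the sets is also one for the masked vectors.\<close>

lemma R_sets_le_R_masked: "R_sets \<le> R_masked"
proof (rule maximal_correlation_le[OF S_measurable T_measurable])
  show "0 \<le> R_masked" using R_masked_pos by simp
  show "\<exists>\<phi>. admissible M (count_space J) S \<phi>" if "\<not> degenerate M S"
    using S_measurable that by (intro finite_range_admissible) auto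
  show "\<exists>\<phi>. admissible M (count_space J) T \<phi>" if "\<not> degenerate M T"
    using T_measurable that by (intro finite_range_admissible) auto
  fix \<phi> \<psi> :: "nat set \<Rightarrow> real"
  assume sq: "square_integrable M (\<lambda>\<omega>. \<phi> (S \<omega>))" "square_integrable M (\<lambda>\<omega>. \<psi> (T \<omega>))"
  have m: "(\<lambda>v. \<theta> (unmasked n v)) \<in> borel_measurable (masked_space n)" for \<theta> :: "nat set \<Rightarrow> real"
    by (rule measurable_compose[OF unmasked_measurable]) simp
  have S_eq: "\<phi> (unmasked n (masked n S X \<omega>)) = \<phi> (S \<omega>)" if "\<omega> \<in> space M" for \<omega>
    using nested[OF that] by (subst masked_S[OF that], subst unmasked_mask) auto
  have T_eq: "\<psi> (unmasked n (masked n T X \<omega>)) = \<psi> (T \<omega>)" if "\<omega> \<in> space M" for \<omega>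
    using nested[OF that] by (subst masked_T[OF that], subst unmasked_mask) auto
  have sq': "square_integrable M (\<lambda>\<omega>. \<phi> (unmasked n (masked n S X \<omega>)))"
    "square_integrable M (\<lambda>\<omega>. \<psi> (unmasked n (masked n T X \<omega>)))"
    by (subst square_integrable_cong, rule S_eq, assumption, rule sq)
       (subst square_integrable_cong, rule T_eq, assumption, rule sq)
  have cov: "covar M (\<lambda>\<omega>. \<phi> (unmasked n (masked n S X \<omega>))) (\<lambda>\<omega>. \<psi> (unmasked n (masked n T X \<omega>)))
      = covar M (\<lambda>\<omega>. \<phi> (S \<omega>)) (\<lambda>\<omega>. \<psi> (T \<omega>))"
    "var M (\<lambda>\<omega>. \<phi> (unmasked n (masked n S X \<omega>)))
      = var M (\<lambda>\<omega>. \<phi> (S \<omega>))"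
    "var M (\<lambda>\<omega>. \<psi> (unmasked n (masked n T X \<omega>)))
      = var M (\<lambda>\<omega>. \<psi> (T \<omega>))"
    by (intro covar_cong S_eq T_eq; assumption)+
  show "covar M (\<lambda>\<omega>. \<phi> (S \<omega>)) (\<lambda>\<omega>. \<psi> (T \<omega>)) \<le> R_masked
    * sqrt (var M (\<lambda>\<omega>. \<phi> (S \<omega>))) * sqrt (var M (\<lambda>\<omega>. \<psi> (T \<omega>)))"
    using covar_le_maximal_correlation[where \<phi> = "\<lambda>v. \<phi> (unmasked n v)" and \<psi> = "\<lambda>v. \<psi> (unmasked n v)",
        OF masked_S_measurable masked_T_measurable m[of \<phi>] sq'(1) m[of \<psi>] sq'(2)]
    unfolding cov .
qed

end

section \<open>The upper bound for the maximal correlation\<close>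

context nested_random_sets
begin

text \<open>The witnesses have coefficients \<open>through j\<close> and a standardizing
  \<open>h\<close>. Positivity of the variance on the side of \<open>T\<close> is indirect: were it
  0, the bound by \<open>R_masked\<close> would make a positive form value nonpositive.\<close>

lemma admissible_masked:
  shows "\<exists>\<phi>. admissible M (masked_space n) (masked n S X) \<phi>"
    and "\<exists>\<phi>. admissible M (masked_space n) (masked n T X) \<phi>"
proof -
  obtain s j where s: "s \<in> J" "pS s > 0" "j \<in> s" using exists_likely_set by blast
  then have j: "j \<in> I" by auto
  obtain h :: "real \<Rightarrow> real" and B where h: "h \<in> borel_measurable borel" "\<And>x. \<bar>h x\<bar> \<le> B"
    "expectation (\<lambda>x. h (X j x)) = 0" "expectation (\<lambda>x. (h (X j x))\<^sup>2) = 1"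
    by (rule standardizing_function[OF continuous[OF j]]) blast
  have z: "\<forall>s. j \<notin> s \<longrightarrow> through j s = 0" by (simp add: through_def)
  note C = j h z z
  have pos: "(\<Sum>s\<in>J. pS s * (through j s)\<^sup>2) > 0" by (rule sum_pS_through_pos(1)[OF s])
  have posT: "(\<Sum>t\<in>J. pT t * (through j t)\<^sup>2) > 0"
  proof (rule ccontr)
    assume "\<not> ?thesis"
    moreover have "(\<Sum>t\<in>J. pT t * (through j t)\<^sup>2) \<ge> 0"
      using pT_nonneg by (intro sum_nonneg) auto
    ultimately have "(\<Sum>t\<in>J. pT t * (through j t)\<^sup>2) = 0" by linarith
    moreover have "bilin (through j) (through j)
      \<le> R_masked * normS (through j) * normT (through j)"
      using coordinate_bound_R_masked[OF j] z unfolding coordinate_bound_def by blast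
    ultimately have "bilin (through j) (through j) \<le> 0" by simp
    then show False using sum_pS_through_pos(2)[OF s] by linarith
  qed
  show "\<exists>\<phi>. admissible M (masked_space n) (masked n S X) \<phi>"
    using coordinate_fun_measurable[OF j h(1)] square_integrable_coordinate_fun_S[OF C] pos
    unfolding covar_coordinate_fun_S[OF C, symmetric] by (intro exI[of _ "coordinate_fun j h (through j)"] admissibleI)
  show "\<exists>\<phi>. admissible M (masked_space n) (masked n T X) \<phi>"
    using coordinate_fun_measurable[OF j h(1)] square_integrable_coordinate_fun_T[OF C] posT
    unfolding covar_coordinate_fun_T[OF C, symmetric] by (intro exI[of _ "coordinate_fun j h (through j)"] admissibleI)
qed

lemma sum_covariance_le_coordinate_bound:
  fixes f g :: "nat set \<Rightarrow> (nat \<Rightarrow> real) \<Rightarrow> real"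
  assumes f: "\<And>s. s \<in> J \<Longrightarrow> square_integrable N (f s)"
    and g: "\<And>t. t \<in> J \<Longrightarrow> square_integrable N (g t)"
    and f_ignore: "\<And>s j x y. s \<in> J \<Longrightarrow> j \<notin> s \<Longrightarrow> f s (x(j := y)) = f s x"
    and g_ignore: "\<And>t j x y. t \<in> J \<Longrightarrow> j \<notin> t \<Longrightarrow> g t (x(j := y)) = g t x"
    and r: "0 \<le> r" "\<And>j. j \<in> I \<Longrightarrow> coordinate_bound j r"
  shows "(\<Sum>s\<in>J. \<Sum>t\<in>J. p s t * (inner_N (f s) (g t)
            - (\<integral>x. f s x \<partial>N) * (\<integral>x. g t x \<partial>N)))
    \<le> r * sqrt (\<Sum>s\<in>J. pS s * ((\<integral>x. (f s x)\<^sup>2 \<partial>N) - (\<integral>x. f s x \<partial>N)\<^sup>2))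
        * sqrt (\<Sum>t\<in>J. pT t * ((\<integral>x. (g t x)\<^sup>2 \<partial>N) - (\<integral>x. g t x \<partial>N)\<^sup>2))"
proof (rule N.sum_covariance_le)
  show "bilin \<alpha> \<beta>
       \<le> r * normS \<alpha> * normT \<beta>"
    if "j \<in> I" "\<And>s. j \<notin> s \<Longrightarrow> \<alpha> s = 0" "\<And>t. j \<notin> t \<Longrightarrow> \<beta> t = 0" for j \<alpha> \<beta>
    using r(2)[OF that(1)] that(2,3) unfolding coordinate_bound_def by blast
qed (use f g r pS_nonneg pT_nonneg in \<open>simp_all add: f_ignore g_ignore\<close>)

text \<open>\<open>U\<close> stands for \<open>S\<close> or \<open>T\<close>. On
  \<open>E s t\<close> it has a fixed value, and there the law of \<open>V\<close> is the product
  law up to the nonzero factor \<open>p s t\<close>, so integrability over this event is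
  integrability of the section.\<close>

lemma masked_section_square_integrable:
  assumes \<phi>: "\<phi> \<in> borel_measurable (masked_space n)"
    and sq: "integrable M (\<lambda>\<omega>. (\<phi> (mask n (U \<omega>) (V \<omega>)))\<^sup>2)"
    and p: "p s t \<noteq> 0" and U: "\<And>\<omega>. \<omega> \<in> E s t \<Longrightarrow> U \<omega> = u"
  shows "square_integrable N (\<lambda>x. \<phi> (mask n u x))"
proof -
  have m: "(\<lambda>x. \<phi> (mask n u x)) \<in> borel_measurable PB"
    by (rule measurable_compose[OF mask_measurable \<phi>])
  have "integrable M (\<lambda>\<omega>. indicator (E s t) \<omega> * (\<phi> (mask n (U \<omega>) (V \<omega>)))\<^sup>2)"
    using integrable_real_mult_indicator[OF E_sets sq, of s t] by (simp add: mult.commute)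
  also have "(\<lambda>\<omega>. indicator (E s t) \<omega> * (\<phi> (mask n (U \<omega>) (V \<omega>)))\<^sup>2)
      = (\<lambda>\<omega>. indicator (E s t) \<omega> * (\<phi> (mask n u (V \<omega>)))\<^sup>2)"
    using U by (auto simp: indicator_def)
  finally have "integrable N (\<lambda>x. (\<phi> (mask n u x))\<^sup>2)"
    using integrable_on_E[OF borel_measurable_power[OF m]] p by blast
  then show ?thesis using m by (simp add: square_integrable_def measurable_N_eq)
qed

lemma AE_likely:
  assumes U: "U \<in> measurable M (count_space J)"
  shows "AE \<omega> in M. prob {\<omega>' \<in> space M. U \<omega>' = U \<omega>} \<noteq> 0"
proof -
  have "AE \<omega> in M. \<forall>s\<in>J. prob {\<omega> \<in> space M. U \<omega> = s} = 0 \<longrightarrow> U \<omega> \<noteq> s"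
  proof (rule AE_finite_allI)
    fix s assume s: "s \<in> J"
    have ev: "{\<omega> \<in> space M. U \<omega> = s} \<in> sets M"
      using measurable_sets[OF U, of "{s}"] s by (simp add: vimage_def Int_def conj_commute)
    show "AE \<omega> in M. prob {\<omega> \<in> space M. U \<omega> = s} = 0 \<longrightarrow> U \<omega> \<noteq> s"
    proof (cases "prob {\<omega> \<in> space M. U \<omega> = s} = 0")
      case True
      then have "AE \<omega> in M. \<omega> \<notin> {\<omega> \<in> space M. U \<omega> = s}"
        using ev by (subst prob_eq_0[symmetric]) auto
      then show ?thesis using AE_space by eventually_elim auto
    qed simp
  qed simp
  then show ?thesis
    using AE_space by eventually_elim (use measurable_space[OF U] in \<open>auto simp: space_count_space\<close>)
qed

lemmas AE_likely_S = AE_likely[OF S_measurable, folded pS_def]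
lemmas AE_likely_T = AE_likely[OF T_measurable, folded pT_def]

lemma mask_ignore: "j \<notin> s \<Longrightarrow> mask n s (x(j := y)) = mask n s x"
  unfolding mask_def by (rule restrict_ext) auto

lemma R_masked_le:
  assumes r: "R_sets \<le> r" "0 \<le> r" "\<And>j. j \<in> I \<Longrightarrow> coordinate_bound j r"
  shows "R_masked \<le> r"
proof (rule maximal_correlation_le[OF masked_S_measurable masked_T_measurable r(2)])
  fix \<phi> \<psi> :: "(nat \<Rightarrow> real option) \<Rightarrow> real"
  assume \<phi>: "\<phi> \<in> borel_measurable (masked_space n)" and sq\<phi>: "square_integrable M (\<lambda>\<omega>. \<phi> (masked n S X \<omega>))"
    and \<psi>: "\<psi> \<in> borel_measurable (masked_space n)" and sq\<psi>: "square_integrable M (\<lambda>\<omega>. \<psi> (masked n T X \<omega>))"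
  \<comment> \<open>Square-integrability of the sections is guaranteed only at values of positive
    probability. Putting 0 at the others changes nothing almost surely.\<close>
  define f where "f s x = (if pS s = 0 then 0 else \<phi> (mask n s x))" for s x
  define g where "g t x = (if pT t = 0 then 0 else \<psi> (mask n t x))" for t x
  have int\<phi>: "integrable M (\<lambda>\<omega>. (\<phi> (mask n (S \<omega>) (V \<omega>)))\<^sup>2)"
    using sq\<phi> by (simp add: square_integrable_def masked_S cong: Bochner_Integration.integrable_cong)
  have int\<psi>: "integrable M (\<lambda>\<omega>. (\<psi> (mask n (T \<omega>) (V \<omega>)))\<^sup>2)"
    using sq\<psi> by (simp add: square_integrable_def masked_T cong: Bochner_Integration.integrable_cong)
  have f: "square_integrable N (f s)" if s: "s \<in> J" for s
  proof (cases "pS s = 0")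
    case True
    then show ?thesis by (simp add: f_def[abs_def] square_integrable_zero)
  next
    case False
    then obtain t where "p s t \<noteq> 0" using pS_eq_sum[OF s] by (metis sum.neutral)
    then have "square_integrable N (\<lambda>x. \<phi> (mask n s x))"
      by (rule masked_section_square_integrable[OF \<phi> int\<phi>]) (simp add: E_def)
    then show ?thesis using False by (simp add: f_def[abs_def])
  qed
  have g: "square_integrable N (g t)" if t: "t \<in> J" for t
  proof (cases "pT t = 0")
    case True
    then show ?thesis by (simp add: g_def[abs_def] square_integrable_zero)
  next
    case False
    then obtain s where "p s t \<noteq> 0" using pT_eq_sum[OF t] by (metis sum.neutral)
    then have "square_integrable N (\<lambda>x. \<psi> (mask n t x))"
      by (rule masked_section_square_integrable[OF \<psi> int\<psi>]) (simp add: E_def)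
    then show ?thesis using False by (simp add: g_def[abs_def])
  qed
  \<comment> \<open>At likely values, \<open>m s\<close> and \<open>m' t\<close> are the conditional
    means given \<open>S = s\<close> and given \<open>T = t\<close>.\<close>
  define m where "m s = (\<integral>x. f s x \<partial>N)" for s
  define m' where "m' t = (\<integral>x. g t x \<partial>N)" for t
  let ?mS = "\<lambda>\<omega>. m (S \<omega>)" and ?mT = "\<lambda>\<omega>. m' (T \<omega>)"
  have const: "square_integrable N (\<lambda>x. c)" for c by (rule N.P.square_integrable_const)
  have sqf: "square_integrable M (onS f)" by (rule square_integrable_randomized_S) (rule f)
  have sqg: "square_integrable M (onT g)" by (rule square_integrable_randomized_T) (rule g)
  have sqm: "square_integrable M ?mS"
    using square_integrable_randomized_S[of "\<lambda>s x. m s"] const by simp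
  have sqm': "square_integrable M ?mT"
    using square_integrable_randomized_T[of "\<lambda>s x. m' s"] const by simp
  have AEf: "AE \<omega> in M. \<phi> (masked n S X \<omega>) = f (S \<omega>) (V \<omega>)"
    using AE_likely_S AE_space by eventually_elim (simp add: f_def masked_S)
  have AEg: "AE \<omega> in M. \<psi> (masked n T X \<omega>) = g (T \<omega>) (V \<omega>)"
    using AE_likely_T AE_space by eventually_elim (simp add: g_def masked_T)
  note meas = sq\<phi>[THEN square_integrable_measurable] sqf[THEN square_integrable_measurable]
    sq\<psi>[THEN square_integrable_measurable] sqg[THEN square_integrable_measurable]
  let ?A = "\<lambda>\<omega>. \<phi> (masked n S X \<omega>)" and ?B = "\<lambda>\<omega>. \<psi> (masked n T X \<omega>)"
  \<comment> \<open>\<open>CS\<close>, \<open>CT\<close> and \<open>CST\<close> are the expected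
    conditional variances and covariance given the sets; \<open>AA\<close>, \<open>BB\<close> and
    \<open>AB\<close> below are the laws of total variance and covariance.\<close>
  define CS where "CS = (\<Sum>s\<in>J. pS s * ((\<integral>x. (f s x)\<^sup>2 \<partial>N) - (\<integral>x. f s x \<partial>N)\<^sup>2))"
  define CT where "CT = (\<Sum>t\<in>J. pT t * ((\<integral>x. (g t x)\<^sup>2 \<partial>N) - (\<integral>x. g t x \<partial>N)\<^sup>2))"
  define CST where "CST = (\<Sum>s\<in>J. \<Sum>t\<in>J. p s t * (inner_N (f s) (g t)
            - (\<integral>x. f s x \<partial>N) * (\<integral>x. g t x \<partial>N)))"
  have one: "(\<integral>x. c \<partial>N) = c" for c :: real by (simp add: N.P.prob_space)
  have AB: "covar M ?A ?B = CST + covar M ?mS ?mT"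
  proof -
    have "covar M ?A ?B = covar M (onS f) (onT g)"
      by (rule covar_cong_AE[OF AEf AEg meas])
    also have "\<dots> = (\<Sum>s\<in>J. \<Sum>t\<in>J. p s t * inner_N (f s) (g t))
        - (\<Sum>s\<in>J. pS s * m s) * (\<Sum>t\<in>J. pT t * m' t)"
      unfolding m_def m'_def by (rule covar_randomized[of f g, OF f g])
    also have "\<dots> = CST + covar M ?mS ?mT"
      using covar_randomized[of "\<lambda>s x. m s" "\<lambda>t x. m' t", OF const const] unfolding one
      by (simp add: CST_def m_def[symmetric] m'_def[symmetric] right_diff_distrib sum_subtractf)
    finally show ?thesis .
  qed
  have AA: "var M ?A = CS + var M ?mS"
  proof -
    have "var M ?A = var M (onS f)"
      by (rule covar_cong_AE[OF AEf AEf meas(1,2,1,2)])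
    also have "\<dots> = (\<Sum>s\<in>J. pS s * (\<integral>x. (f s x)\<^sup>2 \<partial>N)) - (\<Sum>s\<in>J. pS s * m s)\<^sup>2"
      unfolding m_def by (rule covar_randomized_S[of f g, OF f g])
    also have "\<dots> = CS + var M ?mS"
      using covar_randomized_S[of "\<lambda>s x. m s" "\<lambda>t x. m' t", OF const const] unfolding one
      by (simp add: CS_def m_def[symmetric] right_diff_distrib sum_subtractf)
    finally show ?thesis .
  qed
  have BB: "var M ?B = CT + var M ?mT"
  proof -
    have "var M ?B = var M (onT g)"
      by (rule covar_cong_AE[OF AEg AEg meas(3,4,3,4)])
    also have "\<dots> = (\<Sum>t\<in>J. pT t * (\<integral>x. (g t x)\<^sup>2 \<partial>N)) - (\<Sum>t\<in>J. pT t * m' t)\<^sup>2"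
      unfolding m'_def by (rule covar_randomized_T[of f g, OF f g])
    also have "\<dots> = CT + var M ?mT"
      using covar_randomized_T[of "\<lambda>s x. m s" "\<lambda>t x. m' t", OF const const] unfolding one
      by (simp add: CT_def m'_def[symmetric] right_diff_distrib sum_subtractf)
    finally show ?thesis .
  qed
  have CST: "CST \<le> r * sqrt CS * sqrt CT"
    unfolding CST_def CS_def CT_def
    by (rule sum_covariance_le_coordinate_bound[of f g, OF f g _ _ r(2,3)])
       (auto simp: f_def g_def mask_ignore)
  have "covar M ?mS ?mT \<le> R_sets
      * sqrt (var M ?mS) * sqrt (var M ?mT)"
    by (rule covar_le_maximal_correlation[OF S_measurable T_measurable _ sqm _ sqm']) auto
  also have "\<dots> \<le> r * sqrt (var M ?mS) * sqrt (var M ?mT)"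
    using r(1) covar_self_nonneg by (intro mult_right_mono) auto
  finally have "covar M ?A ?B \<le> r * (sqrt CS * sqrt CT
      + sqrt (var M ?mS) * sqrt (var M ?mT))"
    using CST by (simp add: AB distrib_left mult.assoc)
  also have "\<dots> \<le> r * (sqrt (var M ?A) * sqrt (var M ?B))"
    unfolding AA BB
  proof (intro mult_left_mono sqrt_mult_add_le covar_self_nonneg r(2))
    show "0 \<le> CS" "0 \<le> CT"
      unfolding CS_def CT_def using N.P.integral_square_le[OF f] N.P.integral_square_le[OF g] pS_nonneg pT_nonneg
      by (auto intro!: sum_nonneg mult_nonneg_nonneg)
  qed
  finally show "covar M ?A ?B \<le> r * sqrt (var M ?A) * sqrt (var M ?B)"
    by (simp add: mult.assoc)
qed (rule admissible_masked)+

text \<open>\<open>R_masked\<close> itself bounds every coordinate form. So the best constants are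
  infima of nonempty sets, lie below \<open>R_masked\<close> and are attained, which serves both
  directions.\<close>

theorem R_masked_eq: "R_masked = max R_sets (MAX j\<in>I. best_constant M n S T j)"
proof (rule antisym)
  note bc = coordinate_bound_best_constant[OF less_imp_le[OF R_masked_pos] coordinate_bound_R_masked]
  have ne: "(\<lambda>j. best_constant M n S T j) ` I \<noteq> {}" "finite ((\<lambda>j. best_constant M n S T j) ` I)"
    using I_nonempty by auto
  let ?r = "max R_sets (MAX j\<in>I. best_constant M n S T j)"
  have le: "best_constant M n S T j \<le> ?r" if "j \<in> I" for j
    using that ne(2) by (intro max.coboundedI2 Max_ge) auto
  show "R_masked \<le> ?r"
  proof (rule R_masked_le)
    obtain j where j: "j \<in> I" using I_nonempty by blast
    show "0 \<le> ?r" using order_trans[OF bc(2)[OF j] le[OF j]] .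
    show "coordinate_bound j ?r" if "j \<in> I" for j
      unfolding coordinate_bound_def
    proof (intro allI impI)
      fix \<alpha> \<beta> :: "nat set \<Rightarrow> real" assume "\<forall>s. j \<notin> s \<longrightarrow> \<alpha> s = 0" "\<forall>t. j \<notin> t \<longrightarrow> \<beta> t = 0"
      then have "bilin \<alpha> \<beta>
         \<le> best_constant M n S T j * normS \<alpha> * normT \<beta>"
        using bc(3)[OF that] unfolding coordinate_bound_def by blast
      also have "\<dots> \<le> ?r * normS \<alpha> * normT \<beta>"
        using le[OF that] pS_nonneg pT_nonneg
        by (intro mult_right_mono real_sqrt_ge_zero sum_nonneg mult_nonneg_nonneg) auto
      finally show "bilin \<alpha> \<beta>
         \<le> ?r * normS \<alpha> * normT \<beta>" .
    qed
  qed simp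
  show "?r \<le> R_masked"
    using R_sets_le_R_masked ne bc(1) by (intro max.boundedI Max.boundedI) auto
qed

end

section \<open>The inequality for Fisher information\<close>

context nested_random_sets
begin

abbreviation Y :: "nat set \<Rightarrow> 'a \<Rightarrow> real" where
  "Y s \<equiv> \<lambda>\<omega>. \<Sum>i\<in>s. X i \<omega>"

lemma sum_subset_measurable:
  assumes "s \<subseteq> I"
  shows "(\<lambda>x. \<Sum>i\<in>s. x i) \<in> borel_measurable (Pi\<^sub>M I (\<lambda>_. borel :: real measure))"
  using assms by (intro borel_measurable_sum measurable_component_singleton) auto

lemma sum_V: "s \<subseteq> I \<Longrightarrow> (\<Sum>i\<in>s. V \<omega> i) = (\<Sum>i\<in>s. X i \<omega>)"
  by (intro sum.cong) (auto simp: V_def)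

text \<open>Disjoint blocks of independent variables are independent. For \<open>s = t\<close> the
  second block is empty and its sum is the constant 0.\<close>

lemma indep_var_sums:
  assumes "s \<subseteq> t" "t \<subseteq> I"
  shows "indep_var borel (Y s) borel (\<lambda>\<omega>. \<Sum>i\<in>t - s. X i \<omega>)"
proof -
  have "indep_var (Pi\<^sub>M s (\<lambda>_. borel)) (\<lambda>\<omega>. \<lambda>i\<in>s. X i \<omega>) (Pi\<^sub>M (t - s) (\<lambda>_. borel)) (\<lambda>\<omega>. \<lambda>i\<in>t - s. X i \<omega>)"
    using assms by (intro indep_var_restrict[OF indep_X]) auto
  then have "indep_var borel ((\<lambda>x. \<Sum>i\<in>s. x i) \<circ> (\<lambda>\<omega>. \<lambda>i\<in>s. X i \<omega>))
      borel ((\<lambda>x. \<Sum>i\<in>t - s. x i) \<circ> (\<lambda>\<omega>. \<lambda>i\<in>t - s. X i \<omega>))"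
    by (rule indep_var_compose) (auto intro!: borel_measurable_sum measurable_component_singleton)
  then show ?thesis by (simp add: comp_def)
qed

lemma sum_split:
  assumes "s \<subseteq> t" "t \<subseteq> I"
  shows "(\<lambda>\<omega>. (\<Sum>i\<in>s. X i \<omega>) + (\<Sum>i\<in>t - s. X i \<omega>)) = (Y t)"
  using assms finite_subset[OF assms(2)] by (simp add: sum.subset_diff[of s t] add.commute)

lemma has_score_superset:
  assumes "s \<subseteq> t" "t \<subseteq> I" "has_score M (Y s) f k"
  obtains h l where "has_score M (Y t) h l"
  using has_score_add[OF prob_space_axioms indep_var_sums[OF assms(1,2)] assms(3)]
  unfolding sum_split[OF assms(1,2)] by metis

lemma score_superset_projection:
  assumes "s \<subseteq> t" "t \<subseteq> I" "has_score M (Y s) f k" "has_score M (Y t) h l"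
  shows "expectation (\<lambda>x. score f k (\<Sum>i\<in>s. X i x) * score h l (\<Sum>i\<in>t. X i x)) = (fisher_int h l)"
proof -
  have eq: "(\<Sum>i\<in>s. X i \<omega>) + (\<Sum>i\<in>t - s. X i \<omega>) = (\<Sum>i\<in>t. X i \<omega>)" for \<omega>
    using sum_split[OF assms(1,2)] by metis
  show ?thesis
    using score_add_projection[OF prob_space_axioms indep_var_sums[OF assms(1,2)] assms(3), of h l] assms(4)
    unfolding eq by simp
qed

text \<open>The function is 0 outside \<open>A\<close>, because a score is available only at indices
  in \<open>A\<close>; these will be the indices with nonzero probability and nonzero
  coefficient.\<close>

definition scaled_score ::
  "nat set set \<Rightarrow> (nat set \<Rightarrow> real) \<Rightarrow> (nat set \<Rightarrow> real \<Rightarrow> real) \<Rightarrow> (nat set \<Rightarrow> real \<Rightarrow> real)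
    \<Rightarrow> nat set \<Rightarrow> (nat \<Rightarrow> real) \<Rightarrow> real" where
  "scaled_score A c F K s x = (if s \<in> A then c s * score (F s) (K s) (\<Sum>i\<in>s. x i) else 0)"

lemma scaled_score_ignore: "j \<notin> s \<Longrightarrow> scaled_score A c F K s (x(j := y)) = scaled_score A c F K s x"
  by (auto simp: scaled_score_def intro!: arg_cong[where f = "score (F s) (K s)"] sum.cong)

lemma
  fixes c :: "nat set \<Rightarrow> real" and A :: "nat set set"
  assumes A: "\<forall>s\<in>A. s \<subseteq> I \<and> has_score M (Y s) (F s) (K s)"
  shows scaled_score_square_integrable: "square_integrable N (scaled_score A c F K s)"
    and scaled_score_integral: "(\<integral>x. scaled_score A c F K s x \<partial>N) = 0"
    and scaled_score_integral_square: "(\<integral>x. (scaled_score A c F K s x)\<^sup>2 \<partial>N)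
      = (if s \<in> A then (c s)\<^sup>2 * (fisher_int (F s) (K s)) else 0)"
proof -
  define f where "f = scaled_score A c F K"
  have "square_integrable N (f s) \<and> (\<integral>x. f s x \<partial>N) = 0 \<and>
    (\<integral>x. (f s x)\<^sup>2 \<partial>N) = (if s \<in> A then (c s)\<^sup>2 * (fisher_int (F s) (K s)) else 0)"
  proof (cases "s \<in> A")
    case False
    then show ?thesis by (simp add: f_def scaled_score_def[abs_def] square_integrable_zero)
  next
    case True
    then have s: "s \<subseteq> I" and sc: "has_score M (Y s) (F s) (K s)" using A by auto
    let ?\<rho> = "\<lambda>x. score (F s) (K s) (\<Sum>i\<in>s. x i)"
    have m: "?\<rho> \<in> borel_measurable PB"
      by (rule measurable_compose[OF sum_subset_measurable[OF s] score_measurable[OF sc]])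
    have m2: "(\<lambda>x. (?\<rho> x)\<^sup>2) \<in> borel_measurable PB"
      by (rule borel_measurable_power[OF m])
    have sq: "square_integrable N ?\<rho>"
      using square_integrable_square[OF square_integrable_score[OF sc]] m
      by (simp add: square_integrable_def measurable_N_eq integrable_N[OF m2] sum_V[OF s])
    have 0: "(\<integral>x. ?\<rho> x \<partial>N) = 0"
      using integral_score[OF prob_space_axioms sc] by (simp add: integral_N[OF m] sum_V[OF s])
    have 2: "(\<integral>x. (?\<rho> x)\<^sup>2 \<partial>N) = (fisher_int (F s) (K s))"
      using integral_score_square[OF sc] by (simp add: integral_N[OF m2] sum_V[OF s])
    show ?thesis
      using True square_integrable_cmult[OF sq, of "c s"] by (simp add: f_def scaled_score_def[abs_def] power_mult_distrib 0 2)
  qed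
  then show "square_integrable N (scaled_score A c F K s)" "(\<integral>x. scaled_score A c F K s x \<partial>N) = 0"
    "(\<integral>x. (scaled_score A c F K s x)\<^sup>2 \<partial>N)
      = (if s \<in> A then (c s)\<^sup>2 * (fisher_int (F s) (K s)) else 0)"
    unfolding f_def by blast+
qed

text \<open>Outside \<open>A\<close> a term is 0 even if its Fisher information is infinite, as 0
  times infinity is 0 for \<open>ennreal\<close>; inside \<open>A\<close> all factors are
  finite.\<close>

lemma weighted_fisher_information_eq:
  fixes c q :: "nat set \<Rightarrow> real"
  assumes q: "\<And>s. q s \<ge> 0" and A: "A = {s \<in> J. q s \<noteq> 0 \<and> c s \<noteq> 0}"
    and sc: "\<And>s. s \<in> A \<Longrightarrow> has_score M (Y s) (F s) (K s)"
  shows "(\<Sum>s\<in>J. ennreal (q s) * fisher_information M (Y s) * ennreal ((c s)\<^sup>2))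
    = ennreal (\<Sum>s\<in>J. q s * (if s \<in> A then (c s)\<^sup>2 * (fisher_int (F s) (K s)) else 0))"
proof -
  have nn: "0 \<le> (fisher_int (F s) (K s))" if "s \<in> A" for s
    using has_scoreD(3)[OF sc[OF that]] by simp
  have "ennreal (q s) * fisher_information M (Y s) * ennreal ((c s)\<^sup>2)
      = ennreal (q s * (if s \<in> A then (c s)\<^sup>2 * (fisher_int (F s) (K s)) else 0))"
    if "s \<in> J" for s
  proof (cases "s \<in> A")
    case True
    then show ?thesis
      using q[of s] nn[OF True]
      by (simp add: has_score_fisher_information[OF sc[OF True]] mult_ac flip: ennreal_mult)
  next
    case False
    then have "q s = 0 \<or> c s = 0" using that A by auto
    then show ?thesis using False by auto
  qed
  then have "(\<Sum>s\<in>J. ennreal (q s) * fisher_information M (Y s) * ennreal ((c s)\<^sup>2))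
    = (\<Sum>s\<in>J. ennreal (q s * (if s \<in> A then (c s)\<^sup>2 * (fisher_int (F s) (K s)) else 0)))"
    by (rule sum.cong[OF refl])
  also have "\<dots> = ennreal (\<Sum>s\<in>J. q s * (if s \<in> A then (c s)\<^sup>2 * (fisher_int (F s) (K s)) else 0))"
    using q nn by (intro sum_ennreal) auto
  finally show ?thesis .
qed

text \<open>\<open>mu\<close> is specified through the products \<open>pT t * mu t\<close>, which
  avoids conditioning on events of probability 0.\<close>

theorem fisher_information_inequality:
  fixes lam mu :: "nat set \<Rightarrow> real"
  assumes mu: "\<And>t. t \<subseteq> I \<Longrightarrow> pT t * mu t = (\<Sum>s\<in>J. p s t * lam s)"
    and r: "0 < r" "\<And>j. j \<in> I \<Longrightarrow> coordinate_bound j r"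
  shows "(\<Sum>t\<in>J. ennreal (pT t) * fisher_information M (Y t) * ennreal ((mu t)\<^sup>2))
    \<le> ennreal (r\<^sup>2) * (\<Sum>s\<in>J. ennreal (pS s) * fisher_information M (Y s) * ennreal ((lam s)\<^sup>2))"
    (is "?L \<le> _ * ?R")
proof -
  define A where "A = {s \<in> J. pS s \<noteq> 0 \<and> lam s \<noteq> 0}"
  define B where "B = {t \<in> J. pT t \<noteq> 0 \<and> mu t \<noteq> 0}"
  show ?thesis
  proof (cases "\<forall>s\<in>A. fisher_information M (Y s) < \<top>")
    case False
    then obtain s where s: "s \<in> A" "fisher_information M (Y s) = \<top>"
      using less_top by metis
    then have "ennreal (pS s) * fisher_information M (Y s) * ennreal ((lam s)\<^sup>2) = \<top>"
      using pS_nonneg[of s] by (auto simp: A_def ennreal_mult_top ennreal_top_mult)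
    moreover have "ennreal (pS s) * fisher_information M (Y s) * ennreal ((lam s)\<^sup>2) \<le> ?R"
      using s by (intro member_le_sum) (auto simp: A_def)
    ultimately have R: "?R = \<top>" by (simp only: top_unique)
    \<comment> \<open>Here \<open>r > 0\<close> is essential: an infinite term at a contributing
      \<open>s\<close> settles the inequality only if the factor in front is not 0.\<close>
    have "ennreal (r\<^sup>2) * \<top> = \<top>" using r(1) by (simp add: ennreal_mult_top)
    then show ?thesis unfolding R by (simp only: top_greatest)
  next
    case True
    then have "\<forall>s\<in>A. \<exists>f k. has_score M (Y s) f k"
      using fisher_information_finite_has_score[OF prob_space_axioms] by metis
    then obtain F K where FK: "\<And>s. s \<in> A \<Longrightarrow> has_score M (Y s) (F s) (K s)"
      by metis
    have "\<exists>h l. has_score M (Y t) h l" if t: "t \<in> B" for t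
    proof -
      \<comment> \<open>A nonzero \<open>mu t\<close> stems from some \<open>s \<subseteq> t\<close>
        with \<open>p s t * lam s \<noteq> 0\<close>. The sum over this \<open>s\<close> has a
        score, and adding the remaining independent variables preserves that property.\<close>
      have "(\<Sum>s\<in>J. p s t * lam s) \<noteq> 0"
        using t mu[of t] by (auto simp: B_def)
      then obtain s where s: "s \<in> J" "p s t * lam s \<noteq> 0"
        by (rule sum.not_neutral_contains_not_neutral)
      then have sA: "s \<in> A" using p_eq_0(1)[of s t] by (auto simp: A_def)
      have "s \<subseteq> t" "t \<subseteq> I" using p_nonzeroD(2,3)[of s t] s by auto
      then show ?thesis by (rule has_score_superset[OF _ _ FK[OF sA]]) blast
    qed
    then obtain G L where GL: "\<And>t. t \<in> B \<Longrightarrow> has_score M (Y t) (G t) (L t)"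
      by metis
    define f where "f = scaled_score A lam F K"
    define g where "g = scaled_score B mu G L"
    define IG where "IG t = (fisher_int (G t) (L t))" for t
    have AF: "\<forall>s\<in>A. s \<subseteq> I \<and> has_score M (Y s) (F s) (K s)"
      using FK by (auto simp: A_def)
    have BG: "\<forall>t\<in>B. t \<subseteq> I \<and> has_score M (Y t) (G t) (L t)"
      using GL by (auto simp: B_def)
    note f = scaled_score_square_integrable[where A = A and F = F and K = K and c = lam, OF AF, folded f_def]
      scaled_score_integral[where A = A and F = F and K = K and c = lam, OF AF, folded f_def]
      scaled_score_integral_square[where A = A and F = F and K = K and c = lam, OF AF, folded f_def]
    note g = scaled_score_square_integrable[where A = B and F = G and K = L and c = mu, OF BG, folded g_def]
      scaled_score_integral[where A = B and F = G and K = L and c = mu, OF BG, folded g_def]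
      scaled_score_integral_square[where A = B and F = G and K = L and c = mu, OF BG, folded g_def]
    define P where "P = (\<Sum>s\<in>J. pS s * (\<integral>x. (f s x)\<^sup>2 \<partial>N))"
    define Q where "Q = (\<Sum>t\<in>J. pT t * (\<integral>x. (g t x)\<^sup>2 \<partial>N))"
    have "(\<Sum>s\<in>J. \<Sum>t\<in>J. p s t * inner_N (f s) (g t)) \<le> r * sqrt P * sqrt Q"
    proof -
      have "f s (x(j := y)) = f s x" "g s (x(j := y)) = g s x" if "j \<notin> s" for s j x y
        using scaled_score_ignore[OF that] by (simp_all add: f_def g_def)
      from sum_covariance_le_coordinate_bound[of f g, OF f(1) g(1) this less_imp_le[OF r(1)] r(2)]
      show ?thesis by (simp add: f(2) g(2) P_def Q_def)
    qed
    also have "(\<Sum>s\<in>J. \<Sum>t\<in>J. p s t * inner_N (f s) (g t))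
        = (\<Sum>t\<in>J. \<Sum>s\<in>J. p s t * inner_N (f s) (g t))" by (rule sum.swap)
    \<comment> \<open>By the projection property a pair with \<open>p s t * lam s \<noteq> 0\<close>
      has inner product \<open>lam s * mu t\<close> times the Fisher information of the sum over
      \<open>t\<close>; summing \<open>p s t * lam s\<close> over \<open>s\<close> gives
      \<open>pT t * mu t\<close>, hence the second factor \<open>mu t\<close>.\<close>
    also have "\<dots> = Q"
      unfolding Q_def
    proof (rule sum.cong[OF refl])
      fix t assume t: "t \<in> J"
      show "(\<Sum>s\<in>J. p s t * inner_N (f s) (g t)) = pT t * (\<integral>x. (g t x)\<^sup>2 \<partial>N)"
      proof (cases "t \<in> B")
        case False
        then show ?thesis by (simp add: g_def scaled_score_def)
      next
        case True
        have "p s t * inner_N (f s) (g t) = p s t * lam s * (mu t * IG t)" for s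
        proof (cases "p s t = 0 \<or> lam s = 0")
          case True
          then show ?thesis by (auto simp: f_def scaled_score_def A_def)
        next
          case False
          then have st: "s \<subseteq> t" "t \<subseteq> I" using p_nonzeroD(2,3)[of s t] by auto
          then have s: "s \<in> A" using False p_eq_0(1)[of s t] by (auto simp: A_def)
          have sI: "s \<subseteq> I" using st by auto
          let ?\<rho> = "\<lambda>x. score (F s) (K s) (\<Sum>i\<in>s. x i) * score (G t) (L t) (\<Sum>i\<in>t. x i)"
          have m: "?\<rho> \<in> borel_measurable PB"
            by (rule borel_measurable_times)
               (rule measurable_compose[OF sum_subset_measurable[OF sI] score_measurable[OF FK[OF s]]],
                rule measurable_compose[OF sum_subset_measurable[OF st(2)] score_measurable[OF GL[OF \<open>t \<in> B\<close>]]])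
          have "(\<integral>x. ?\<rho> x \<partial>N) = IG t"
            using score_superset_projection[OF st FK[OF s] GL[OF \<open>t \<in> B\<close>]]
            by (simp add: integral_N[OF m] sum_V[OF sI] sum_V[OF st(2)] IG_def)
          moreover have "inner_N (f s) (g t) = (\<integral>x. lam s * mu t * ?\<rho> x \<partial>N)"
            using s \<open>t \<in> B\<close> by (simp add: f_def g_def scaled_score_def mult_ac)
          ultimately show ?thesis by simp
        qed
        then have "(\<Sum>s\<in>J. p s t * inner_N (f s) (g t)) = (\<Sum>s\<in>J. p s t * lam s) * (mu t * IG t)"
          by (simp only: sum_distrib_right)
        also have "\<dots> = pT t * (\<integral>x. (g t x)\<^sup>2 \<partial>N)"
          using mu[of t] t True unfolding g(3) IG_def by (simp add: power2_eq_square)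
        finally show ?thesis .
      qed
    qed
    finally have Q_le: "Q \<le> r * sqrt P * sqrt Q" .
    have "P \<ge> 0" "Q \<ge> 0"
      unfolding P_def Q_def using pS_nonneg pT_nonneg by (auto intro!: sum_nonneg)
    have "Q \<le> r\<^sup>2 * P"
    proof (cases "Q = 0")
      case False
      then have "sqrt Q > 0" using \<open>Q \<ge> 0\<close> by simp
      moreover have "sqrt Q * sqrt Q \<le> r * sqrt P * sqrt Q" using Q_le \<open>Q \<ge> 0\<close> by simp
      ultimately have "sqrt Q \<le> r * sqrt P" by (simp only: mult_le_cancel_right_pos)
      then have "(sqrt Q)\<^sup>2 \<le> (r * sqrt P)\<^sup>2" using \<open>Q \<ge> 0\<close> by (intro power_mono) auto
      then show ?thesis using \<open>P \<ge> 0\<close> \<open>Q \<ge> 0\<close> by (simp add: power_mult_distrib)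
    qed (use \<open>P \<ge> 0\<close> in auto)
    moreover have "?L = ennreal Q"
      unfolding Q_def g(3) by (rule weighted_fisher_information_eq[OF pT_nonneg B_def GL])
    moreover have "?R = ennreal P"
      unfolding P_def f(3) by (rule weighted_fisher_information_eq[OF pS_nonneg A_def FK])
    ultimately show ?thesis
      using \<open>P \<ge> 0\<close> by (simp add: ennreal_leI flip: ennreal_mult)
  qed
qed

end

theorem theorem1p8:
  fixes M :: "'a measure" and n :: nat
    and X :: "nat \<Rightarrow> 'a \<Rightarrow> real"
    and S T :: "'a \<Rightarrow> nat set"
    and R :: real
    and lam mu :: "nat set \<Rightarrow> real"
  assumes "prob_space M"
    and "\<And>i. i \<in> {1..n} \<Longrightarrow> continuous_rv M (X i)"
    and "prob_space.indep_vars M (\<lambda>_. borel) X {1..n}"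
    and "\<And>\<omega>. \<omega> \<in> space M \<Longrightarrow> S \<omega> \<noteq> {} \<and> S \<omega> \<subseteq> T \<omega> \<and> T \<omega> \<subseteq> {1..n}"
    and "indep_elements M
           (count_space (Pow {1..n} \<times> Pow {1..n})) (\<lambda>\<omega>. (S \<omega>, T \<omega>))
           (Pi\<^sub>M {1..n} (\<lambda>_. borel)) (\<lambda>\<omega>. \<lambda>i\<in>{1..n}. X i \<omega>)"
    and "R = maximal_correlation M (masked_space n) (masked n S X) (masked_space n) (masked n T X)"
    and "\<And>t. t \<subseteq> {1..n} \<Longrightarrow>
           mu t = (\<Sum>s \<in> Pow {1..n}. \<P>(\<omega> in M. S \<omega> = s \<bar> T \<omega> = t) * lam s)"
  shows "R = max (maximal_correlation M (count_space (Pow {1..n})) S (count_space (Pow {1..n})) T)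
                 (MAX j\<in>{1..n}. best_constant M n S T j)
    \<and> (\<Sum>t \<in> Pow {1..n}. ennreal (\<P>(\<omega> in M. T \<omega> = t))
           * fisher_information M (\<lambda>\<omega>. \<Sum>j\<in>t. X j \<omega>) * ennreal ((mu t)\<^sup>2))
      \<le> ennreal (R\<^sup>2) * (\<Sum>s \<in> Pow {1..n}. ennreal (\<P>(\<omega> in M. S \<omega> = s))
           * fisher_information M (\<lambda>\<omega>. \<Sum>i\<in>s. X i \<omega>) * ennreal ((lam s)\<^sup>2))"
proof -
  interpret nested_random_sets M n X S T
    using assms(1-5) by (intro nested_random_sets.intro nested_random_sets_axioms.intro)
  have mu: "pT t * mu t = (\<Sum>s\<in>Pow {1..n}. p s t * lam s)" if "t \<subseteq> {1..n}" for t
  proof -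
    \<comment> \<open>If \<open>pT t = 0\<close>, the right-hand side vanishes too, as
      \<open>p s t \<le> pT t\<close>; otherwise the factor cancels the denominator of the
      conditional probability.\<close>
    have "pT t * (\<P>(\<omega> in M. S \<omega> = s \<bar> T \<omega> = t) * lam s) = p s t * lam s" for s
      using p_eq_0(2)[of t s] by (cases "pT t = 0") (simp_all add: cond_prob_def p_def pT_def)
    then show ?thesis by (simp only: assms(7)[OF that] sum_distrib_left)
  qed
  show ?thesis
    using R_masked_eq fisher_information_inequality[OF mu R_masked_pos coordinate_bound_R_masked]
    by (simp only: assms(6) pS_def pT_def)
qed

end
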